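(* Let $1\le p\le2$, $p^{-1}+p'^{-1}=1$ and $\lambda\ge0$. (a) Suppose $f$ is a real-valued Lipschitz function on an interval $I\subset\mathbb{R}_+$ with Lipschitz constant $\lambda$, i.e. $$|f(x_1)-f(x_2)|\le\lambda|x_1-x_2|\quad\text{for all }x_1,x_2\in I.\qquad( * )$$ Let $\gamma=\{x+if(x)\mid x\in I\}$ be the graph of $f$. Then the operator $\mathcal{L}_\gamma$ (the Laplace transform restricted to $\gamma$) acts continuously from $L^p(\mathbb{R}_+)$ to $L^{p'}(\gamma)$. Moreover, the following uniform estimate holds: $$\sup_{f\text{ satisfies }( * )}\|\mathcal{L}_\gamma\|_{L^p(\mathbb{R}_+)\to L^{p'}(\gamma)}\le\big(32\,\pi\,(1+\lambda^2)\big)^{1/p'}.$$ (b) If $f\ge0$ is a Lipschitz function satisfying $( * )$ on an interval $I\subset\mathbb{R}$ and $\hat\gamma=\{f(x)+ix\mid x\in I\}$ is the graph of $f$ with the axes interchanged, then we have the uniform estimate $$\sup_{f\ge0,\ f\text{ satisfies }( * )}\|\mathcal{L}_{\hat\gamma}\|_{L^p(\mathbb{R}_+)\to L^{p'}(\hat\gamma)}\le\big(36\cdot32\,\pi\,(1+\lambda^2)\big)^{1/p'}.$$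
   Context: $\mathbb{R}_+=(0,\infty)$. For a rectifiable curve $\gamma$ in the closed right half-plane, $\mathcal{L}_\gamma f$ is the restriction to $\gamma$ of the Laplace transform $\mathcal{L}f(z)=\int_0^\infty f(t)e^{-zt}\,dt$ (as an operator on $L^p(\mathbb{R}_+)$, understood as the extension by continuity from $L^1(\mathbb{R}_+)\cap L^p(\mathbb{R}_+)$), and $L^{p'}(\gamma)$ is taken with respect to arclength measure on $\gamma$. *)

theory Defs
  imports "HOL-Analysis.Analysis" "HOL-Probability.Essential_Supremum"
begin

text \<open>
  Elements of a Lebesgue space are represented by measurable functions, not by classes modulo
  null sets; all statements about them are therefore up to almost-everywhere equality.
  Exponents are extended nonnegative reals, so that \<open>p = \<infinity>\<close> is included.
\<close>

definition Lp_norm :: "ennreal \<Rightarrow> 'a measure \<Rightarrow> ('a \<Rightarrow> complex) \<Rightarrow> ennreal" where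
  "Lp_norm p M g =
     (if p = \<infinity> then esssup M (\<lambda>x. ennreal (norm (g x)))
      else let J = \<integral>\<^sup>+x. ennreal (norm (g x) powr enn2real p) \<partial>M
           in if J = \<infinity> then \<infinity> else ennreal (enn2real J powr (1 / enn2real p)))"

definition Lp :: "ennreal \<Rightarrow> 'a measure \<Rightarrow> ('a \<Rightarrow> complex) set" where
  "Lp p M = {g \<in> borel_measurable M. Lp_norm p M g < \<infinity>}"

text \<open>
  Compatibility of \<open>T\<close> with almost-everywhere equality is not demanded separately: it follows from
  linearity and boundedness.
\<close>

definition bounded_linear_Lp ::
  "ennreal \<Rightarrow> 'a measure \<Rightarrow> ennreal \<Rightarrow> 'b measure \<Rightarrow> (('a \<Rightarrow> complex) \<Rightarrow> 'b \<Rightarrow> complex) \<Rightarrow> bool" where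
  "bounded_linear_Lp p M q N T \<longleftrightarrow>
     (\<forall>g\<in>Lp p M. T g \<in> Lp q N) \<and>
     (\<forall>g\<in>Lp p M. \<forall>h\<in>Lp p M. AE y in N. T (\<lambda>x. g x + h x) y = T g y + T h y) \<and>
     (\<forall>c. \<forall>g\<in>Lp p M. AE y in N. T (\<lambda>x. c * g x) y = c * T g y) \<and>
     (\<exists>C::real. \<forall>g\<in>Lp p M. Lp_norm q N (T g) \<le> ennreal C * Lp_norm p M g)"

definition Lp_opnorm ::
  "ennreal \<Rightarrow> 'a measure \<Rightarrow> ennreal \<Rightarrow> 'b measure \<Rightarrow> (('a \<Rightarrow> complex) \<Rightarrow> 'b \<Rightarrow> complex) \<Rightarrow> ennreal" where
  "Lp_opnorm p M q N T = (SUP g \<in> {g \<in> Lp p M. Lp_norm p M g \<le> 1}. Lp_norm q N (T g))"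

abbreviation lebesgue_pos :: "real measure" where
  "lebesgue_pos \<equiv> lebesgue_on {0<..}"

definition laplace :: "(real \<Rightarrow> complex) \<Rightarrow> complex \<Rightarrow> complex" where
  "laplace g z = (LINT t|lebesgue_pos. g t * exp (- (z * of_real t)))"

text \<open>
  A partition of \<open>{a..b}\<close> is encoded as a monotone sequence in \<open>{a..b}\<close> of which only the
  first \<open>n + 1\<close> terms are used.
\<close>

definition curve_length :: "(real \<Rightarrow> complex) \<Rightarrow> real \<Rightarrow> real \<Rightarrow> ennreal" where
  "curve_length c a b =
     (SUP (t, n) \<in> {t :: nat \<Rightarrow> real. mono t \<and> range t \<subseteq> {a..b}} \<times> UNIV.
        \<Sum>i<n. ennreal (dist (c (t i)) (c (t (Suc i)))))"

text \<open>
  On the parameter interval \<open>I\<close>, arclength is the measure giving each \<open>{a..b} \<subseteq> I\<close> the length of the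
  curve over \<open>{a..b}\<close>. Closed intervals (including the points \<open>{a..a}\<close>) are used as generators, because
  half-open ones would leave the mass of an endpoint of \<open>I\<close> undetermined. For an injective curve
  \<open>c\<close> the push-forward is arclength measure on the set \<open>c ` I\<close>.
\<close>

definition arclength_measure :: "real set \<Rightarrow> (real \<Rightarrow> complex) \<Rightarrow> complex measure" where
  "arclength_measure I c =
     distr (extend_measure I {(a, b). a \<le> b \<and> {a..b} \<subseteq> I} (\<lambda>(a, b). {a..b})
              (\<lambda>(a, b). curve_length c a b))
           (restrict_space borel (c ` I)) c"

definition graph_curve :: "(real \<Rightarrow> real) \<Rightarrow> real \<Rightarrow> complex" where
  "graph_curve f x = Complex x (f x)"

definition swapped_graph_curve :: "(real \<Rightarrow> real) \<Rightarrow> real \<Rightarrow> complex" where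
  "swapped_graph_curve f x = Complex (f x) x"

text \<open>
  The Laplace transform restricted to a curve with arclength measure \<open>N\<close>, extended by continuity
  from \<open>L\<^sup>1 \<inter> L\<^sup>p\<close> to \<open>L\<^sup>p\<close>. For \<open>p < \<infinity>\<close> density makes such an extension unique up to null sets if it
  exists; its existence is exactly continuity of the operator.
\<close>

definition is_laplace_extension ::
  "ennreal \<Rightarrow> ennreal \<Rightarrow> complex measure \<Rightarrow> ((real \<Rightarrow> complex) \<Rightarrow> complex \<Rightarrow> complex) \<Rightarrow> bool" where
  "is_laplace_extension p q N T \<longleftrightarrow>
     bounded_linear_Lp p lebesgue_pos q N T \<and>
     (\<forall>g \<in> Lp 1 lebesgue_pos \<inter> Lp p lebesgue_pos. AE z in N. T g z = laplace g z)"

definition laplace_op ::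
  "ennreal \<Rightarrow> ennreal \<Rightarrow> complex measure \<Rightarrow> (real \<Rightarrow> complex) \<Rightarrow> complex \<Rightarrow> complex" where
  "laplace_op p q N = (SOME T. is_laplace_extension p q N T)"

definition laplace_opnorm :: "ennreal \<Rightarrow> ennreal \<Rightarrow> complex measure \<Rightarrow> ennreal" where
  "laplace_opnorm p q N = Lp_opnorm p lebesgue_pos q N (laplace_op p q N)"

end

theory Submission
  imports Defs "HOL-Complex_Analysis.Complex_Analysis" "HOL-Probability.Sinc_Integral"
begin

text \<open>
  The endpoint \<open>p = 1\<close> is the trivial bound by the \<open>L\<^sup>1\<close>-norm, and Riesz-Thorin interpolation reduces
  the theorem to \<open>p = 2\<close>. Arclength is at most \<open>sqrt (1 + lam\<^sup>2) dx\<close>. In part (a) the transform at \<open>x + i f(x)\<close> is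
  dominated by the transform of \<open>\<bar>g\<bar>\<close> at \<open>x\<close>, which a Schur test with weight \<open>t\<^bsup>1/4\<^esup>\<close> bounds on the
  half-line with constant \<open>pi\<close>.

  Part (b) at \<open>p = 2\<close> is proved by duality and does not use the Lipschitz condition again: extending the adjoint
  \<open>t \<mapsto> \<integral> h(x) exp (- (f(x) + i x) t) dx\<close> to negative \<open>t\<close> by \<open>exp (- f(x) \<bar>t\<bar> - i x t)\<close> turns its
  squared norm into the quadratic form of the positive kernel \<open>2 p\<^bsub>f(x)+f(y)\<^esub>(x - y)\<close>, where
  \<open>p\<^bsub>a\<^esub>(u) = a / (a\<^sup>2 + u\<^sup>2)\<close> is the Poisson kernel. The form \<open>Q\<close> of \<open>p\<close> is bounded by
  comparing it with the operator \<open>K\<close> with kernel \<open>p\<^bsub>f(x)\<^esub>(x - s)\<close>: both \<open>Q \<le> 2 \<langle>K h, h\<rangle>\<close> and \<open>\<parallel>K h\<parallel>\<^sup>2 \<le> 2 pi Q\<close> hold.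
\<close>

section \<open>Borel representatives and the Laplace transform on the half-line\<close>

text \<open>Behind the comparison with \<open>K\<close> stands the semigroup law of the Poisson
  kernel: p_a convolved with p_b is pi p_(a+b), so the square norm of K h would be exactly pi Q. A
  pointwise inequality replaces the convolution at the price of a factor 2, and Cauchy-Schwarz then
  yields Q^2 \<le> 8 pi Q times the square norm of h.

  Dividing by Q is legitimate only if Q is finite, and this obstacle shapes part (b): first f is at
  least e > 0, h is integrable and the transform is cut off to a bounded interval. The constants
  depend neither on e nor on the cutoff, so Fatou's lemma removes both. The resulting constants pi
  in (a) and 16 pi in (b) lie well below 32 pi and 36 * 32 pi.

  A second obstacle is that \<open>laplace_op\<close> is an arbitrary choice among the extensions.
  One needs that some extension exists and that every extension obeys the bound. Both follow from
  one relation, "G is a limit of transforms of functions tending to g", which is visibly linear and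
  determines G up to null sets.\<close>

lemma lebesgue_pos_borel_representative:
  fixes g :: "real \<Rightarrow> complex"
  assumes "g \<in> borel_measurable lebesgue_pos"
  obtains g' where "g' \<in> borel_measurable borel" "\<And>t. t \<le> 0 \<Longrightarrow> g' t = 0"
    "AE t in lebesgue_pos. g t = g' t"
proof -
  define h where "h t = (if t \<in> {0<..} then g t else 0)" for t
  have h: "h \<in> borel_measurable lebesgue"
    unfolding h_def using assms by (subst borel_measurable_if) auto
  then have "(\<lambda>t. Re (h t)) \<in> borel_measurable lebesgue" "(\<lambda>t. Im (h t)) \<in> borel_measurable lebesgue"
    by measurable
  then obtain r i where ri: "r \<in> borel_measurable lborel" "i \<in> borel_measurable lborel"
    "AE t in lborel. Re (h t) = r t" "AE t in lborel. Im (h t) = i t"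
    using completion_ex_borel_measurable_real[of "\<lambda>t. Re (h t)" lborel]
      completion_ex_borel_measurable_real[of "\<lambda>t. Im (h t)" lborel] by blast
  then have [measurable]: "r \<in> borel_measurable borel" "i \<in> borel_measurable borel"
    by simp_all
  define g' where "g' t = (if 0 < t then Complex (r t) (i t) else 0)" for t
  have "AE t in lborel. 0 < t \<longrightarrow> g t = g' t"
    using ri(3,4) by eventually_elim (auto simp: h_def g'_def complex_eq_iff)
  then have "AE t in lebesgue_pos. g t = g' t"
    by (subst AE_restrict_space_iff) (auto intro: AE_completion)
  moreover have "g' \<in> borel_measurable borel"
    unfolding g'_def Complex_eq by measurable
  ultimately show thesis
    by (intro that[of g']) (auto simp: g'_def)
qed

text \<open>Tonelli and affine substitutions are carried out for Borel functions on
  \<open>lborel\<close>, whereas elements of the given space are measurable for the completed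
  measure only. The condition \<open>F t 0 = 0\<close> is what lets the half-line integral become
  one over the whole line; a general \<open>F\<close> covers the norm, its square and the
  exponential weights alike.\<close>

lemma nn_integral_lebesgue_pos_representative:
  assumes "AE t in lebesgue_pos. g t = g' t" "g' \<in> borel_measurable borel" "\<And>t. t \<le> 0 \<Longrightarrow> g' t = 0"
    and [measurable]: "(\<lambda>t. F t (g' t)) \<in> borel_measurable borel" and "\<And>t. F t 0 = 0"
  shows "(\<integral>\<^sup>+t. F t (g t) \<partial>lebesgue_pos) = (\<integral>\<^sup>+t. F t (g' t) \<partial>lborel)"
proof -
  have "(\<integral>\<^sup>+t. F t (g t) \<partial>lebesgue_pos) = (\<integral>\<^sup>+t. F t (g' t) \<partial>lebesgue_pos)"
    using assms(1) by (intro nn_integral_cong_AE) auto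
  also have "\<dots> = (\<integral>\<^sup>+t. F t (g' t) * indicator {0<..} t \<partial>lborel)"
    by (subst nn_integral_restrict_space) (auto simp: nn_integral_completion)
  also have "\<dots> = (\<integral>\<^sup>+t. F t (g' t) \<partial>lborel)"
    using assms(3,5) by (intro nn_integral_cong) (auto simp: indicator_def not_less)
  finally show ?thesis .
qed

lemma laplace_representative:
  assumes "AE t in lebesgue_pos. g t = g' t" "g' \<in> borel_measurable borel" "\<And>t. t \<le> 0 \<Longrightarrow> g' t = 0"
    "g \<in> borel_measurable lebesgue_pos"
  shows "laplace g z = (LINT t|lborel. g' t * exp (- (z * of_real t)))"
proof -
  have [measurable]: "g' \<in> borel_measurable borel" by fact
  have "(\<lambda>t. exp (- (z * complex_of_real t))) \<in> borel_measurable lebesgue_pos"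
    by (intro measurable_restrict_space1 measurable_completion) simp
  moreover have "g' \<in> borel_measurable lebesgue_pos"
    by (intro measurable_restrict_space1 measurable_completion) simp
  ultimately have "laplace g z = (LINT t|lebesgue_pos. g' t * exp (- (z * of_real t)))"
    unfolding laplace_def using assms(1,4) by (intro integral_cong_AE) auto
  also have "\<dots> = (LINT t|lborel. indicator {0<..} t *\<^sub>R (g' t * exp (- (z * of_real t))))"
    by (subst integral_restrict_space) (auto simp: integral_completion)
  also have "\<dots> = (LINT t|lborel. g' t * exp (- (z * of_real t)))"
    using assms(3) by (intro Bochner_Integration.integral_cong) (auto simp: indicator_def not_less)
  finally show ?thesis .
qed

section \<open>A Schur test for the Laplace transform on the half-line\<close>

lemma nn_integral_exp_div_sqrt:
  fixes a :: real
  assumes "a > 0"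
  shows "(\<integral>\<^sup>+x. ennreal (x powr (-1/2) * exp (- (x * a))) * indicator {0<..} x \<partial>lborel)
       = ennreal (sqrt pi * a powr (-1/2))"
proof -
  \<comment> \<open>Euler's integral for Gamma(1/2), rescaled by t = a x: the Jacobian
    \<open>a\<close> and the factor \<open>a powr (-1/2)\<close> combine to
    \<open>a powr (1/2)\<close>, which is moved to the other side at the end.\<close>
  have "ennreal (sqrt pi) = (\<integral>\<^sup>+t. ennreal (indicator {0..} t * t powr (1/2 - 1) / exp t) \<partial>lborel)"
    using Gamma_conv_nn_integral_real[of "1/2"] by (simp add: Gamma_one_half_real)
  also have "\<dots> = ennreal a * (\<integral>\<^sup>+x. ennreal (indicator {0..} (0 + a * x) * (0 + a * x) powr (1/2 - 1) / exp (0 + a * x)) \<partial>lborel)"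
    using assms by (subst nn_integral_real_affine[where t=0 and c=a]) auto
  also have "(\<integral>\<^sup>+x. ennreal (indicator {0..} (0 + a * x) * (0 + a * x) powr (1/2 - 1) / exp (0 + a * x)) \<partial>lborel)
      = (\<integral>\<^sup>+x. ennreal (a powr (-1/2)) * (ennreal (x powr (-1/2) * exp (- (x * a))) * indicator {0<..} x) \<partial>lborel)"
    using assms
    by (intro nn_integral_cong)
       (auto simp: indicator_def powr_mult exp_minus field_simps zero_le_mult_iff ennreal_mult'[symmetric])
  also have "\<dots> = ennreal (a powr (-1/2)) * (\<integral>\<^sup>+x. ennreal (x powr (-1/2) * exp (- (x * a))) * indicator {0<..} x \<partial>lborel)"
    by (subst nn_integral_cmult) auto
  finally have *: "ennreal (sqrt pi) = ennreal (a powr (1/2)) *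
      (\<integral>\<^sup>+x. ennreal (x powr (-1/2) * exp (- (x * a))) * indicator {0<..} x \<partial>lborel)"
    using assms powr_add[of a 1 "-1/2"]
    by (simp add: mult.assoc[symmetric] ennreal_mult''[symmetric])
  have "ennreal (sqrt pi * a powr (-1/2)) = ennreal (a powr (-1/2)) * ennreal (sqrt pi)"
    by (simp add: ennreal_mult''[symmetric] mult.commute)
  also have "\<dots> = ennreal (a powr (-1/2) * a powr (1/2)) * (\<integral>\<^sup>+x. ennreal (x powr (-1/2) * exp (- (x * a))) * indicator {0<..} x \<partial>lborel)"
    by (simp add: * mult.assoc[symmetric] ennreal_mult''[symmetric])
  also have "a powr (-1/2) * a powr (1/2) = 1"
    using assms by (simp add: powr_add[symmetric])
  finally show ?thesis by simp
qed

text \<open>Cauchy-Schwarz with the weights t^(1/4) and t^(-1/4), each taking half of the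
  exponential. The second factor contributes sqrt pi * x^(-1/2); integrating the first one against
  this in x gives pi * t^(-1/2), which cancels the remaining t^(1/2). The exponent 1/4 is forced by
  this homogeneity, and pi is the norm of the Carleman kernel 1 / (s + t).\<close>

lemma nn_integral_laplace_sq_le:
  fixes u :: "real \<Rightarrow> real"
  assumes [measurable]: "u \<in> borel_measurable borel" and "\<And>t. 0 \<le> u t" "\<And>t. t \<le> 0 \<Longrightarrow> u t = 0"
  shows "(\<integral>\<^sup>+x. (\<integral>\<^sup>+t. ennreal (u t * exp (- (x * t))) \<partial>lborel)\<^sup>2 * indicator {0<..} x \<partial>lborel)
     \<le> ennreal pi * (\<integral>\<^sup>+t. ennreal ((u t)\<^sup>2) \<partial>lborel)"
proof -
  define A where "A x = (\<integral>\<^sup>+t. ennreal ((u t)\<^sup>2 * t powr (1/2) * exp (- (x * t))) \<partial>lborel)" for x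
  have 1: "(\<integral>\<^sup>+t. ennreal (u t * exp (- (x * t))) \<partial>lborel)\<^sup>2 \<le> A x * ennreal (sqrt pi * x powr (-1/2))"
    if "x > 0" for x
  proof -
    have sq: "(exp (- (x * t / 2)))\<^sup>2 = exp (- (x * t))" "(t powr (1/4))\<^sup>2 = t powr (1/2)"
      "(t powr (-1/4))\<^sup>2 = t powr (-1/2)" for t :: real
      using exp_double[of "- (x * t / 2)"] powr_add[of t "1/4" "1/4"] powr_add[of t "-1/4" "-1/4"]
      by (simp_all add: power2_eq_square)
    \<comment> \<open>The indicator changes nothing because \<open>u\<close> vanishes off the
      half-line, but without it the square of the second factor would pick up the growth of the
      exponential at negative t.\<close>
    have eq: "(\<integral>\<^sup>+t. ennreal (u t * exp (- (x * t))) \<partial>lborel)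
      = (\<integral>\<^sup>+t. ennreal (u t * t powr (1/4) * exp (- (x * t / 2))) *
            ennreal (indicator {0<..} t * t powr (-1/4) * exp (- (x * t / 2))) \<partial>lborel)"
    proof (intro nn_integral_cong)
      fix t
      show "ennreal (u t * exp (- (x * t))) = ennreal (u t * t powr (1/4) * exp (- (x * t / 2))) *
            ennreal (indicator {0<..} t * t powr (-1/4) * exp (- (x * t / 2)))"
      proof (cases "t > 0")
        case True
        have "t powr (1/4) * t powr (-1/4) = 1"
          using True powr_add[of t "1/4" "-1/4"] by simp
        moreover have "(u t * t powr (1/4) * exp (- (x * t / 2))) * (t powr (-1/4) * exp (- (x * t / 2)))
          = u t * (t powr (1/4) * t powr (-1/4)) * (exp (- (x * t / 2)))\<^sup>2"
          by (simp only: mult_ac power2_eq_square)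
        ultimately have "u t * exp (- (x * t)) =
            (u t * t powr (1/4) * exp (- (x * t / 2))) * (t powr (-1/4) * exp (- (x * t / 2)))"
          by (simp only: sq mult_1_right)
        then have "ennreal (u t * exp (- (x * t))) =
            ennreal (u t * t powr (1/4) * exp (- (x * t / 2))) * ennreal (t powr (-1/4) * exp (- (x * t / 2)))"
          by (simp only: ennreal_mult'' powr_ge_zero exp_ge_zero mult_nonneg_nonneg)
        then show ?thesis using True by simp
      qed (use assms in \<open>auto simp: not_less\<close>)
    qed
    have "(\<integral>\<^sup>+t. ennreal (u t * exp (- (x * t))) \<partial>lborel)\<^sup>2 \<le> (\<integral>\<^sup>+t. (ennreal (u t * t powr (1/4) * exp (- (x * t / 2))))\<^sup>2 \<partial>lborel)
        * (\<integral>\<^sup>+t. (ennreal (indicator {0<..} t * t powr (-1/4) * exp (- (x * t / 2))))\<^sup>2 \<partial>lborel)"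
      unfolding eq by (intro Cauchy_Schwarz_nn_integral) measurable
    also have "(\<integral>\<^sup>+t. (ennreal (u t * t powr (1/4) * exp (- (x * t / 2))))\<^sup>2 \<partial>lborel) = A x"
      unfolding A_def using assms(2)
      by (intro nn_integral_cong, subst ennreal_power) (simp_all only: power_mult_distrib sq powr_ge_zero exp_ge_zero mult_nonneg_nonneg)
    also have "(\<integral>\<^sup>+t. (ennreal (indicator {0<..} t * t powr (-1/4) * exp (- (x * t / 2))))\<^sup>2 \<partial>lborel)
      = (\<integral>\<^sup>+t. ennreal (t powr (-1/2) * exp (- (t * x))) * indicator {0<..} t \<partial>lborel)"
    proof (intro nn_integral_cong)
      fix t
      show "(ennreal (indicator {0<..} t * t powr (-1/4) * exp (- (x * t / 2))))\<^sup>2 =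
          ennreal (t powr (-1/2) * exp (- (t * x))) * indicator {0<..} t"
        by (subst ennreal_power) (simp_all only: power_mult_distrib sq mult.commute[of t] indicator_def
            powr_ge_zero exp_ge_zero mult_nonneg_nonneg, simp_all)
    qed
    finally show ?thesis by (simp only: nn_integral_exp_div_sqrt[OF that])
  qed
  have "(\<integral>\<^sup>+x. (\<integral>\<^sup>+t. ennreal (u t * exp (- (x * t))) \<partial>lborel)\<^sup>2 * indicator {0<..} x \<partial>lborel)
    \<le> (\<integral>\<^sup>+x. A x * (ennreal (sqrt pi * x powr (-1/2)) * indicator {0<..} x) \<partial>lborel)"
    using 1 by (intro nn_integral_mono) (simp split: split_indicator)
  also have "\<dots> = (\<integral>\<^sup>+x. \<integral>\<^sup>+t. ennreal ((u t)\<^sup>2 * t powr (1/2) * exp (- (x * t))) *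
      (ennreal (sqrt pi * x powr (-1/2)) * indicator {0<..} x) \<partial>lborel \<partial>lborel)"
    unfolding A_def by (intro nn_integral_cong nn_integral_multc[symmetric]) measurable
  also have "\<dots> = (\<integral>\<^sup>+t. \<integral>\<^sup>+x. ennreal ((u t)\<^sup>2 * t powr (1/2) * exp (- (x * t))) *
      (ennreal (sqrt pi * x powr (-1/2)) * indicator {0<..} x) \<partial>lborel \<partial>lborel)"
    by (intro lborel_pair.Fubini') measurable
  also have "\<dots> = (\<integral>\<^sup>+t. ennreal ((u t)\<^sup>2 * t powr (1/2) * sqrt pi) *
     (\<integral>\<^sup>+x. ennreal (x powr (-1/2) * exp (- (x * t))) * indicator {0<..} x \<partial>lborel) \<partial>lborel)"
    by (intro nn_integral_cong, subst nn_integral_cmult[symmetric])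
       (auto intro!: nn_integral_cong simp: indicator_def ennreal_mult''[symmetric] mult_ac)
  also have "\<dots> = (\<integral>\<^sup>+t. ennreal pi * ennreal ((u t)\<^sup>2) \<partial>lborel)"
  proof (intro nn_integral_cong)
    fix t
    show "ennreal ((u t)\<^sup>2 * t powr (1/2) * sqrt pi) *
     (\<integral>\<^sup>+x. ennreal (x powr (-1/2) * exp (- (x * t))) * indicator {0<..} x \<partial>lborel) = ennreal pi * ennreal ((u t)\<^sup>2)"
    proof (cases "t > 0")
      case True
      have "t powr (1/2) * t powr (-1/2) = 1"
        using True powr_add[of t "1/2" "-1/2"] by simp
      moreover have "(u t)\<^sup>2 * t powr (1/2) * sqrt pi * (sqrt pi * t powr (-1/2)) =
          (sqrt pi * sqrt pi) * (u t)\<^sup>2 * (t powr (1/2) * t powr (-1/2))"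
        by (simp only: mult_ac)
      ultimately have "(u t)\<^sup>2 * t powr (1/2) * sqrt pi * (sqrt pi * t powr (-1/2)) = pi * (u t)\<^sup>2"
        by simp
      then show ?thesis
        by (simp only: nn_integral_exp_div_sqrt[OF True] flip: ennreal_mult'') (simp flip: ennreal_mult'')
    qed (use assms in \<open>auto simp: not_less\<close>)
  qed
  also have "\<dots> = ennreal pi * (\<integral>\<^sup>+t. ennreal ((u t)\<^sup>2) \<partial>lborel)"
    by (rule nn_integral_cmult) measurable
  finally show ?thesis .
qed

section \<open>The Poisson kernel\<close>

text \<open>The arctangent gives pi/2 on a half-line, reflection doubles it, and the substitution x
  + a u removes both parameters.\<close>

lemma nn_integral_poisson_kernel:
  fixes a x :: real
  assumes "a > 0"
  shows "(\<integral>\<^sup>+u. ennreal (a / (a\<^sup>2 + (x - u)\<^sup>2)) \<partial>lborel) = ennreal pi"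
proof -
  have half: "(\<integral>\<^sup>+u. ennreal (inverse (1 + u\<^sup>2)) * indicator {0..} u \<partial>lborel) = ennreal (pi/2)"
    using nn_integral_FTC_atLeast[of "\<lambda>u. inverse (1 + u\<^sup>2)" 0 arctan "pi/2"]
    by (auto simp: tendsto_arctan_at_top intro!: DERIV_arctan)
  have "(\<integral>\<^sup>+u. ennreal (inverse (1 + u\<^sup>2)) * indicator {..<0} u \<partial>lborel)
      = (\<integral>\<^sup>+u. ennreal (inverse (1 + u\<^sup>2)) * indicator {0<..} u \<partial>lborel)"
    by (subst nn_integral_real_affine[where c="-1" and t=0])
       (auto intro!: nn_integral_cong simp: indicator_def)
  also have "\<dots> = (\<integral>\<^sup>+u. ennreal (inverse (1 + u\<^sup>2)) * indicator {0..} u \<partial>lborel)"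
    by (intro nn_integral_cong_AE eventually_mono[OF AE_lborel_singleton[of 0]]) (auto simp: indicator_def)
  finally have neg: "(\<integral>\<^sup>+u. ennreal (inverse (1 + u\<^sup>2)) * indicator {..<0} u \<partial>lborel) = ennreal (pi/2)"
    by (simp only: half)
  have "(\<integral>\<^sup>+u. ennreal (inverse (1 + u\<^sup>2)) \<partial>lborel) =
    (\<integral>\<^sup>+u. ennreal (inverse (1 + u\<^sup>2)) * indicator {..<0} u + ennreal (inverse (1 + u\<^sup>2)) * indicator {0..} u \<partial>lborel)"
    by (intro nn_integral_cong) (auto simp: indicator_def)
  also have "\<dots> = ennreal (pi/2) + ennreal (pi/2)"
    by (subst nn_integral_add) (auto simp: neg half)
  finally have 1: "(\<integral>\<^sup>+u. ennreal (inverse (1 + u\<^sup>2)) \<partial>lborel) = ennreal pi"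
    by (simp flip: ennreal_plus)
  have "(\<integral>\<^sup>+u. ennreal (a / (a\<^sup>2 + (x - u)\<^sup>2)) \<partial>lborel) =
    ennreal a * (\<integral>\<^sup>+u. ennreal (a / (a\<^sup>2 + (x - (x + a * u))\<^sup>2)) \<partial>lborel)"
    using assms by (subst nn_integral_real_affine[where c=a and t=x]) auto
  also have "\<dots> = (\<integral>\<^sup>+u. ennreal a * ennreal (a / (a\<^sup>2 + (x - (x + a * u))\<^sup>2)) \<partial>lborel)"
    by (rule nn_integral_cmult[symmetric]) measurable
  also have "\<dots> = (\<integral>\<^sup>+u. ennreal (inverse (1 + u\<^sup>2)) \<partial>lborel)"
  proof (intro nn_integral_cong)
    fix u
    have "a\<^sup>2 + (x - (x + a * u))\<^sup>2 = a * a * (1 + u\<^sup>2)"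
      by (simp add: power2_eq_square algebra_simps)
    moreover have "1 + u\<^sup>2 \<noteq> 0"
      by (metis add_pos_nonneg less_numeral_extra(1) less_numeral_extra(3) zero_le_power2)
    ultimately have "a * (a / (a\<^sup>2 + (x - (x + a * u))\<^sup>2)) = inverse (1 + u\<^sup>2)"
      using assms by (simp only:) (simp add: divide_simps)
    then show "ennreal a * ennreal (a / (a\<^sup>2 + (x - (x + a * u))\<^sup>2)) = ennreal (inverse (1 + u\<^sup>2))"
      using assms by (simp flip: ennreal_mult')
  qed
  finally show ?thesis by (simp only: 1)
qed

text \<open>This is the Cauchy-Schwarz inequality \<open>1 / p\<^bsub>a+b\<^esub>(u + v) \<le> 1 / p\<^bsub>a\<^esub>(u) + 1 / p\<^bsub>b\<^esub>(v)\<close>, multiplied out.\<close>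

lemma poisson_kernel_mult_le:
  fixes a b u v :: real
  assumes "a > 0" "b > 0"
  shows "a / (a\<^sup>2 + u\<^sup>2) * (b / (b\<^sup>2 + v\<^sup>2)) \<le>
    (a + b) / ((a + b)\<^sup>2 + (u + v)\<^sup>2) * (a / (a\<^sup>2 + u\<^sup>2) + b / (b\<^sup>2 + v\<^sup>2))"
proof -
  define A B where "A = a\<^sup>2 + u\<^sup>2" and "B = b\<^sup>2 + v\<^sup>2"
  have pos: "A > 0" "B > 0" "(a + b)\<^sup>2 + (u + v)\<^sup>2 > 0"
    using assms by (auto simp: A_def B_def add_pos_nonneg)
  have "a * b * ((a + b)\<^sup>2 + (u + v)\<^sup>2) \<le> (a + b) * (a * B + b * A)"
  proof -
    have "(a + b) * (a * B + b * A) - a * b * ((a + b)\<^sup>2 + (u + v)\<^sup>2) = (a * v - b * u)\<^sup>2"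
      unfolding A_def B_def by (simp add: power2_eq_square algebra_simps)
    then show ?thesis
      by (metis diff_ge_0_iff_ge zero_le_power2)
  qed
  then have "a * b / (A * B) \<le> (a + b) / ((a + b)\<^sup>2 + (u + v)\<^sup>2) * ((a * B + b * A) / (A * B))"
    using pos by (simp add: divide_simps mult_ac)
  also have "(a * B + b * A) / (A * B) = a / A + b / B"
    using pos by (simp add: field_simps)
  finally show ?thesis
    unfolding A_def[symmetric] B_def[symmetric] by simp
qed

text \<open>Each numerator keeps only its own height in the denominator. This decouples the heights:
  every term on the right involves a single value of \<open>f\<close>, which is how \<open>K\<close>
  enters the estimate of the form.\<close>

lemma poisson_kernel_add_le:
  fixes a b d :: real
  assumes "a > 0" "b > 0"
  shows "(a + b) / ((a + b)\<^sup>2 + d\<^sup>2) \<le> a / (a\<^sup>2 + d\<^sup>2) + b / (b\<^sup>2 + d\<^sup>2)"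
proof -
  have "a\<^sup>2 \<le> (a + b)\<^sup>2" "b\<^sup>2 \<le> (a + b)\<^sup>2"
    using assms by (auto intro!: power_mono)
  then have "a / ((a + b)\<^sup>2 + d\<^sup>2) \<le> a / (a\<^sup>2 + d\<^sup>2)" "b / ((a + b)\<^sup>2 + d\<^sup>2) \<le> b / (b\<^sup>2 + d\<^sup>2)"
    using assms by (auto intro!: divide_left_mono mult_pos_pos add_pos_nonneg)
  then show ?thesis by (simp add: add_divide_distrib)
qed

text \<open>For \<open>Q = \<infinity>\<close> the premise says nothing as soon as
  \<open>C > 0\<close>; this is the reason for all regularisations that precede its use.\<close>

lemma ennreal_le_of_sq_le_mult:
  fixes Q :: ennreal
  assumes "Q\<^sup>2 \<le> C * Q" "Q < \<infinity>"
  shows "Q \<le> C"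
proof (rule ccontr)
  assume *: "\<not> Q \<le> C"
  then have "C * Q < Q * Q"
    using assms(2) by (intro ennreal_mult_strict_right_mono) (auto simp: not_le zero_less_iff_neq_zero)
  then show False
    using assms(1) by (simp add: power2_eq_square)
qed

text \<open>A bootstrap: Q \<le> 2 <K h, h> \<le> 2 |K h| |h| with |K h|^2 \<le> 2 pi Q bounds Q by
  its own square root, and 4 * 2 pi gives the constant 8 pi. The lower bound \<open>e\<close> and
  the integrability of \<open>h\<close> make Q finite; they leave no trace in the constant.\<close>

lemma poisson_quadratic_form_le:
  fixes f h :: "real \<Rightarrow> real" and e :: real
  assumes [measurable]: "f \<in> borel_measurable borel" "h \<in> borel_measurable borel"
    and "e > 0" and f: "\<And>x. e \<le> f x" and h: "\<And>x. 0 \<le> h x"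
    and fin: "(\<integral>\<^sup>+x. ennreal (h x) \<partial>lborel) < \<infinity>"
  shows "(\<integral>\<^sup>+x. \<integral>\<^sup>+y. ennreal (h x * h y * ((f x + f y) / ((f x + f y)\<^sup>2 + (x - y)\<^sup>2))) \<partial>lborel \<partial>lborel)
    \<le> ennreal (8 * pi) * (\<integral>\<^sup>+x. ennreal ((h x)\<^sup>2) \<partial>lborel)"
proof -
  define p :: "real \<Rightarrow> real \<Rightarrow> real" where "p a u = a / (a\<^sup>2 + u\<^sup>2)" for a u
  have [measurable]: "(\<lambda>(a, u). p a u) \<in> borel_measurable (borel \<Otimes>\<^sub>M borel)"
    unfolding p_def by measurable
  have p_nn: "0 \<le> p a u" if "a > 0" for a u
    using that by (simp add: p_def)
  have p_minus: "p a (- u) = p a u" for a u by (simp add: p_def)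
  have f_pos: "f x > 0" for x using f[of x] \<open>e > 0\<close> by simp
  define Q where "Q = (\<integral>\<^sup>+x. \<integral>\<^sup>+y. ennreal (h x * h y * p (f x + f y) (x - y)) \<partial>lborel \<partial>lborel)"
  define K where "K s = (\<integral>\<^sup>+x. ennreal (h x * p (f x) (x - s)) \<partial>lborel)" for s
  have [measurable]: "K \<in> borel_measurable borel"
    unfolding K_def by measurable
  have p_int: "(\<integral>\<^sup>+u. ennreal (p a (x - u)) \<partial>lborel) = ennreal pi" if "a > 0" for a x
    unfolding p_def using that by (rule nn_integral_poisson_kernel)

  \<comment> \<open>Finiteness of Q: the kernel is at most 1 / (f x + f y), hence at most 1 / (2 e),
    and \<open>h\<close> is integrable.\<close>
  have "Q \<le> (\<integral>\<^sup>+x. \<integral>\<^sup>+y. ennreal (1 / (2 * e)) * (ennreal (h x) * ennreal (h y)) \<partial>lborel \<partial>lborel)"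
    unfolding Q_def
  proof (intro nn_integral_mono)
    fix x y
    have "2 * e \<le> f x + f y" using f[of x] f[of y] by simp
    then have "1 / (f x + f y) \<le> 1 / (2 * e)"
      using \<open>e > 0\<close> by (intro divide_left_mono) auto
    moreover have "p (f x + f y) (x - y) \<le> (f x + f y) / (f x + f y)\<^sup>2"
      unfolding p_def using f_pos[of x] f_pos[of y] by (intro divide_left_mono) (auto intro!: mult_pos_pos add_pos_nonneg)
    moreover have "(f x + f y) / (f x + f y)\<^sup>2 = 1 / (f x + f y)"
      by (simp add: power2_eq_square)
    ultimately have "p (f x + f y) (x - y) \<le> 1 / (2 * e)"
      by linarith
    then have "h x * h y * p (f x + f y) (x - y) \<le> h x * h y * (1 / (2 * e))"
      using h by (intro mult_left_mono) auto
    then show "ennreal (h x * h y * p (f x + f y) (x - y)) \<le> ennreal (1 / (2 * e)) * (ennreal (h x) * ennreal (h y))"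
      using h \<open>e > 0\<close> by (simp add: mult.commute ennreal_leI flip: ennreal_mult)
  qed
  also have "\<dots> = ennreal (1 / (2 * e)) * ((\<integral>\<^sup>+x. ennreal (h x) \<partial>lborel) * (\<integral>\<^sup>+x. ennreal (h x) \<partial>lborel))"
    by (simp add: nn_integral_cmult nn_integral_multc)
  also have "\<dots> < \<infinity>"
    using fin by (simp add: ennreal_mult_less_top)
  finally have Q_fin: "Q < \<infinity>" .

  have "Q \<le> (\<integral>\<^sup>+x. \<integral>\<^sup>+y. (ennreal (h x * p (f x) (x - y)) * ennreal (h y) + ennreal (h y * p (f y) (y - x)) * ennreal (h x)) \<partial>lborel \<partial>lborel)"
    unfolding Q_def
  proof (intro nn_integral_mono)
    fix x y
    have "p (f x + f y) (x - y) \<le> p (f x) (x - y) + p (f y) (x - y)"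
      unfolding p_def using f_pos by (intro poisson_kernel_add_le)
    also have "p (f y) (x - y) = p (f y) (y - x)"
      using p_minus[of "f y" "x - y"] by simp
    finally have "h x * h y * p (f x + f y) (x - y) \<le> h x * h y * (p (f x) (x - y) + p (f y) (y - x))"
      using h by (intro mult_left_mono) auto
    also have "\<dots> = h x * p (f x) (x - y) * h y + h y * p (f y) (y - x) * h x"
      by (simp add: algebra_simps)
    finally show "ennreal (h x * h y * p (f x + f y) (x - y)) \<le>
      ennreal (h x * p (f x) (x - y)) * ennreal (h y) + ennreal (h y * p (f y) (y - x)) * ennreal (h x)"
      using h p_nn f_pos by (simp add: ennreal_leI flip: ennreal_mult ennreal_plus)
  qed
  also have "\<dots> = (\<integral>\<^sup>+x. \<integral>\<^sup>+y. ennreal (h x * p (f x) (x - y)) * ennreal (h y) \<partial>lborel \<partial>lborel) +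
      (\<integral>\<^sup>+x. \<integral>\<^sup>+y. ennreal (h y * p (f y) (y - x)) * ennreal (h x) \<partial>lborel \<partial>lborel)"
    by (subst nn_integral_add[symmetric]; (intro nn_integral_cong nn_integral_add)?) measurable
  \<comment> \<open>Only the first half needs Tonelli: there the variable carrying the height is the
    outer one. The second half already has the shape of \<open>K\<close> paired with
    \<open>h\<close>.\<close>
  also have "(\<integral>\<^sup>+x. \<integral>\<^sup>+y. ennreal (h x * p (f x) (x - y)) * ennreal (h y) \<partial>lborel \<partial>lborel) =
     (\<integral>\<^sup>+y. \<integral>\<^sup>+x. ennreal (h x * p (f x) (x - y)) * ennreal (h y) \<partial>lborel \<partial>lborel)"
    by (rule lborel_pair.Fubini') measurable
  also have "(\<integral>\<^sup>+y. \<integral>\<^sup>+x. ennreal (h x * p (f x) (x - y)) * ennreal (h y) \<partial>lborel \<partial>lborel) = (\<integral>\<^sup>+s. K s * ennreal (h s) \<partial>lborel)"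
    unfolding K_def by (intro nn_integral_cong nn_integral_multc) measurable
  finally have 1: "Q \<le> 2 * (\<integral>\<^sup>+s. K s * ennreal (h s) \<partial>lborel)"
    by (simp only: mult_2)

  have "(\<integral>\<^sup>+s. (K s)\<^sup>2 \<partial>lborel) = (\<integral>\<^sup>+s. \<integral>\<^sup>+x. \<integral>\<^sup>+y. ennreal (h x * p (f x) (x - s)) * ennreal (h y * p (f y) (y - s)) \<partial>lborel \<partial>lborel \<partial>lborel)"
  proof (intro nn_integral_cong)
    fix s
    have "(K s)\<^sup>2 = (\<integral>\<^sup>+x. ennreal (h x * p (f x) (x - s)) * K s \<partial>lborel)"
      unfolding power2_eq_square by (subst (1) K_def, rule nn_integral_multc[symmetric]) measurable
    also have "\<dots> = (\<integral>\<^sup>+x. \<integral>\<^sup>+y. ennreal (h x * p (f x) (x - s)) * ennreal (h y * p (f y) (y - s)) \<partial>lborel \<partial>lborel)"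
      unfolding K_def by (intro nn_integral_cong nn_integral_cmult[symmetric]) measurable
    finally show "(K s)\<^sup>2 = \<dots>" .
  qed
  also have "\<dots> = (\<integral>\<^sup>+x. \<integral>\<^sup>+s. \<integral>\<^sup>+y. ennreal (h x * p (f x) (x - s)) * ennreal (h y * p (f y) (y - s)) \<partial>lborel \<partial>lborel \<partial>lborel)"
    by (rule lborel_pair.Fubini') measurable
  also have "\<dots> = (\<integral>\<^sup>+x. \<integral>\<^sup>+y. \<integral>\<^sup>+s. ennreal (h x * p (f x) (x - s)) * ennreal (h y * p (f y) (y - s)) \<partial>lborel \<partial>lborel \<partial>lborel)"
    by (intro nn_integral_cong lborel_pair.Fubini') measurable
  also have "\<dots> \<le> (\<integral>\<^sup>+x. \<integral>\<^sup>+y. ennreal (2 * pi) * ennreal (h x * h y * p (f x + f y) (x - y)) \<partial>lborel \<partial>lborel)"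
  proof (intro nn_integral_mono)
    fix x y
    define c where "c = h x * h y * p (f x + f y) (x - y)"
    have c: "0 \<le> c" unfolding c_def using h p_nn f_pos by (simp add: add_pos_pos)
    have "(\<integral>\<^sup>+s. ennreal (h x * p (f x) (x - s)) * ennreal (h y * p (f y) (y - s)) \<partial>lborel)
      \<le> (\<integral>\<^sup>+s. ennreal c * (ennreal (p (f x) (x - s)) + ennreal (p (f y) (y - s))) \<partial>lborel)"
    proof (intro nn_integral_mono)
      fix s
      \<comment> \<open>With u = x - s and v = s - y the sum u + v = x - y is free of s, so the
        joint kernel leaves the s-integral. Each of the two kernels that remain has integral pi,
        whence the 2 pi.\<close>
      have "p (f x) (x - s) * p (f y) (s - y) \<le> p (f x + f y) ((x - s) + (s - y)) * (p (f x) (x - s) + p (f y) (s - y))"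
        unfolding p_def using f_pos by (intro poisson_kernel_mult_le)
      moreover have "p (f y) (s - y) = p (f y) (y - s)"
        using p_minus[of "f y" "s - y"] by simp
      ultimately have "h x * h y * (p (f x) (x - s) * p (f y) (y - s)) \<le> h x * h y * (p (f x + f y) (x - y) * (p (f x) (x - s) + p (f y) (y - s)))"
        using h by (intro mult_left_mono) auto
      then have "(h x * p (f x) (x - s)) * (h y * p (f y) (y - s)) \<le> c * (p (f x) (x - s) + p (f y) (y - s))"
        by (simp add: c_def mult_ac)
      then show "ennreal (h x * p (f x) (x - s)) * ennreal (h y * p (f y) (y - s)) \<le>
        ennreal c * (ennreal (p (f x) (x - s)) + ennreal (p (f y) (y - s)))"
        using h p_nn f_pos c by (simp add: ennreal_leI flip: ennreal_mult ennreal_plus)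
    qed
    also have "\<dots> = ennreal c * (\<integral>\<^sup>+s. ennreal (p (f x) (x - s)) + ennreal (p (f y) (y - s)) \<partial>lborel)"
      by (rule nn_integral_cmult) measurable
    also have "(\<integral>\<^sup>+s. ennreal (p (f x) (x - s)) + ennreal (p (f y) (y - s)) \<partial>lborel) = ennreal (2 * pi)"
      by (subst nn_integral_add) (auto simp: p_int f_pos simp flip: ennreal_plus)
    finally show "(\<integral>\<^sup>+s. ennreal (h x * p (f x) (x - s)) * ennreal (h y * p (f y) (y - s)) \<partial>lborel)
      \<le> ennreal (2 * pi) * ennreal (h x * h y * p (f x + f y) (x - y))"
      by (simp add: c_def mult.commute)
  qed
  also have "\<dots> = ennreal (2 * pi) * Q"
    unfolding Q_def by (subst nn_integral_cmult[symmetric], measurable, intro nn_integral_cong nn_integral_cmult) measurable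
  finally have 2: "(\<integral>\<^sup>+s. (K s)\<^sup>2 \<partial>lborel) \<le> ennreal (2 * pi) * Q" .

  have "Q\<^sup>2 \<le> (2 * (\<integral>\<^sup>+s. K s * ennreal (h s) \<partial>lborel))\<^sup>2"
    using 1 by (rule power_mono) simp
  also have "\<dots> = 4 * (\<integral>\<^sup>+s. K s * ennreal (h s) \<partial>lborel)\<^sup>2"
    by (simp add: power_mult_distrib)
  also have "\<dots> \<le> 4 * ((\<integral>\<^sup>+s. (K s)\<^sup>2 \<partial>lborel) * (\<integral>\<^sup>+s. (ennreal (h s))\<^sup>2 \<partial>lborel))"
    by (intro mult_left_mono Cauchy_Schwarz_nn_integral) auto
  also have "\<dots> \<le> 4 * ((ennreal (2 * pi) * Q) * (\<integral>\<^sup>+s. (ennreal (h s))\<^sup>2 \<partial>lborel))"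
    by (intro mult_left_mono mult_right_mono 2) auto
  also have "\<dots> = (ennreal (8 * pi) * (\<integral>\<^sup>+s. ennreal ((h s)\<^sup>2) \<partial>lborel)) * Q"
    using ennreal_mult'[of 4 "2 * pi"] h by (simp add: ennreal_power mult_ac)
  finally show ?thesis
    using Q_fin unfolding Q_def p_def by (rule ennreal_le_of_sq_le_mult)
qed

section \<open>Square-integrability along graphs over the imaginary axis\<close>

lemma set_integrable_exp_complex:
  assumes "Re w > 0"
  shows "set_integrable lborel {0<..} (\<lambda>t. exp (- (w * complex_of_real t)))"
  unfolding set_integrable_def
proof (rule Bochner_Integration.integrable_bound)
  show "integrable lborel (\<lambda>t. indicat_real {0<..} t *\<^sub>R exp (- (t * Re w)))"
    using integrable_I0i_exp_mscale[OF assms] by (simp add: set_integrable_def)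
qed (auto simp: indicator_def mult.commute)

lemma set_integral_exp_complex:
  assumes "Re w > 0"
  shows "(LINT t:{0<..}|lborel. exp (- (w * complex_of_real t))) = 1 / w"
proof -
  have w: "w \<noteq> 0" using assms by auto
  have "interval_lebesgue_integral lborel 0 \<infinity> (\<lambda>t. exp (- (w * complex_of_real t))) = 0 - (- 1 / w)"
  proof (rule interval_integral_FTC_integrable[where F="\<lambda>t. - exp (- (w * complex_of_real t)) / w"])
    fix t :: real
    have "((\<lambda>z. - exp (- (w * z)) / w) has_field_derivative exp (- (w * of_real t))) (at (of_real t))"
      using w by (auto intro!: derivative_eq_intros)
    then show "((\<lambda>t. - exp (- (w * complex_of_real t)) / w) has_vector_derivative exp (- (w * complex_of_real t))) (at t)"
      by (rule has_vector_derivative_real_field)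
    show "isCont (\<lambda>t. exp (- (w * complex_of_real t))) t"
      by (intro continuous_intros)
  next
    show "set_integrable lborel (einterval 0 \<infinity>) (\<lambda>t. exp (- (w * complex_of_real t)))"
      using set_integrable_exp_complex[OF assms] by (simp add: zero_ereal_def)
    have "((\<lambda>t. - exp (- (w * complex_of_real t)) / w) \<longlongrightarrow> - exp (- (w * complex_of_real 0)) / w) (at_right 0)"
      by (intro tendsto_intros w)
    then show "(((\<lambda>t. - exp (- (w * complex_of_real t)) / w) \<circ> real_of_ereal) \<longlongrightarrow> - 1 / w) (at_right 0)"
      by (simp add: zero_ereal_def ereal_tendsto_simps)
    have "((\<lambda>t. exp (- (Re w * t)) / cmod w) \<longlongrightarrow> 0) at_top"
      using assms w by real_asymp
    then have "((\<lambda>t. - exp (- (w * complex_of_real t)) / w) \<longlongrightarrow> 0) at_top"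
      by (subst tendsto_norm_zero_iff[symmetric]) (simp add: norm_divide)
    then show "(((\<lambda>t. - exp (- (w * complex_of_real t)) / w) \<circ> real_of_ereal) \<longlongrightarrow> 0) (at_left \<infinity>)"
      by (simp add: ereal_tendsto_simps)
  qed auto
  then show ?thesis
    by (simp add: interval_lebesgue_integral_0_infty)
qed

lemma (in pair_sigma_finite)
  fixes f g :: "_ \<Rightarrow> complex"
  assumes "integrable M1 f" "integrable M2 g"
  shows integrable_pair_mult: "integrable (M1 \<Otimes>\<^sub>M M2) (\<lambda>(x, y). f x * g y)"
    and integral_pair_mult: "(LINT p|(M1 \<Otimes>\<^sub>M M2). f (fst p) * g (snd p)) = (LINT x|M1. f x) * (LINT y|M2. g y)"
proof -
  have [measurable]: "f \<in> borel_measurable M1" "g \<in> borel_measurable M2"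
    using assms by auto
  have "(\<integral>\<^sup>+x. ennreal (norm (f x)) \<partial>M1) * (\<integral>\<^sup>+y. ennreal (norm (g y)) \<partial>M2) < \<infinity>"
    using assms by (auto simp: integrable_iff_bounded ennreal_mult_less_top)
  moreover have "(\<integral>\<^sup>+p. ennreal (norm (case p of (x, y) \<Rightarrow> f x * g y)) \<partial>(M1 \<Otimes>\<^sub>M M2)) =
      (\<integral>\<^sup>+x. \<integral>\<^sup>+y. ennreal (norm (f x)) * ennreal (norm (g y)) \<partial>M2 \<partial>M1)"
    by (subst M2.nn_integral_fst[symmetric]) (auto simp: norm_mult ennreal_mult)
  moreover have "\<dots> = (\<integral>\<^sup>+x. ennreal (norm (f x)) \<partial>M1) * (\<integral>\<^sup>+y. ennreal (norm (g y)) \<partial>M2)"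
    by (simp add: nn_integral_cmult nn_integral_multc)
  ultimately show 1: "integrable (M1 \<Otimes>\<^sub>M M2) (\<lambda>(x, y). f x * g y)"
    by (intro integrableI_bounded) auto
  show "(LINT p|(M1 \<Otimes>\<^sub>M M2). f (fst p) * g (snd p)) = (LINT x|M1. f x) * (LINT y|M2. g y)"
    using integral_fst[OF 1] by (simp add: case_prod_unfold)
qed

text \<open>Fatou's lemma in the form in which bounds survive limits throughout; the bounds may vary
  with n as long as they converge.\<close>

lemma nn_integral_le_limit:
  assumes "\<And>n. F n \<in> borel_measurable M" "AE x in M. (\<lambda>n. F n x) \<longlonglongrightarrow> G x"
    and "\<And>n. (\<integral>\<^sup>+x. F n x \<partial>M) \<le> C n" "C \<longlonglongrightarrow> c"
  shows "(\<integral>\<^sup>+x. G x \<partial>M) \<le> (c :: ennreal)"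
proof -
  have "(\<integral>\<^sup>+x. G x \<partial>M) = (\<integral>\<^sup>+x. liminf (\<lambda>n. F n x) \<partial>M)"
    using assms(2) lim_imp_Liminf[OF sequentially_bot, symmetric]
    by (intro nn_integral_cong_AE) (auto elim!: eventually_mono)
  also have "\<dots> \<le> liminf (\<lambda>n. \<integral>\<^sup>+x. F n x \<partial>M)"
    by (intro nn_integral_liminf assms)
  also have "\<dots> \<le> liminf C"
    by (intro Liminf_mono always_eventually allI assms)
  also have "\<dots> = c"
    using assms(4) by (intro lim_imp_Liminf) auto
  finally show ?thesis .
qed

text \<open>The square norm of \<open>E\<close> alone leads to the kernel 1 / a with a = w x + cnj
  (w y), which is not positive. Adding the nonnegative square norm of \<open>E'\<close> turns it
  into 1 / a + 1 / cnj a = 2 Re a / |a|^2, where Re a = f x + f y and Im a = x - y. This is twice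
  the Poisson kernel, so the bound 8 pi for its form becomes 16 pi.\<close>

lemma adjoint_laplace_L2_le:
  fixes f :: "real \<Rightarrow> real" and h :: "real \<Rightarrow> complex" and e :: real
  assumes [measurable]: "f \<in> borel_measurable borel" and h: "integrable lborel h"
    and "e > 0" and f: "\<And>x. e \<le> f x"
  shows "(\<integral>\<^sup>+t. ennreal ((norm (LINT x|lborel. h x * exp (- ((of_real (f x) + \<i> * of_real x) * of_real t))))\<^sup>2) * indicator {0<..} t \<partial>lborel)
    \<le> ennreal (16 * pi) * (\<integral>\<^sup>+x. ennreal ((norm (h x))\<^sup>2) \<partial>lborel)"
proof -
  have [measurable]: "h \<in> borel_measurable borel" using h by auto
  have [measurable]: "cnj \<in> borel_measurable borel"
    by (intro borel_measurable_continuous_onI continuous_intros)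
  define w where "w x = complex_of_real (f x) + \<i> * of_real x" for x
  have [measurable]: "w \<in> borel_measurable borel" unfolding w_def by measurable
  have Re_w: "Re (w x) = f x" "Im (w x) = x" for x by (auto simp: w_def)
  have f_pos: "f x > 0" for x using f[of x] \<open>e > 0\<close> by simp
  let ?P = "lborel \<Otimes>\<^sub>M lborel :: (real \<times> real) measure"
  define E where "E t = (LINT x|lborel. h x * exp (- (w x * complex_of_real t)))" for t
  \<comment> \<open>\<open>E' t\<close> is the value at \<open>- t\<close> of the extension to
    negative times.\<close>
  define E' where "E' t = (LINT x|lborel. h x * exp (- (cnj (w x) * complex_of_real t)))" for t
  define \<psi> where "\<psi> p t = h (fst p) * cnj (h (snd p)) *
      (exp (- ((w (fst p) + cnj (w (snd p))) * complex_of_real t)) +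
       exp (- ((cnj (w (fst p)) + w (snd p)) * complex_of_real t)))" for p t
  have [measurable]: "(\<lambda>(p, t). \<psi> p t) \<in> borel_measurable (?P \<Otimes>\<^sub>M lborel)"
    unfolding \<psi>_def by measurable
  interpret P: pair_sigma_finite ?P lborel ..

  have hE: "integrable lborel (\<lambda>x. h x * exp (- (w x * complex_of_real t)))"
      "integrable lborel (\<lambda>x. h x * exp (- (cnj (w x) * complex_of_real t)))" if "t > 0" for t
    using that f_pos
    by (auto intro!: Bochner_Integration.integrable_bound[OF h] AE_I2 mult_right_le_one_le
        simp: norm_mult Re_w less_imp_le)
  have sq: "integrable ?P (\<lambda>p. F (fst p) * cnj (F (snd p)))"
    "(LINT p|?P. F (fst p) * cnj (F (snd p))) = (LINT x|lborel. F x) * cnj (LINT x|lborel. F x)"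
    if "integrable lborel F" for F :: "real \<Rightarrow> complex"
    using lborel_pair.integrable_pair_mult[OF that integrable_cnj[OF that]]
      lborel_pair.integral_pair_mult[OF that integrable_cnj[OF that]]
    by (simp_all add: case_prod_unfold)
  have E: "of_real ((norm (E t))\<^sup>2 + (norm (E' t))\<^sup>2) = (LINT p|?P. \<psi> p t)" if "t > 0" for t
  proof -
    let ?F = "\<lambda>x. h x * exp (- (w x * complex_of_real t))"
    let ?F' = "\<lambda>x. h x * exp (- (cnj (w x) * complex_of_real t))"
    have "of_real ((norm (E t))\<^sup>2 + (norm (E' t))\<^sup>2) = E t * cnj (E t) + E' t * cnj (E' t)"
      by (simp only: of_real_add complex_norm_square)
    also have "\<dots> = (LINT p|?P. ?F (fst p) * cnj (?F (snd p))) + (LINT p|?P. ?F' (fst p) * cnj (?F' (snd p)))"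
      unfolding E_def E'_def by (simp only: sq(2)[OF hE(1)[OF that]] sq(2)[OF hE(2)[OF that]])
    also have "\<dots> = (LINT p|?P. ?F (fst p) * cnj (?F (snd p)) + ?F' (fst p) * cnj (?F' (snd p)))"
      using sq(1)[OF hE(1)[OF that]] sq(1)[OF hE(2)[OF that]]
      by (intro Bochner_Integration.integral_add[symmetric])
    also have "\<dots> = (LINT p|?P. \<psi> p t)"
      by (intro Bochner_Integration.integral_cong)
         (auto simp: \<psi>_def exp_cnj exp_add[symmetric] algebra_simps mult_exp_exp)
    finally show ?thesis .
  qed

  \<comment> \<open>The lower bound \<open>e\<close> gives exponential decay in t uniformly in the
    pair \<open>p\<close>; this supplies the product majorant that Fubini on the triple product
    requires.\<close>
  have \<psi>_le: "norm (\<psi> p t) \<le> norm (h (fst p)) * norm (h (snd p)) * (2 * exp (- (t * (2 * e))))" if "t > 0" for p t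
  proof -
    have "2 * e * t \<le> (f (fst p) + f (snd p)) * t"
      using f[of "fst p"] f[of "snd p"] that by (intro mult_right_mono) auto
    then have "exp (- ((f (fst p) + f (snd p)) * t)) \<le> exp (- (t * (2 * e)))"
      by (simp add: mult_ac)
    then show ?thesis
      unfolding \<psi>_def norm_mult complex_mod_cnj
      by (intro mult_left_mono order_trans[OF norm_triangle_ineq]) (auto simp: Re_w)
  qed
  have hh: "integrable ?P (\<lambda>p. h (fst p) * cnj (h (snd p)))"
    using lborel_pair.integrable_pair_mult[OF h integrable_cnj[OF h]] by (simp add: case_prod_unfold)
  have e_int: "integrable lborel (\<lambda>t. complex_of_real (indicator {0<..} t * (2 * exp (- (t * (2 * e))))))"
  proof (rule integrable_of_real)
    show "integrable lborel (\<lambda>t. indicator {0<..} t * (2 * exp (- (t * (2 * e)))))"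
      using integrable_mult_right[of 2, OF integrable_I0i_exp_mscale[of "2 * e", unfolded set_integrable_def]] \<open>e > 0\<close>
      by (simp add: mult.left_commute)
  qed
  have int3: "integrable (?P \<Otimes>\<^sub>M lborel) (\<lambda>(p, t). indicator {0<..} t *\<^sub>R \<psi> p t)"
    using P.integrable_pair_mult[OF hh e_int]
    by (rule Bochner_Integration.integrable_bound)
       (auto simp: norm_mult indicator_def intro!: AE_I2 order_trans[OF \<psi>_le])
  have "(\<integral>\<^sup>+t. ennreal ((norm (E t))\<^sup>2) * indicator {0<..} t \<partial>lborel) \<le>
    (\<integral>\<^sup>+t. ennreal (Re (LINT p|?P. indicator {0<..} t *\<^sub>R \<psi> p t)) \<partial>lborel)"
  proof (intro nn_integral_mono)
    fix t
    show "ennreal ((norm (E t))\<^sup>2) * indicator {0<..} t \<le> ennreal (Re (LINT p|?P. indicator {0<..} t *\<^sub>R \<psi> p t))"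
      using E[of t, symmetric] by (cases "t > 0") (auto intro!: ennreal_leI)
  qed
  also have "\<dots> = ennreal (LINT t|lborel. Re (LINT p|?P. indicator {0<..} t *\<^sub>R \<psi> p t))"
  proof (rule nn_integral_eq_integral)
    show "integrable lborel (\<lambda>t. Re (LINT p|?P. indicator {0<..} t *\<^sub>R \<psi> p t))"
      by (rule integrable_Re[OF P.integrable_snd[OF int3]])
    have "0 \<le> Re (LINT p|?P. indicator {0<..} t *\<^sub>R \<psi> p t)" for t
      using E[of t, symmetric] by (cases "t > 0") auto
    then show "AE t in lborel. 0 \<le> Re (LINT p|?P. indicator {0<..} t *\<^sub>R \<psi> p t)" by simp
  qed
  also have "(LINT t|lborel. Re (LINT p|?P. indicator {0<..} t *\<^sub>R \<psi> p t)) =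
     Re (LINT t|lborel. LINT p|?P. indicator {0<..} t *\<^sub>R \<psi> p t)"
    by (rule integral_Re[OF P.integrable_snd[OF int3]])
  also have "(LINT t|lborel. LINT p|?P. indicator {0<..} t *\<^sub>R \<psi> p t) =
     (LINT p|?P. LINT t|lborel. indicator {0<..} t *\<^sub>R \<psi> p t)"
    by (rule P.Fubini_integral[OF int3])
  also have inner: "(\<lambda>p. LINT t|lborel. indicator {0<..} t *\<^sub>R \<psi> p t) =
     (\<lambda>p. h (fst p) * cnj (h (snd p)) * of_real (2 * ((f (fst p) + f (snd p)) / ((f (fst p) + f (snd p))\<^sup>2 + (fst p - snd p)\<^sup>2))))"
  proof
    fix p
    define a b where "a = w (fst p) + cnj (w (snd p))" and "b = cnj (w (fst p)) + w (snd p)"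
    have ab: "Re a > 0" "Re b > 0" "b = cnj a" using f_pos by (auto simp: a_def b_def Re_w add_pos_pos)
    have "(LINT t|lborel. indicator {0<..} t *\<^sub>R \<psi> p t) =
      (LINT t|lborel. h (fst p) * cnj (h (snd p)) * (indicator {0<..} t *\<^sub>R exp (- (a * complex_of_real t)) + indicator {0<..} t *\<^sub>R exp (- (b * complex_of_real t))))"
      unfolding \<psi>_def a_def b_def
      by (intro Bochner_Integration.integral_cong) (auto simp: algebra_simps)
    also have "\<dots> = h (fst p) * cnj (h (snd p)) * (1 / a + 1 / b)"
      using set_integral_exp_complex[OF ab(1)] set_integral_exp_complex[OF ab(2)]
        set_integrable_exp_complex[OF ab(1)] set_integrable_exp_complex[OF ab(2)]
      by (simp add: set_integrable_def set_lebesgue_integral_def)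
    also have "1 / a + 1 / b = (a + cnj a) / (a * cnj a)"
    proof -
      have "a \<noteq> 0" using ab(1) by auto
      then show ?thesis by (simp add: ab(3) field_simps)
    qed
    also have "\<dots> = of_real (2 * Re a / ((Re a)\<^sup>2 + (Im a)\<^sup>2))"
      by (simp add: complex_add_cnj complex_mult_cnj)
    also have "\<dots> = of_real (2 * ((f (fst p) + f (snd p)) / ((f (fst p) + f (snd p))\<^sup>2 + (fst p - snd p)\<^sup>2)))"
      by (simp add: a_def Re_w)
    finally show "(LINT t|lborel. indicator {0<..} t *\<^sub>R \<psi> p t) =
        h (fst p) * cnj (h (snd p)) * of_real (2 * ((f (fst p) + f (snd p)) / ((f (fst p) + f (snd p))\<^sup>2 + (fst p - snd p)\<^sup>2)))" .
  qed
  \<comment> \<open>Absolute values may be inserted now without spoiling the estimate, since the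
    kernel has become nonnegative and the bound for its form concerns nonnegative functions
    anyway.\<close>
  also have "ennreal (Re (LINT p|?P. h (fst p) * cnj (h (snd p)) * of_real (2 * ((f (fst p) + f (snd p)) / ((f (fst p) + f (snd p))\<^sup>2 + (fst p - snd p)\<^sup>2)))))
    \<le> ennreal (norm (LINT p|?P. h (fst p) * cnj (h (snd p)) * of_real (2 * ((f (fst p) + f (snd p)) / ((f (fst p) + f (snd p))\<^sup>2 + (fst p - snd p)\<^sup>2)))))"
    by (intro ennreal_leI complex_Re_le_cmod)
  also have "\<dots> \<le> (\<integral>\<^sup>+p. ennreal (norm (h (fst p) * cnj (h (snd p)) * of_real (2 * ((f (fst p) + f (snd p)) / ((f (fst p) + f (snd p))\<^sup>2 + (fst p - snd p)\<^sup>2))))) \<partial>?P)"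
    using P.integrable_fst[OF int3] unfolding inner by (rule integral_norm_bound_ennreal)
  also have "\<dots> = (\<integral>\<^sup>+p. 2 * ennreal (norm (h (fst p)) * norm (h (snd p)) * ((f (fst p) + f (snd p)) / ((f (fst p) + f (snd p))\<^sup>2 + (fst p - snd p)\<^sup>2))) \<partial>?P)"
  proof (intro nn_integral_cong)
    fix p
    have "0 \<le> (f (fst p) + f (snd p)) / ((f (fst p) + f (snd p))\<^sup>2 + (fst p - snd p)\<^sup>2)"
      using f_pos[of "fst p"] f_pos[of "snd p"] by simp
    then show "ennreal (norm (h (fst p) * cnj (h (snd p)) * of_real (2 * ((f (fst p) + f (snd p)) / ((f (fst p) + f (snd p))\<^sup>2 + (fst p - snd p)\<^sup>2))))) =
        2 * ennreal (norm (h (fst p)) * norm (h (snd p)) * ((f (fst p) + f (snd p)) / ((f (fst p) + f (snd p))\<^sup>2 + (fst p - snd p)\<^sup>2)))"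
      by (simp only: norm_mult norm_of_real complex_mod_cnj abs_mult abs_numeral abs_of_nonneg
          mult.left_commute[of _ 2] ennreal_mult' ennreal_numeral zero_le_numeral)
  qed
  also have "\<dots> = 2 * (\<integral>\<^sup>+p. ennreal (norm (h (fst p)) * norm (h (snd p)) * ((f (fst p) + f (snd p)) / ((f (fst p) + f (snd p))\<^sup>2 + (fst p - snd p)\<^sup>2))) \<partial>?P)"
    by (rule nn_integral_cmult) measurable
  also have "(\<integral>\<^sup>+p. ennreal (norm (h (fst p)) * norm (h (snd p)) * ((f (fst p) + f (snd p)) / ((f (fst p) + f (snd p))\<^sup>2 + (fst p - snd p)\<^sup>2))) \<partial>?P)
    = (\<integral>\<^sup>+x. \<integral>\<^sup>+y. ennreal (norm (h x) * norm (h y) * ((f x + f y) / ((f x + f y)\<^sup>2 + (x - y)\<^sup>2))) \<partial>lborel \<partial>lborel)"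
    by (subst lborel.nn_integral_fst[symmetric]) auto
  also have "2 * \<dots> \<le> 2 * (ennreal (8 * pi) * (\<integral>\<^sup>+x. ennreal ((norm (h x))\<^sup>2) \<partial>lborel))"
    using h by (intro mult_left_mono poisson_quadratic_form_le[OF _ _ \<open>e > 0\<close> f]) (auto simp: integrable_iff_bounded)
  also have "\<dots> = ennreal (16 * pi) * (\<integral>\<^sup>+x. ennreal ((norm (h x))\<^sup>2) \<partial>lborel)"
    using ennreal_mult'[of 2 "8 * pi"] by (simp add: mult.assoc[symmetric])
  finally show ?thesis unfolding E_def w_def .
qed

text \<open>Duality with an explicit test function: pairing the transform \<open>G\<close> with its
  own truncated conjugate \<open>h\<close> gives X on one side and, by Fubini, the pairing of
  \<open>g\<close> with the adjoint \<open>H\<close> on the other. Hence X^2 \<le> |g|^2 * 16 pi *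
  X. Since \<open>G\<close> is bounded by the L1-norm of \<open>g\<close>, the truncation makes X
  finite, and X can be cancelled.\<close>

lemma laplace_graph_L2_le_aux:
  fixes f :: "real \<Rightarrow> real" and g :: "real \<Rightarrow> complex" and e :: real
  assumes [measurable]: "f \<in> borel_measurable borel" and g: "integrable lborel g"
    and g0: "\<And>t. t \<le> 0 \<Longrightarrow> g t = 0" and "e > 0" and f: "\<And>x. e \<le> f x"
  shows "(\<integral>\<^sup>+x. ennreal ((norm (LINT t|lborel. g t * exp (- ((of_real (f x) + \<i> * of_real x) * of_real t))))\<^sup>2) \<partial>lborel)
    \<le> ennreal (16 * pi) * (\<integral>\<^sup>+t. ennreal ((norm (g t))\<^sup>2) \<partial>lborel)"
proof -
  have [measurable]: "g \<in> borel_measurable borel" using g by auto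
  have [measurable]: "cnj \<in> borel_measurable borel"
    by (intro borel_measurable_continuous_onI continuous_intros)
  have f_pos: "f x > 0" for x using f[of x] \<open>e > 0\<close> by simp
  define k where "k x t = exp (- ((complex_of_real (f x) + \<i> * of_real x) * of_real t))" for x t
  have [measurable]: "(\<lambda>(x, t). k x t) \<in> borel_measurable (borel \<Otimes>\<^sub>M borel)"
    unfolding k_def by measurable
  have k_le: "norm (g t * k x t) \<le> norm (g t)" for x t
    using f_pos[of x] g0[of t]
    by (cases "t > 0") (auto simp: k_def norm_mult intro!: mult_right_le_one_le)
  define G where "G x = (LINT t|lborel. g t * k x t)" for x
  have [measurable]: "G \<in> borel_measurable borel"
    unfolding G_def by measurable
  have gk: "integrable lborel (\<lambda>t. g t * k x t)" for x
    using k_le by (intro Bochner_Integration.integrable_bound[OF g]) auto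
  define B where "B = (LINT t|lborel. norm (g t))"
  have G_le: "norm (G x) \<le> B" for x
    unfolding G_def B_def using g gk k_le
    by (intro order_trans[OF integral_norm_bound] integral_mono integrable_norm) auto
  define I :: "nat \<Rightarrow> real \<Rightarrow> real" where "I n x = indicator {- real n..real n} x" for n x
  have I[measurable]: "I n \<in> borel_measurable borel" "I n x = 0 \<or> I n x = (1::real)" for n x
    by (auto simp: I_def[abs_def] indicator_def)
  have I_int: "integrable lborel (\<lambda>x. I n x * c)" for n and c :: real
    unfolding I_def by (intro integrable_mult_left) (simp add: integrable_indicator_iff)
  have X: "(\<integral>\<^sup>+x. ennreal (I n x * (norm (G x))\<^sup>2) \<partial>lborel) \<le> ennreal (16 * pi) * (\<integral>\<^sup>+t. ennreal ((norm (g t))\<^sup>2) \<partial>lborel)" for n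
  proof -
    \<comment> \<open>The cutoff takes only the values 0 and 1, so the square norm of
      \<open>h\<close> is again the integrand of X; this is what closes the estimate.\<close>
    define h where "h x = of_real (I n x) * cnj (G x)" for x
    have [measurable]: "h \<in> borel_measurable borel" unfolding h_def by measurable
    have h: "integrable lborel h"
      using G_le I(2)[of n]
      by (intro Bochner_Integration.integrable_bound[OF I_int[of n B]] AE_I2)
         (auto simp: h_def norm_mult abs_mult intro!: mult_left_mono intro: order_trans[OF _ abs_ge_self])
    define H where "H t = (LINT x|lborel. h x * k x t)" for t
    define X where "X = (\<integral>\<^sup>+x. ennreal (I n x * (norm (G x))\<^sup>2) \<partial>lborel)"
    have int: "integrable lborel (\<lambda>x. I n x * (norm (G x))\<^sup>2)"
      by (intro Bochner_Integration.integrable_bound[OF I_int[of n "B\<^sup>2"]] AE_I2)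
         (auto simp: abs_mult intro!: mult_left_mono power_mono G_le)
    have X1: "X = ennreal (LINT x|lborel. I n x * (norm (G x))\<^sup>2)"
      unfolding X_def using int I(2)[of n]
      by (intro nn_integral_eq_integral AE_I2) (auto intro!: mult_nonneg_nonneg simp: I_def)
    have hh: "(norm (h x))\<^sup>2 = I n x * (norm (G x))\<^sup>2" for x
      using I(2)[of n x] by (auto simp: h_def norm_mult)
    have int2: "integrable (lborel \<Otimes>\<^sub>M lborel) (\<lambda>(x, t). h x * (g t * k x t))"
      using lborel_pair.integrable_pair_mult[OF h g]
      by (rule Bochner_Integration.integrable_bound) (auto simp: norm_mult intro!: AE_I2 mult_left_mono k_le[unfolded norm_mult])
    have "complex_of_real (LINT x|lborel. I n x * (norm (G x))\<^sup>2) = (LINT x|lborel. h x * G x)"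
    proof -
      have "of_real (I n x * (norm (G x))\<^sup>2) = h x * G x" for x
        by (simp only: of_real_mult complex_norm_square h_def mult_ac)
      then have "(LINT x|lborel. complex_of_real (I n x * (norm (G x))\<^sup>2)) = (LINT x|lborel. h x * G x)"
        by (simp only:)
      then show ?thesis by (subst (asm) integral_complex_of_real)
    qed
    also have "\<dots> = (LINT x|lborel. LINT t|lborel. h x * (g t * k x t))"
      unfolding G_def by simp
    also have "\<dots> = (LINT t|lborel. LINT x|lborel. h x * (g t * k x t))"
      by (rule lborel_pair.Fubini_integral[OF int2, symmetric])
    also have "(\<lambda>t. LINT x|lborel. h x * (g t * k x t)) = (\<lambda>t. g t * H t)"
      unfolding H_def integral_mult_right_zero[symmetric] by (simp only: mult.left_commute)
    finally have eq: "complex_of_real (LINT x|lborel. I n x * (norm (G x))\<^sup>2) = (LINT t|lborel. g t * H t)" .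
    have [measurable]: "H \<in> borel_measurable borel" unfolding H_def by measurable
    have int3: "integrable lborel (\<lambda>t. g t * H t)"
      using lborel_pair.integrable_snd[OF int2]
      unfolding H_def integral_mult_right_zero[symmetric] by (simp only: mult.left_commute)
    have "X \<le> ennreal (norm (LINT t|lborel. g t * H t))"
      unfolding X1 eq[symmetric] by (intro ennreal_leI) (simp add: abs_ge_self)
    also have "\<dots> \<le> (\<integral>\<^sup>+t. ennreal (norm (g t * H t)) \<partial>lborel)"
      by (rule integral_norm_bound_ennreal[OF int3])
    also have "\<dots> = (\<integral>\<^sup>+t. ennreal (norm (g t)) * ennreal (norm (H t) * indicator {0<..} t) \<partial>lborel)"
      using g0 by (intro nn_integral_cong) (auto simp: norm_mult ennreal_mult indicator_def not_less)
    finally have 1: "X \<le> (\<integral>\<^sup>+t. ennreal (norm (g t)) * ennreal (norm (H t) * indicator {0<..} t) \<partial>lborel)" .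
    have "(\<integral>\<^sup>+t. (ennreal (norm (H t) * indicator {0<..} t))\<^sup>2 \<partial>lborel) =
       (\<integral>\<^sup>+t. ennreal ((norm (H t))\<^sup>2) * indicator {0<..} t \<partial>lborel)"
      by (intro nn_integral_cong) (auto simp: ennreal_power indicator_def)
    also have "\<dots> \<le> ennreal (16 * pi) * (\<integral>\<^sup>+x. ennreal ((norm (h x))\<^sup>2) \<partial>lborel)"
      unfolding H_def k_def by (rule adjoint_laplace_L2_le[OF _ h \<open>e > 0\<close> f]) measurable
    finally have 2: "(\<integral>\<^sup>+t. (ennreal (norm (H t) * indicator {0<..} t))\<^sup>2 \<partial>lborel) \<le> ennreal (16 * pi) * X"
      by (simp only: X_def hh)
    have "X\<^sup>2 \<le> (\<integral>\<^sup>+t. ennreal (norm (g t)) * ennreal (norm (H t) * indicator {0<..} t) \<partial>lborel)\<^sup>2"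
      using 1 by (rule power_mono) simp
    also have "\<dots> \<le> (\<integral>\<^sup>+t. (ennreal (norm (g t)))\<^sup>2 \<partial>lborel) * (\<integral>\<^sup>+t. (ennreal (norm (H t) * indicator {0<..} t))\<^sup>2 \<partial>lborel)"
      by (intro Cauchy_Schwarz_nn_integral) measurable
    also have "\<dots> \<le> (\<integral>\<^sup>+t. (ennreal (norm (g t)))\<^sup>2 \<partial>lborel) * (ennreal (16 * pi) * X)"
      by (intro mult_left_mono 2) simp
    also have "\<dots> = (ennreal (16 * pi) * (\<integral>\<^sup>+t. ennreal ((norm (g t))\<^sup>2) \<partial>lborel)) * X"
      by (simp add: ennreal_power mult_ac)
    finally have "X\<^sup>2 \<le> (ennreal (16 * pi) * (\<integral>\<^sup>+t. ennreal ((norm (g t))\<^sup>2) \<partial>lborel)) * X" .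
    then show ?thesis
      unfolding X_def[symmetric] by (rule ennreal_le_of_sq_le_mult) (simp add: X1)
  qed
  show ?thesis
    unfolding k_def[symmetric] G_def[symmetric]
  proof (rule nn_integral_le_limit[OF _ _ X tendsto_const])
    have "(\<lambda>n. ennreal (I n x * (norm (G x))\<^sup>2)) \<longlonglongrightarrow> ennreal ((norm (G x))\<^sup>2)" for x
    proof (rule tendsto_eventually)
      obtain N where N: "\<bar>x\<bar> \<le> real N" using real_arch_simple by blast
      have "I n x = 1" if "n \<ge> N" for n
        using N that by (auto simp: I_def indicator_def)
      then show "\<forall>\<^sub>F n in sequentially. ennreal (I n x * (norm (G x))\<^sup>2) = ennreal ((norm (G x))\<^sup>2)"
        unfolding eventually_sequentially by (intro exI[of _ N]) simp
    qed
    then show "AE x in lborel. (\<lambda>n. ennreal (I n x * (norm (G x))\<^sup>2)) \<longlonglongrightarrow> ennreal ((norm (G x))\<^sup>2)"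
      by simp
  qed measurable
qed

text \<open>Shifting the graph to the right by 1 / (n + 1) makes \<open>f\<close> bounded below by a
  positive number. The constant does not see the shift, the transforms converge pointwise with
  majorant \<open>norm (g t)\<close>, and Fatou finishes.\<close>

lemma laplace_graph_L2_le:
  fixes f :: "real \<Rightarrow> real" and g :: "real \<Rightarrow> complex"
  assumes [measurable]: "f \<in> borel_measurable borel" and g: "integrable lborel g"
    and g0: "\<And>t. t \<le> 0 \<Longrightarrow> g t = 0" and f: "\<And>x. 0 \<le> f x"
  shows "(\<integral>\<^sup>+x. ennreal ((norm (LINT t|lborel. g t * exp (- ((of_real (f x) + \<i> * of_real x) * of_real t))))\<^sup>2) \<partial>lborel)
    \<le> ennreal (16 * pi) * (\<integral>\<^sup>+t. ennreal ((norm (g t))\<^sup>2) \<partial>lborel)"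
proof -
  have [measurable]: "g \<in> borel_measurable borel" using g by auto
  define G where "G d x = (LINT t|lborel. g t * exp (- ((of_real (f x + d) + \<i> * of_real x) * of_real t)))" for d x
  have [measurable]: "G d \<in> borel_measurable borel" for d
    unfolding G_def by measurable
  have le: "(\<integral>\<^sup>+x. ennreal ((norm (G (inverse (real (Suc n))) x))\<^sup>2) \<partial>lborel)
    \<le> ennreal (16 * pi) * (\<integral>\<^sup>+t. ennreal ((norm (g t))\<^sup>2) \<partial>lborel)" for n
    unfolding G_def using f
    by (intro laplace_graph_L2_le_aux[where e="inverse (real (Suc n))"] g g0) auto
  have lim: "(\<lambda>n. G (inverse (real (Suc n))) x) \<longlonglongrightarrow> G 0 x" for x
    unfolding G_def
  proof (rule integral_dominated_convergence[where w="\<lambda>t. norm (g t)"])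
    show "AE t in lborel. (\<lambda>n. g t * exp (- ((of_real (f x + inverse (real (Suc n))) + \<i> * of_real x) * of_real t)))
      \<longlonglongrightarrow> g t * exp (- ((of_real (f x + 0) + \<i> * of_real x) * of_real t))"
      by (intro AE_I2 tendsto_intros LIMSEQ_inverse_real_of_nat)
    show "AE t in lborel. norm (g t * exp (- ((of_real (f x + inverse (real (Suc n))) + \<i> * of_real x) * of_real t))) \<le> norm (g t)" for n
    proof (intro AE_I2)
      fix t
      define d where "d = f x + inverse (real (Suc n))"
      have "0 \<le> d" unfolding d_def using f[of x] by (simp add: add_nonneg_nonneg)
      then show "norm (g t * exp (- ((of_real (f x + inverse (real (Suc n))) + \<i> * of_real x) * of_real t))) \<le> norm (g t)"
        unfolding d_def[symmetric]
        using g0[of t] by (cases "t > 0") (auto simp: norm_mult intro!: mult_right_le_one_le)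
    qed
  qed (use g in auto)
  have "(\<integral>\<^sup>+x. ennreal ((norm (G 0 x))\<^sup>2) \<partial>lborel) \<le> ennreal (16 * pi) * (\<integral>\<^sup>+t. ennreal ((norm (g t))\<^sup>2) \<partial>lborel)"
    by (rule nn_integral_le_limit[where F="\<lambda>n x. ennreal ((norm (G (inverse (real (Suc n))) x))\<^sup>2)", OF _ _ le tendsto_const])
       (measurable, intro AE_I2 tendsto_ennrealI tendsto_intros lim)
  then show ?thesis unfolding G_def by simp
qed

section \<open>Arclength of Lipschitz curves\<close>

lemma curve_length_le_lipschitz:
  assumes "\<And>x y. x \<in> {a..b} \<Longrightarrow> y \<in> {a..b} \<Longrightarrow> dist (c x) (c y) \<le> L * \<bar>x - y\<bar>" "0 \<le> L" "a \<le> b"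
  shows "curve_length c a b \<le> ennreal (L * (b - a))"
  unfolding curve_length_def
proof (rule SUP_least, clarify)
  fix t :: "nat \<Rightarrow> real" and n
  assume t: "mono t" "range t \<subseteq> {a..b}"
  have mem: "t i \<in> {a..b}" for i using t(2) by (rule subsetD) simp
  have "(\<Sum>i<n. ennreal (dist (c (t i)) (c (t (Suc i))))) \<le> (\<Sum>i<n. ennreal (L * (t (Suc i) - t i)))"
  proof (intro sum_mono ennreal_leI)
    fix i
    have "t i \<le> t (Suc i)" using t(1) by (simp add: mono_def)
    then show "dist (c (t i)) (c (t (Suc i))) \<le> L * (t (Suc i) - t i)"
      using assms(1)[OF mem mem, of i "Suc i"] by simp
  qed
  also have "\<dots> = ennreal (\<Sum>i<n. L * (t (Suc i) - t i))"
    using t(1) assms(2) by (intro sum_ennreal) (simp add: mono_def)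
  also have "(\<Sum>i<n. L * (t (Suc i) - t i)) = L * (t n - t 0)"
    by (simp add: sum_distrib_left[symmetric] sum_lessThan_telescope)
  also have "ennreal (L * (t n - t 0)) \<le> ennreal (L * (b - a))"
    using mem[of n] mem[of 0] assms(2) by (intro ennreal_leI mult_left_mono) auto
  finally show "(\<Sum>i<n. ennreal (dist (c (t i)) (c (t (Suc i))))) \<le> ennreal (L * (b - a))" .
qed

text \<open>Exhaustion by compact intervals without a case distinction on the type of the interval:
  running minima and maxima of an enumeration of a countable subset that reaches below and above
  every point.\<close>

lemma interval_eq_Union_Icc:
  fixes I :: "real set"
  assumes "is_interval I" "I \<noteq> {}"
  obtains u v :: "nat \<Rightarrow> real" where "decseq u" "incseq v" "\<And>n. u n \<le> v n" "I = (\<Union>n. {u n..v n})"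
proof -
  obtain T where T: "countable T" "T \<subseteq> I" "I \<subseteq> closure T"
    using separable by blast
  \<comment> \<open>A dense countable subset may miss an endpoint that belongs to \<open>I\<close>.
    Each added set holds at most one point, so countability is kept.\<close>
  define T' where "T' = T \<union> ({x \<in> I. \<forall>y\<in>I. x \<le> y} \<union> {x \<in> I. \<forall>y\<in>I. y \<le> x})"
  have "T \<noteq> {}" using T(3) assms(2) by auto
  then have T'_ne: "T' \<noteq> {}" by (auto simp: T'_def)
  have sing: "countable S" if "\<And>x y. x \<in> S \<Longrightarrow> y \<in> S \<Longrightarrow> x = y" for S :: "real set"
  proof (cases "S = {}")
    case False
    then obtain x where "x \<in> S" by auto
    then have "S = {x}" using that by auto
    then show ?thesis by (metis countable_empty countable_insert)
  qed simp
  have "countable T'"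
    unfolding T'_def by (intro countable_Un T(1); rule sing) (auto intro: antisym)
  then obtain r :: "nat \<Rightarrow> real" where r: "range r = T'"
    using T'_ne by (metis range_from_nat_into)
  have T'_I: "T' \<subseteq> I" using T(2) by (auto simp: T'_def)
  have btw: "z \<in> I" if "x \<in> I" "y \<in> I" "x \<le> z" "z \<le> y" for x y z
    using assms(1)[unfolded is_interval_1] that by blast
  have meets: "\<exists>s\<in>T. x < s \<and> s < y" if "x \<in> I" "y \<in> I" "x < y" for x y
  proof -
    have "(x + y) / 2 \<in> closure T"
      using T(3) btw[OF that(1,2), of "(x + y) / 2"] that(3) by auto
    moreover have "open {x<..<y}" "(x + y) / 2 \<in> {x<..<y}" using that(3) by auto
    ultimately have "{x<..<y} \<inter> T \<noteq> {}"
      using open_Int_closure_eq_empty by blast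
    then show ?thesis by auto
  qed
  have below: "\<exists>s\<in>T'. s \<le> x" if "x \<in> I" for x
  proof (cases "\<forall>y\<in>I. x \<le> y")
    case True
    then show ?thesis using that by (intro bexI[of _ x]) (auto simp: T'_def)
  next
    case False
    then obtain y where "y \<in> I" "y < x" by (auto simp: not_le)
    then have "\<exists>s\<in>T. s < x" using meets[of y x] that by blast
    then show ?thesis unfolding T'_def by (meson UnI1 less_imp_le)
  qed
  have above: "\<exists>s\<in>T'. x \<le> s" if "x \<in> I" for x
  proof (cases "\<forall>y\<in>I. y \<le> x")
    case True
    then show ?thesis using that by (intro bexI[of _ x]) (auto simp: T'_def)
  next
    case False
    then obtain y where "y \<in> I" "x < y" by (auto simp: not_le)
    then have "\<exists>s\<in>T. x < s" using meets[of x y] that by blast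
    then show ?thesis unfolding T'_def by (meson UnI1 less_imp_le)
  qed
  define u where "u n = Min (r ` {..n})" for n
  define v where "v n = Max (r ` {..n})" for n
  have u_in: "u n \<in> I" and v_in: "v n \<in> I" for n
    using Min_in[of "r ` {..n}"] Max_in[of "r ` {..n}"] r T'_I unfolding u_def v_def by blast+
  have le: "u n \<le> r k" "r k \<le> v n" if "k \<le> n" for n k
    using that by (auto simp: u_def v_def)
  show thesis
  proof
    show "decseq u" unfolding decseq_def u_def by (auto intro!: Min_antimono)
    show "incseq v" unfolding incseq_def v_def by (auto intro!: Max_mono)
    show "u n \<le> v n" for n using le[of 0 n] by simp
    show "I = (\<Union>n. {u n..v n})"
    proof (intro set_eqI iffI)
      fix x assume "x \<in> I"
      then obtain i j where "r i \<le> x" "x \<le> r j"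
        using below[of x] above[of x] r by (metis imageE)
      then have "x \<in> {u (max i j)..v (max i j)}"
        using le(1)[of i "max i j"] le(2)[of j "max i j"] by auto
      then show "x \<in> (\<Union>n. {u n..v n})" by blast
    qed (auto intro: btw[OF u_in v_in])
  qed
qed

text \<open>The measure produced by \<open>extend_measure\<close> lives on the sigma-algebra of its
  generators; continuity of the curve can be used only once this is known to be the Borel one. If
  \<open>I\<close> is not closed, \<open>I \<inter> {a..b}\<close> need not be a generator, but it
  is a countable union of generators by exhaustion.\<close>

lemma sigma_sets_Icc_interval:
  fixes I :: "real set"
  assumes "is_interval I"
  shows "sigma_sets I {{a..b} | a b. a \<le> b \<and> {a..b} \<subseteq> I} = sets (restrict_space borel I)"
    (is "sigma_sets I ?G = _")
proof (intro antisym)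
  have "{a..b} \<in> sets (restrict_space borel I)" if "{a..b} \<subseteq> I" for a b
    using that unfolding sets_restrict_space by (intro image_eqI[of _ _ "{a..b}"]) auto
  then have "?G \<subseteq> sets (restrict_space borel I)" by blast
  then show "sigma_sets I ?G \<subseteq> sets (restrict_space borel I)"
    using sets.sigma_sets_subset[of ?G "restrict_space borel I"] by (simp add: space_restrict_space)
next
  have Icc: "I \<inter> {a..b} \<in> sigma_sets I ?G" for a b
  proof (cases "I = {}")
    case False
    obtain u v :: "nat \<Rightarrow> real" where "decseq u" "incseq v" "\<And>n. u n \<le> v n"
      and uv: "I = (\<Union>n. {u n..v n})"
      by (rule interval_eq_Union_Icc[OF assms False]) (rule that)
    have "I \<inter> {a..b} = (\<Union>n. {max (u n) a..min (v n) b})"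
      unfolding uv by auto
    moreover have "{max (u n) a..min (v n) b} \<in> sigma_sets I ?G" for n
    proof (cases "max (u n) a \<le> min (v n) b")
      case True
      moreover have "{max (u n) a..min (v n) b} \<subseteq> I" unfolding uv by auto
      ultimately show ?thesis by (intro sigma_sets.Basic) blast
    next
      case False
      \<comment> \<open>Generators satisfy \<open>a \<le> b\<close>, so empty intersections have to
        come from the sigma-algebra itself.\<close>
      then have "{max (u n) a..min (v n) b} = {}" by (simp only: atLeastatMost_empty_iff not_le)
      then show ?thesis using sigma_sets.Empty[of I ?G] by (simp only:)
    qed
    ultimately show ?thesis by (simp only:) (rule sigma_sets.Union)
  qed (simp add: sigma_sets.Empty)
  have "I \<inter> A \<in> sigma_sets I ?G" if "A \<in> sigma_sets UNIV (range (\<lambda>(a, b). {a..b}))" for A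
    using that
  proof induction
    case (Basic A)
    then show ?case using Icc by auto
  next
    case Empty
    then show ?case by (simp add: sigma_sets.Empty)
  next
    case (Compl A)
    have "I \<inter> (UNIV - A) = I - I \<inter> A" by auto
    then show ?case using sigma_sets.Compl[OF Compl.IH] by simp
  next
    case (Union A)
    have "I \<inter> (\<Union>i. A i) = (\<Union>i. I \<inter> A i)" by auto
    then show ?case using sigma_sets.Union[of "\<lambda>i. I \<inter> A i", OF Union.IH] by simp
  qed
  moreover have "sets (borel :: real measure) = sigma_sets UNIV (range (\<lambda>(a, b). {a..b}))"
    by (subst borel_eq_atLeastAtMost) simp
  ultimately show "sets (restrict_space borel I) \<subseteq> sigma_sets I ?G"
    unfolding sets_restrict_space by auto
qed

text \<open>An outer-measure argument: cover by countably many non-overlapping compact intervals of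
  nearly the same Lebesgue measure and apply the hypothesis to each. Only an upper bound on closed
  intervals is at hand, so subadditivity takes the place of a uniqueness theorem for
  measures.\<close>

lemma emeasure_le_lborel_if_Icc:
  fixes M :: "real measure"
  assumes I: "is_interval I" and sets: "sets M = sets (restrict_space borel I)"
    and le: "\<And>a b. a \<le> b \<Longrightarrow> {a..b} \<subseteq> I \<Longrightarrow> emeasure M {a..b} \<le> ennreal (L * (b - a))"
    and L: "0 \<le> L" and A: "A \<in> sets M"
  shows "emeasure M A \<le> ennreal L * emeasure lborel A"
proof (cases "I = {}")
  case True
  then have "A = {}" using A sets.sets_into_space[OF A] sets_eq_imp_space_eq[OF sets] by (auto simp: space_restrict_space)
  then show ?thesis by simp
next
  case False
  have Icc_sets: "{a..b} \<in> sets M" if "{a..b} \<subseteq> I" for a b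
    using that unfolding sets sets_restrict_space by (intro image_eqI[of _ _ "{a..b}"]) auto
  have A_borel: "B \<in> sets borel" if "B \<in> sets M" for B
  proof -
    have "I \<in> sets borel" using I by (rule real_interval_borel_measurable)
    then show ?thesis using that unfolding sets by (auto simp: sets_restrict_space)
  qed
  have bounded: "emeasure M B \<le> ennreal L * emeasure lborel B"
    if B: "B \<in> sets M" "B \<subseteq> {a..b}" "{a..b} \<subseteq> I" for B a b
  proof (rule ennreal_le_epsilon)
    fix e :: real assume "e > 0"
    \<comment> \<open>Dividing by \<open>L + 1\<close> keeps the quotient meaningful for
      \<open>L = 0\<close>.\<close>
    define e' where "e' = e / (L + 1)"
    have e': "e' > 0" "L * e' \<le> e" using \<open>e > 0\<close> L by (auto simp: e'_def field_simps)
    have Bl: "B \<in> lmeasurable"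
      using A_borel[OF B(1)] B(2) by (intro bounded_set_imp_lmeasurable bounded_subset[OF _ B(2)]) auto
    obtain D where D: "countable D"
        "\<And>K. K \<in> D \<Longrightarrow> K \<subseteq> cbox a b \<and> K \<noteq> {} \<and> (\<exists>c d. K = cbox c d)"
        "pairwise (\<lambda>A B. interior A \<inter> interior B = {}) D"
        "B \<subseteq> \<Union>D" "\<Union>D \<in> lmeasurable" "measure lebesgue (\<Union>D) \<le> measure lebesgue B + e'"
      using measurable_outer_intervals_bounded[OF Bl _ e'(1), of a b] B(2)
      by (metis (no_types, lifting) box_real(2))
    define K where "K n = (if n \<in> to_nat_on D ` D then from_nat_into D n else {})" for n
    have K: "K n = {} \<or> (\<exists>c d. c \<le> d \<and> K n = {c..d} \<and> {c..d} \<subseteq> {a..b})" for n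
      using D(2)[of "K n"] D(1) by (fastforce simp: K_def)
    have UK: "(\<Union>n. K n) = \<Union>D"
      using D(1) by (force simp: K_def split: if_splits)
    have disj: "disjoint_family (\<lambda>n. interior (K n))"
      unfolding disjoint_family_on_def
    proof (intro ballI impI)
      fix m n :: nat assume "m \<noteq> n"
      show "interior (K m) \<inter> interior (K n) = {}"
      proof (cases "m \<in> to_nat_on D ` D \<and> n \<in> to_nat_on D ` D")
        case True
        then have "K m \<in> D" "K n \<in> D" "K m \<noteq> K n"
          using D(1) \<open>m \<noteq> n\<close> by (auto simp: K_def)
        then show ?thesis using D(3) by (auto simp: pairwise_def)
      qed (auto simp: K_def)
    qed
    \<comment> \<open>Covering intervals may share endpoints. Their interiors are disjoint and have
      the same length, so the Lebesgue side adds up exactly.\<close>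
    have KM: "K n \<in> sets M" "emeasure M (K n) \<le> ennreal L * emeasure lborel (interior (K n))" for n
    proof -
      consider "K n = {}" | c d where "c \<le> d" "K n = {c..d}" "{c..d} \<subseteq> I"
        using K[of n] B(3) by blast
      then show "K n \<in> sets M" "emeasure M (K n) \<le> ennreal L * emeasure lborel (interior (K n))"
        using Icc_sets le L by (cases; simp add: interior_atLeastAtMost_real ennreal_mult')+
    qed
    have "emeasure M B \<le> emeasure M (\<Union>n. K n)"
      using D(4) KM(1) unfolding UK[symmetric] by (intro emeasure_mono sets.countable_UN) auto
    also have "\<dots> \<le> (\<Sum>n. emeasure M (K n))"
      using KM(1) by (intro emeasure_subadditive_countably) auto
    also have "\<dots> \<le> (\<Sum>n. ennreal L * emeasure lborel (interior (K n)))"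
      by (intro suminf_le KM) auto
    also have "\<dots> = ennreal L * emeasure lborel (\<Union>n. interior (K n))"
      using disj by (subst suminf_emeasure[symmetric]) auto
    also have "emeasure lborel (\<Union>n. interior (K n)) = emeasure lebesgue (\<Union>n. interior (K n))"
      by simp
    also have "\<dots> \<le> emeasure lebesgue (\<Union>D)"
      using D(5) interior_subset unfolding UK[symmetric] by (intro emeasure_mono) (auto simp: fmeasurableD)
    also have "\<dots> = ennreal (measure lebesgue (\<Union>D))"
      using D(5) by (rule emeasure_eq_measure2)
    also have "\<dots> \<le> ennreal (measure lebesgue B + e')"
      by (intro ennreal_leI D)
    also have "ennreal L * ennreal (measure lebesgue B + e') = ennreal L * ennreal (measure lebesgue B) + ennreal (L * e')"
      using e' L by (simp add: ennreal_mult' distrib_left)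
    also have "ennreal (measure lebesgue B) = emeasure lebesgue B"
      using emeasure_eq_measure2[OF Bl] by simp
    also have "\<dots> = emeasure lborel B" using A_borel[OF B(1)] by simp
    also have "ennreal L * emeasure lborel B + ennreal (L * e') \<le> ennreal L * emeasure lborel B + ennreal e"
      using e'(2) by (intro add_left_mono ennreal_leI)
    finally show "emeasure M B \<le> ennreal L * emeasure lborel B + ennreal e" 
      by (simp add: mult_left_mono)
  qed
  \<comment> \<open>The covering result needs the set inside a compact interval contained in
    \<open>I\<close>; continuity from below extends the bound to all of \<open>I\<close>.\<close>
  obtain u v :: "nat \<Rightarrow> real" where uv: "decseq u" "incseq v" "\<And>n. u n \<le> v n" "I = (\<Union>n. {u n..v n})"
    by (rule interval_eq_Union_Icc[OF I False]) (rule that)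
  have uv_I: "{u n..v n} \<subseteq> I" for n using uv(4) by auto
  have sub: "A \<subseteq> I"
    using sets.sets_into_space[OF A] sets_eq_imp_space_eq[OF sets] by (simp add: space_restrict_space)
  have "incseq (\<lambda>n. A \<inter> {u n..v n})"
    using uv(1,2) unfolding incseq_def decseq_def by fastforce
  moreover have An: "A \<inter> {u n..v n} \<in> sets M" for n
    using A Icc_sets[OF uv_I] by (rule sets.Int)
  ultimately have "(SUP n. emeasure M (A \<inter> {u n..v n})) = emeasure M (\<Union>n. A \<inter> {u n..v n})"
    by (intro SUP_emeasure_incseq) auto
  also have "(\<Union>n. A \<inter> {u n..v n}) = A"
    using sub uv(4) by auto
  finally have "emeasure M A = (SUP n. emeasure M (A \<inter> {u n..v n}))" by simp
  also have "\<dots> \<le> ennreal L * emeasure lborel A"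
  proof (rule SUP_least)
    fix n
    have "emeasure M (A \<inter> {u n..v n}) \<le> ennreal L * emeasure lborel (A \<inter> {u n..v n})"
      using An by (rule bounded[OF _ _ uv_I]) auto
    also have "\<dots> \<le> ennreal L * emeasure lborel A"
      using A_borel[OF A] by (intro mult_left_mono emeasure_mono) auto
    finally show "emeasure M (A \<inter> {u n..v n}) \<le> ennreal L * emeasure lborel A" .
  qed
  finally show ?thesis .
qed

lemma sets_arclength_measure [simp]: "sets (arclength_measure I c) = sets (restrict_space borel (c ` I))"
  by (simp add: arclength_measure_def)

text \<open>If no measure with the prescribed values on closed intervals exists, then \<open>extend_measure\<close> is
  the null measure, so the existence of arclength measure is not needed for an upper bound.\<close>

lemma nn_integral_arclength_le:
  assumes I: "is_interval I" and L: "0 \<le> L"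
    and lip: "\<And>x y. x \<in> I \<Longrightarrow> y \<in> I \<Longrightarrow> dist (c x) (c y) \<le> L * \<bar>x - y\<bar>"
    and u: "u \<in> borel_measurable borel"
  shows "(\<integral>\<^sup>+z. u z \<partial>arclength_measure I c) \<le> ennreal L * (\<integral>\<^sup>+x. u (c x) * indicator I x \<partial>lborel)"
proof -
  define J where "J = {(a, b). a \<le> b \<and> {a..b} \<subseteq> I}"
  define M where "M = extend_measure I J (\<lambda>(a, b). {a..b}) (\<lambda>(a, b). curve_length c a b)"
  define G where "G = (\<lambda>(a, b). {a..b}) ` J"
  have G: "G = {{a..b} | a b. a \<le> b \<and> {a..b} \<subseteq> I}" by (auto simp: G_def J_def)
  have G_sub: "G \<subseteq> Pow I" by (auto simp: G)
  have I_borel: "I \<in> sets borel" using I by (rule real_interval_borel_measurable)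
  have sets_M: "sets M = sets (restrict_space borel I)"
    unfolding M_def using sets_extend_measure[of "\<lambda>(a, b). {a..b}" J I] G_sub sigma_sets_Icc_interval[OF I]
    unfolding G_def[symmetric] G by simp
  \<comment> \<open>The predicate that \<open>extend_measure\<close> hands to the choice operator,
    named so that its two branches can be separated.\<close>
  define P where "P \<mu>' \<longleftrightarrow> (\<forall>i\<in>J. \<mu>' ((\<lambda>(a, b). {a..b}) i) = (\<lambda>(a, b). curve_length c a b) i) \<and>
      measure_space I (sigma_sets I G) \<mu>'" for \<mu>'
  have M_cases: "M = measure_of I G (Eps P) \<and> P (Eps P) \<or> M = measure_of I G (\<lambda>_. 0)"
  proof (cases "(\<exists>\<mu>'. P \<mu>') \<and> \<not> (\<forall>i\<in>J. (\<lambda>(a, b). curve_length c a b) i = 0)")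
    case True
    then have "P (Eps P)" by (intro someI_ex[of P]) simp
    then show ?thesis
      using True unfolding M_def extend_measure_def P_def[symmetric] G_def[symmetric] by auto
  next
    case False
    then show ?thesis
      unfolding M_def extend_measure_def P_def[symmetric] G_def[symmetric] by auto
  qed
  have "emeasure M {a..b} \<le> ennreal (L * (b - a))" if ab: "a \<le> b" "{a..b} \<subseteq> I" for a b
    using M_cases
  proof
    assume *: "M = measure_of I G (Eps P) \<and> P (Eps P)"
    have "Eps P {a..b} = curve_length c a b"
      using * ab by (auto simp: P_def J_def)
    also have "\<dots> \<le> ennreal (L * (b - a))"
      using ab L by (intro curve_length_le_lipschitz lip) auto
    finally show ?thesis
      using * G_sub by (simp add: emeasure_measure_of_conv)
  next
    assume "M = measure_of I G (\<lambda>_. 0)"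
    then show ?thesis using G_sub by (simp add: emeasure_measure_of_conv)
  qed
  then have le: "emeasure M A \<le> ennreal L * emeasure lborel A" if "A \<in> sets M" for A
    using emeasure_le_lborel_if_Icc[OF I sets_M _ L that] by simp
  \<comment> \<open>Domination by \<open>L\<close> times Lebesgue measure, stated in the order on
    measures, transfers from sets to integrals of all nonnegative functions at once.\<close>
  define N where "N = scale_measure (ennreal L) (restrict_space lborel I)"
  have sets_N: "sets M = sets N"
    unfolding N_def sets_M by (simp add: sets_restrict_space)
  have "M \<le> N"
  proof (subst le_measure[OF sets_N], intro ballI)
    fix A assume A: "A \<in> sets M"
    then have "A \<subseteq> I" using sets.sets_into_space[OF A] sets_eq_imp_space_eq[OF sets_M]
      by (simp add: space_restrict_space)
    then show "emeasure M A \<le> emeasure N A"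
      using le[OF A] I_borel by (simp add: N_def emeasure_restrict_space)
  qed
  have "continuous_on I c"
  proof (rule lipschitz_on_continuous_on)
    show "L-lipschitz_on I c"
      using L lip by (auto intro!: lipschitz_onI simp: dist_real_def)
  qed
  then have "c \<in> borel_measurable (restrict_space borel I)"
    by (rule borel_measurable_continuous_on_restrict)
  then have "c \<in> borel_measurable M"
    by (simp cong: measurable_cong_sets add: sets_M)
  moreover have "space M = I" using sets_eq_imp_space_eq[OF sets_M] by (simp add: space_restrict_space)
  ultimately have c: "c \<in> measurable M (restrict_space borel (c ` I))"
    by (intro measurable_restrict_space2) auto
  have "(\<integral>\<^sup>+z. u z \<partial>arclength_measure I c) = (\<integral>\<^sup>+x. u (c x) \<partial>M)"
    unfolding arclength_measure_def J_def[symmetric] M_def[symmetric]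
    by (subst nn_integral_distr[OF c]) (auto intro: measurable_restrict_space1 u)
  also have "\<dots> \<le> (\<integral>\<^sup>+x. u (c x) \<partial>N)"
    by (rule nn_integral_mono_measure[OF sets_N \<open>M \<le> N\<close>])
  also have "\<dots> = ennreal L * (\<integral>\<^sup>+x. u (c x) \<partial>restrict_space lborel I)"
    unfolding N_def
  proof (rule nn_integral_scale_measure)
    show "(\<lambda>x. u (c x)) \<in> borel_measurable (restrict_space lborel I)"
      using measurable_compose[OF \<open>c \<in> borel_measurable (restrict_space borel I)\<close> u]
      by (simp cong: measurable_cong_sets add: sets_restrict_space)
  qed
  also have "(\<integral>\<^sup>+x. u (c x) \<partial>restrict_space lborel I) = (\<integral>\<^sup>+x. u (c x) * indicator I x \<partial>lborel)"
    using I_borel by (subst nn_integral_restrict_space) auto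
  finally show ?thesis .
qed

section \<open>Interpolation\<close>

lemma mult_le_abs:
  fixes x r :: real
  assumes "0 \<le> x" "x \<le> 1"
  shows "x * r \<le> \<bar>r\<bar>"
  using mult_left_mono[OF abs_ge_self[of r] assms(1)] mult_left_le_one_le[of "\<bar>r\<bar>" x] assms by linarith

text \<open>Dividing by A0^(1-z) A1^z normalises both boundary lines to 1; a Gaussian factor then
  makes the function small at the far ends of the strip, so the maximum principle on a rectangle
  applies. An entire \<open>F\<close> suffices for the application, where it is a finite sum of
  exponentials, and no boundary regularity has to be discussed.\<close>

lemma Hadamard_three_lines:
  assumes holo: "F holomorphic_on UNIV"
    and M: "\<And>z. 0 \<le> Re z \<Longrightarrow> Re z \<le> 1 \<Longrightarrow> norm (F z) \<le> M"
    and A0: "A0 > 0" "\<And>z. Re z = 0 \<Longrightarrow> norm (F z) \<le> A0"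
    and A1: "A1 > 0" "\<And>z. Re z = 1 \<Longrightarrow> norm (F z) \<le> A1"
    and \<theta>: "0 \<le> \<theta>" "\<theta> \<le> 1"
  shows "norm (F (of_real \<theta>)) \<le> exp ((1 - \<theta>) * ln A0 + \<theta> * ln A1)"
proof -
  define a b where "a = ln A0" and "b = ln A1"
  have exp_ab: "exp a = A0" "exp b = A1" using A0 A1 by (auto simp: a_def b_def)
  define G where "G z = F z * exp (- ((1 - z) * of_real a + z * of_real b))" for z
  have G_norm: "norm (G z) = norm (F z) * exp (- ((1 - Re z) * a + Re z * b))" for z
    by (simp add: G_def norm_mult)
  define M' where "M' = \<bar>M\<bar> * exp (\<bar>a\<bar> + \<bar>b\<bar>)"
  have M': "norm (G z) \<le> M'" if "0 \<le> Re z" "Re z \<le> 1" for z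
  proof -
    have "(1 - Re z) * - a \<le> \<bar>a\<bar>" "Re z * - b \<le> \<bar>b\<bar>"
      using mult_le_abs[of "1 - Re z" "- a"] mult_le_abs[of "Re z" "- b"] that by simp_all
    then have "- ((1 - Re z) * a + Re z * b) \<le> \<bar>a\<bar> + \<bar>b\<bar>" by simp
    then show ?thesis
      unfolding G_norm M'_def using M[OF that] by (intro mult_mono) auto
  qed
  have M'_nn: "0 \<le> M'" by (simp add: M'_def)
  have lines: "norm (G z) \<le> 1" if "Re z = 0 \<or> Re z = 1" for z
    using that
  proof
    assume "Re z = 0"
    then show ?thesis using A0(2)[of z] A0(1) by (simp add: G_norm exp_minus exp_ab field_simps)
  next
    assume "Re z = 1"
    then show ?thesis using A1(2)[of z] A1(1) by (simp add: G_norm exp_minus exp_ab field_simps)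
  qed
  have eps: "norm (G (of_real \<theta>)) * exp (e * (\<theta>\<^sup>2 - 1)) \<le> 1" if "e > 0" for e
  proof -
    \<comment> \<open>The exponent has real part e * (Re^2 - Im^2 - 1): the \<open>- 1\<close> keeps
      the factor at most 1 up to the line Re z = 1, and the Im^2 gives decay.\<close>
    define H where "H z = G z * exp (of_real e * (z\<^sup>2 - 1))" for z
    have H_norm: "norm (H z) = norm (G z) * exp (e * ((Re z)\<^sup>2 - (Im z)\<^sup>2 - 1))" for z
      by (simp add: H_def norm_mult power2_eq_square)
    \<comment> \<open>Chosen so that e * R^2 \<ge> M'; then M' * exp (- e R^2) \<le> 1 follows from
      exp x \<ge> x. The \<open>+ 1\<close> makes R positive even if M' = 0.\<close>
    define R where "R = sqrt (M' / e) + 1"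
    have R: "R > 0" using that M'_nn by (simp add: R_def add_nonneg_pos)
    have MR: "M' / e \<le> R\<^sup>2"
      using that M'_nn real_sqrt_ge_zero[of "M' / e"] by (simp add: R_def power2_sum)
    have R2: "M' * exp (- (e * R\<^sup>2)) \<le> 1"
    proof -
      have "M' \<le> e * R\<^sup>2" using MR that by (simp add: field_simps)
      also have "\<dots> \<le> exp (e * R\<^sup>2)" using exp_ge_add_one_self[of "e * R\<^sup>2"] by linarith
      finally show ?thesis by (simp add: exp_minus field_simps)
    qed
    define S where "S = cbox (Complex 0 (- R)) (Complex 1 R)"
    have mem_S: "z \<in> S \<longleftrightarrow> 0 \<le> Re z \<and> Re z \<le> 1 \<and> - R \<le> Im z \<and> Im z \<le> R" for z
      by (auto simp: S_def in_cbox_complex_iff)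
    have holH: "H holomorphic_on UNIV"
      unfolding H_def G_def by (intro holomorphic_intros holo)
    have "norm (H (of_real \<theta>)) \<le> 1"
    proof (rule maximum_modulus_frontier[where f=H and S=S])
      show "H holomorphic_on interior S" using holH by (rule holomorphic_on_subset) auto
      show "continuous_on (closure S) H"
        using holomorphic_on_imp_continuous_on[OF holH] by (rule continuous_on_subset) auto
      show "bounded S" by (simp add: S_def)
      show "of_real \<theta> \<in> S" using \<theta> R by (auto simp: mem_S)
      fix z assume "z \<in> frontier S"
      then have "z \<in> S" "z \<notin> box (Complex 0 (- R)) (Complex 1 R)"
        by (auto simp: frontier_def S_def)
      then have z: "0 \<le> Re z" "Re z \<le> 1" and
        "(Re z = 0 \<or> Re z = 1) \<or> (Im z)\<^sup>2 = R\<^sup>2"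
        by (auto simp: mem_S in_box_complex_iff power2_eq_iff)
      from this(3) show "norm (H z) \<le> 1"
      proof
        assume l: "Re z = 0 \<or> Re z = 1"
        then have "(Re z)\<^sup>2 \<le> 1" by auto
        then have "e * ((Re z)\<^sup>2 - (Im z)\<^sup>2 - 1) \<le> 0"
          using that zero_le_power2[of "Im z"] by (intro mult_nonneg_nonpos) linarith+
        then show ?thesis
          unfolding H_norm using lines[OF l] by (intro mult_le_one) auto
      next
        assume l: "(Im z)\<^sup>2 = R\<^sup>2"
        have "(Re z)\<^sup>2 \<le> 1" using z by (intro power_le_one)
        then have "e * ((Re z)\<^sup>2 - (Im z)\<^sup>2 - 1) \<le> e * (- R\<^sup>2)"
          using that l by (intro mult_left_mono) auto
        then have "norm (H z) \<le> M' * exp (- (e * R\<^sup>2))"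
          unfolding H_norm using M'[OF z] M'_nn by (intro mult_mono) auto
        then show ?thesis using R2 by linarith
      qed
    qed
    then show ?thesis by (simp add: H_norm)
  qed
  \<comment> \<open>Letting e tend to 0 removes the damping factor.\<close>
  have "norm (G (of_real \<theta>)) * exp (0 * (\<theta>\<^sup>2 - 1)) \<le> 1"
  proof (rule tendsto_upperbound)
    show "((\<lambda>e. norm (G (of_real \<theta>)) * exp (e * (\<theta>\<^sup>2 - 1))) \<longlongrightarrow> norm (G (of_real \<theta>)) * exp (0 * (\<theta>\<^sup>2 - 1))) (at_right 0)"
      by (intro tendsto_intros)
    show "\<forall>\<^sub>F e in at_right 0. norm (G (of_real \<theta>)) * exp (e * (\<theta>\<^sup>2 - 1)) \<le> 1"
      using eps by (auto simp: eventually_at_right_less intro: eventually_mono[OF eventually_at_right_less])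
  qed simp
  then have "norm (F (of_real \<theta>)) * exp (- ((1 - \<theta>) * a + \<theta> * b)) \<le> 1"
    by (simp add: G_norm)
  then have "norm (F (of_real \<theta>)) / exp ((1 - \<theta>) * a + \<theta> * b) \<le> 1"
    by (simp only: exp_minus divide_inverse)
  then show ?thesis
    unfolding a_def[symmetric] b_def[symmetric] by (simp only: pos_divide_le_eq exp_gt_zero mult_1)
qed

text \<open>Here \<open>V\<close> stands for the atoms of a simple function and \<open>m\<close> for
  their masses, so \<open>bound1\<close> is the L1 to L-infinity estimate with norm 1 and
  \<open>bound2\<close> the L2 estimate with squared norm \<open>B\<close>. Taking \<open>s\<close>
  both as lower bound for the image and as dual test function gives X \<le> (X Y)^(1-\<theta>) (X B
  Y)^(\<theta>/2) with X the integral of s^q. As X is finite, solving for X leaves X \<le> B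
  Y^(q-1).\<close>

lemma finite_Riesz_Thorin_dual:
  fixes V :: "'i set" and m :: "'i \<Rightarrow> real" and \<phi> :: "'i \<Rightarrow> 'b \<Rightarrow> complex" and c :: "'i \<Rightarrow> complex" and s :: "'b \<Rightarrow> real"
  assumes "finite V" and m: "\<And>a. a \<in> V \<Longrightarrow> 0 \<le> m a"
    and \<phi>[measurable]: "\<And>a. a \<in> V \<Longrightarrow> \<phi> a \<in> borel_measurable N"
    and bound1: "\<And>c \<xi>. \<xi> \<in> space N \<Longrightarrow> norm (\<Sum>a\<in>V. c a * \<phi> a \<xi>) \<le> (\<Sum>a\<in>V. norm (c a) * m a)"
    and bound2: "\<And>c. (\<integral>\<^sup>+\<xi>. ennreal ((norm (\<Sum>a\<in>V. c a * \<phi> a \<xi>))\<^sup>2) \<partial>N) \<le> ennreal (B * (\<Sum>a\<in>V. (norm (c a))\<^sup>2 * m a))"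
    and B: "B > 0" and pq: "p > 1" "q \<ge> 2" "1 / p + 1 / q = 1"
    and s: "simple_function N s" "\<And>\<xi>. \<xi> \<in> space N \<Longrightarrow> 0 \<le> s \<xi>"
      "\<And>\<xi>. \<xi> \<in> space N \<Longrightarrow> s \<xi> \<le> norm (\<Sum>a\<in>V. c a * \<phi> a \<xi>)"
  shows "(\<integral>\<^sup>+\<xi>. ennreal (s \<xi> powr q) \<partial>N) \<le> ennreal (B * (\<Sum>a\<in>V. norm (c a) powr p * m a) powr (q - 1))"
proof -
  have [measurable]: "s \<in> borel_measurable N" using s(1) by (rule borel_measurable_simple_function)
  have [measurable]: "cnj \<in> borel_measurable borel" "sgn \<in> borel_measurable (borel :: complex measure)"
  proof -
    show "cnj \<in> borel_measurable borel" by (intro borel_measurable_continuous_onI continuous_intros)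
    show "sgn \<in> borel_measurable (borel :: complex measure)" unfolding sgn_div_norm[abs_def] by measurable
  qed
  define w where "w \<xi> = (\<Sum>a\<in>V. c a * \<phi> a \<xi>)" for \<xi>
  have [measurable]: "w \<in> borel_measurable N" unfolding w_def by measurable
  define Y where "Y = (\<Sum>a\<in>V. norm (c a) powr p * m a)"
  have Y_nn: "0 \<le> Y" unfolding Y_def using m by (intro sum_nonneg) auto
  define W where "W = s ` space N - {0}"
  have W: "finite W" "\<And>b. b \<in> W \<Longrightarrow> b > 0"
    using simple_functionD(1)[OF s(1)] s(2) by (force simp: W_def)+
  define D where "D b = {\<xi> \<in> space N. s \<xi> = b}" for b
  have [measurable]: "D b \<in> sets N" for b unfolding D_def by measurable
  have w2: "(\<integral>\<^sup>+\<xi>. ennreal ((norm (w \<xi>))\<^sup>2) \<partial>N) < \<infinity>"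
    using bound2[of c] unfolding w_def by (auto simp: le_less_trans)
  \<comment> \<open>Chebyshev: on \<open>D b\<close> the image has modulus at least b > 0, and it is
    square-integrable by \<open>bound2\<close>.\<close>
  have D_fin: "emeasure N (D b) < \<infinity>" if "b \<in> W" for b
  proof -
    have "ennreal (b\<^sup>2) * emeasure N (D b) = (\<integral>\<^sup>+\<xi>. ennreal (b\<^sup>2) * indicator (D b) \<xi> \<partial>N)"
      by (simp add: nn_integral_cmult_indicator)
    also have "\<dots> \<le> (\<integral>\<^sup>+\<xi>. ennreal ((norm (w \<xi>))\<^sup>2) \<partial>N)"
      using s(3) W(2)[OF that]
      by (intro nn_integral_mono) (auto simp: D_def indicator_def w_def intro!: ennreal_leI power_mono)
    finally have "ennreal (b\<^sup>2) * emeasure N (D b) < \<infinity>" using w2 by (rule le_less_trans)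
    then show ?thesis using W(2)[OF that] by (auto simp: ennreal_mult_less_top)
  qed

  txt \<open>
    The analytic families of Riesz and Thorin: \<open>\<bar>cz z\<bar>\<close> is \<open>\<bar>c\<bar>\<^sup>p\<close> on \<open>Re z = 0\<close> and \<open>\<bar>c\<bar>\<^bsup>p/2\<^esup>\<close> on \<open>Re z = 1\<close>, likewise \<open>hz\<close> with
    \<open>s\<^sup>q\<close> and \<open>s\<^bsup>q/2\<^esup>\<close>; at \<open>z = 2/q\<close> they are \<open>c\<close> and \<open>s\<^bsup>q-1\<^esup>\<close> times the conjugate phase of \<open>w\<close>. Since \<open>s\<close> is simple,
    pairing them gives a finite sum of exponentials in \<open>z\<close>.
  \<close>
  define cz where "cz z a = sgn (c a) * exp (of_real (p * ln (norm (c a))) * (1 - z / 2))" for z a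
  define hz where "hz z \<xi> = (if s \<xi> = 0 then 0 else exp (of_real (q * ln (s \<xi>)) * (1 - z / 2))) * cnj (sgn (w \<xi>))" for z \<xi>
  have [measurable]: "hz z \<in> borel_measurable N" for z
    unfolding hz_def by measurable
  have cz_norm: "norm (cz z a) = norm (c a) powr (p * (1 - Re z / 2))" for z a
    by (cases "c a = 0") (auto simp: cz_def norm_mult norm_sgn powr_def mult_ac)
  have hz_norm: "norm (hz z \<xi>) \<le> s \<xi> powr (q * (1 - Re z / 2))" if "\<xi> \<in> space N" for z \<xi>
    using s(2)[OF that] by (auto simp: hz_def norm_mult norm_sgn powr_def mult_ac)
  define \<kappa> where "\<kappa> a b = (LINT \<xi>|N. \<phi> a \<xi> * (indicator (D b) \<xi> * cnj (sgn (w \<xi>))))" for a b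
  have \<kappa>_int: "integrable N (\<lambda>\<xi>. \<phi> a \<xi> * (indicator (D b) \<xi> * cnj (sgn (w \<xi>))))" if "a \<in> V" "b \<in> W" for a b
  proof (rule Bochner_Integration.integrable_bound)
    show "integrable N (\<lambda>\<xi>. indicator (D b) \<xi> * m a)"
      using D_fin[OF that(2)] by (intro integrable_mult_left) (simp add: integrable_indicator_iff)
    \<comment> \<open>\<open>bound1\<close> for the coefficient vector of a single atom.\<close>
    have "norm (\<phi> a \<xi>) \<le> m a" if "\<xi> \<in> space N" for \<xi>
      using bound1[OF that, of "\<lambda>i. if i = a then 1 else 0"] \<open>finite V\<close> \<open>a \<in> V\<close>
      by (simp add: if_distrib[of "\<lambda>x. x * _"] if_distrib[of norm] cong: if_cong)
    then show "AE \<xi> in N. norm (\<phi> a \<xi> * (indicator (D b) \<xi> * cnj (sgn (w \<xi>)))) \<le> norm (indicator (D b) \<xi> * m a)"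
      using m[OF that(1)] by (intro AE_I2) (auto simp: indicator_def norm_mult norm_sgn)
  qed (use that in measurable)
  define F where "F z = (\<Sum>a\<in>V. \<Sum>b\<in>W. cz z a * exp (of_real (q * ln b) * (1 - z / 2)) * \<kappa> a b)" for z
  have integrand: "(\<Sum>a\<in>V. cz z a * \<phi> a \<xi>) * hz z \<xi> =
      (\<Sum>a\<in>V. \<Sum>b\<in>W. cz z a * exp (of_real (q * ln b) * (1 - z / 2)) * (\<phi> a \<xi> * (indicator (D b) \<xi> * cnj (sgn (w \<xi>)))))"
    if "\<xi> \<in> space N" for z \<xi>
  proof -
    have "(if s \<xi> = 0 then 0 else exp (of_real (q * ln (s \<xi>)) * (1 - z / 2))) =
      (\<Sum>b\<in>W. exp (of_real (q * ln b) * (1 - z / 2)) * indicator (D b) \<xi>)"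
    proof -
      have "(\<Sum>b\<in>W. exp (of_real (q * ln b) * (1 - z / 2)) * indicator (D b) \<xi>) =
        (\<Sum>b\<in>W. if b = s \<xi> then exp (of_real (q * ln (s \<xi>)) * (1 - z / 2)) else 0)"
        using that by (intro sum.cong) (auto simp: D_def indicator_def)
      also have "\<dots> = (if s \<xi> \<in> W then exp (of_real (q * ln (s \<xi>)) * (1 - z / 2)) else 0)"
        using W(1) by simp
      finally show ?thesis using that by (auto simp: W_def)
    qed
    then show ?thesis
      unfolding hz_def by (simp add: sum_product sum_distrib_left sum_distrib_right mult_ac) (rule sum.swap)
  qed
  have F_int: "integrable N (\<lambda>\<xi>. (\<Sum>a\<in>V. cz z a * \<phi> a \<xi>) * hz z \<xi>)"
    and F_eq: "F z = (LINT \<xi>|N. (\<Sum>a\<in>V. cz z a * \<phi> a \<xi>) * hz z \<xi>)" for z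
  proof -
    have "integrable N (\<lambda>\<xi>. \<Sum>a\<in>V. \<Sum>b\<in>W. cz z a * exp (of_real (q * ln b) * (1 - z / 2)) * (\<phi> a \<xi> * (indicator (D b) \<xi> * cnj (sgn (w \<xi>)))))"
      by (intro Bochner_Integration.integrable_sum integrable_mult_right \<kappa>_int)
    then show "integrable N (\<lambda>\<xi>. (\<Sum>a\<in>V. cz z a * \<phi> a \<xi>) * hz z \<xi>)"
      by (simp only: integrand cong: Bochner_Integration.integrable_cong)
    have "(LINT \<xi>|N. (\<Sum>a\<in>V. cz z a * \<phi> a \<xi>) * hz z \<xi>) =
      (LINT \<xi>|N. (\<Sum>a\<in>V. \<Sum>b\<in>W. cz z a * exp (of_real (q * ln b) * (1 - z / 2)) * (\<phi> a \<xi> * (indicator (D b) \<xi> * cnj (sgn (w \<xi>))))))"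
      by (intro Bochner_Integration.integral_cong integrand) auto
    also have "\<dots> = (\<Sum>a\<in>V. LINT \<xi>|N. (\<Sum>b\<in>W. cz z a * exp (of_real (q * ln b) * (1 - z / 2)) * (\<phi> a \<xi> * (indicator (D b) \<xi> * cnj (sgn (w \<xi>))))))"
      by (intro Bochner_Integration.integral_sum Bochner_Integration.integrable_sum integrable_mult_right \<kappa>_int)
    also have "\<dots> = (\<Sum>a\<in>V. \<Sum>b\<in>W. LINT \<xi>|N. cz z a * exp (of_real (q * ln b) * (1 - z / 2)) * (\<phi> a \<xi> * (indicator (D b) \<xi> * cnj (sgn (w \<xi>)))))"
      by (intro sum.cong refl Bochner_Integration.integral_sum integrable_mult_right \<kappa>_int)
    also have "\<dots> = (\<Sum>a\<in>V. \<Sum>b\<in>W. cz z a * exp (of_real (q * ln b) * (1 - z / 2)) * \<kappa> a b)"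
      by (simp add: \<kappa>_def)
    finally show "F z = (LINT \<xi>|N. (\<Sum>a\<in>V. cz z a * \<phi> a \<xi>) * hz z \<xi>)"
      unfolding F_def by simp
  qed
  have F_le: "ennreal (norm (F z)) \<le> (\<integral>\<^sup>+\<xi>. ennreal (norm (\<Sum>a\<in>V. cz z a * \<phi> a \<xi>)) * ennreal (s \<xi> powr (q * (1 - Re z / 2))) \<partial>N)" for z
  proof -
    have "ennreal (norm (F z)) \<le> (\<integral>\<^sup>+\<xi>. ennreal (norm ((\<Sum>a\<in>V. cz z a * \<phi> a \<xi>) * hz z \<xi>)) \<partial>N)"
      unfolding F_eq by (rule integral_norm_bound_ennreal[OF F_int])
    also have "\<dots> \<le> (\<integral>\<^sup>+\<xi>. ennreal (norm (\<Sum>a\<in>V. cz z a * \<phi> a \<xi>)) * ennreal (s \<xi> powr (q * (1 - Re z / 2))) \<partial>N)"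
      by (intro nn_integral_mono)
         (auto simp: norm_mult ennreal_mult intro!: mult_left_mono ennreal_leI hz_norm)
    finally show ?thesis .
  qed

  have "(\<integral>\<^sup>+\<xi>. ennreal (s \<xi> powr q) \<partial>N) = (\<Sum>b\<in>W. ennreal (b powr q) * emeasure N (D b))"
  proof -
    have "(\<integral>\<^sup>+\<xi>. ennreal (s \<xi> powr q) \<partial>N) = (\<integral>\<^sup>+\<xi>. (\<Sum>b\<in>W. ennreal (b powr q) * indicator (D b) \<xi>) \<partial>N)"
    proof (intro nn_integral_cong)
      fix \<xi> assume \<xi>: "\<xi> \<in> space N"
      have "(\<Sum>b\<in>W. ennreal (b powr q) * indicator (D b) \<xi>) = (\<Sum>b\<in>W. if b = s \<xi> then ennreal (s \<xi> powr q) else 0)"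
        using \<xi> by (intro sum.cong) (auto simp: D_def indicator_def)
      then show "ennreal (s \<xi> powr q) = (\<Sum>b\<in>W. ennreal (b powr q) * indicator (D b) \<xi>)"
        using W(1) \<xi> by (auto simp: W_def)
    qed
    also have "\<dots> = (\<Sum>b\<in>W. ennreal (b powr q) * emeasure N (D b))"
      by (subst nn_integral_sum) (auto simp: nn_integral_cmult_indicator)
    finally show ?thesis .
  qed
  also have "\<dots> < \<infinity>" using D_fin W(1) by (auto simp: ennreal_mult_less_top)
  finally have X_fin: "(\<integral>\<^sup>+\<xi>. ennreal (s \<xi> powr q) \<partial>N) < \<infinity>" .
  define X where "X = enn2real (\<integral>\<^sup>+\<xi>. ennreal (s \<xi> powr q) \<partial>N)"
  have X: "(\<integral>\<^sup>+\<xi>. ennreal (s \<xi> powr q) \<partial>N) = ennreal X"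
    unfolding X_def using X_fin by simp
  have X_nn: "0 \<le> X" by (simp add: X_def)

  have "X \<le> B * Y powr (q - 1)"
  proof (cases "X = 0")
    case True
    then show ?thesis using B by simp
  next
    case False
    then have X_pos: "X > 0" using X_nn by simp
    \<comment> \<open>Positivity of Y is required for the logarithms. If Y = 0, the image and hence
      \<open>s\<close> vanish, contrary to X > 0.\<close>
    have Y_pos: "Y > 0"
    proof (rule ccontr)
      assume "\<not> Y > 0"
      then have "Y = 0" using Y_nn by simp
      then have "\<forall>a\<in>V. norm (c a) powr p * m a = 0"
        unfolding Y_def using \<open>finite V\<close> m by (subst (asm) sum_nonneg_eq_0_iff) auto
      then have "(\<Sum>a\<in>V. norm (c a) * m a) = 0"
        by (intro sum.neutral) auto
      then have "norm (w \<xi>) \<le> 0" if "\<xi> \<in> space N" for \<xi>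
        using bound1[OF that, of c] by (simp add: w_def)
      then have "s \<xi> = 0" if "\<xi> \<in> space N" for \<xi>
        using s(2,3)[OF that] that by (force simp: w_def)
      then have "(\<integral>\<^sup>+\<xi>. ennreal (s \<xi> powr q) \<partial>N) = (\<integral>\<^sup>+\<xi>. 0 \<partial>N)"
        by (intro nn_integral_cong) simp
      then show False using X X_pos by simp
    qed
    have line0: "norm (F z) \<le> X * Y" if "Re z = 0" for z
    proof -
      have "ennreal (norm (F z)) \<le> (\<integral>\<^sup>+\<xi>. ennreal Y * ennreal (s \<xi> powr q) \<partial>N)"
        using bound1[of _ "cz z"] that
        by (intro order_trans[OF F_le] nn_integral_mono) (auto simp: cz_norm Y_def intro!: mult_right_mono ennreal_leI)
      also have "\<dots> = ennreal (X * Y)"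
        using X_nn Y_nn by (subst nn_integral_cmult) (auto simp: X ennreal_mult mult.commute)
      finally show ?thesis using X_nn Y_nn by (simp add: ennreal_le_iff)
    qed
    have pw: "(x powr (r / 2))\<^sup>2 = x powr r" for x r :: real
      using powr_add[of x "r / 2" "r / 2"] by (simp add: power2_eq_square)
    \<comment> \<open>On this line both families carry half the exponent, so Cauchy-Schwarz meets
      \<open>bound2\<close> in one factor and X in the other.\<close>
    have line1: "norm (F z) \<le> sqrt (X * (B * Y))" if "Re z = 1" for z
    proof -
      have "(ennreal (norm (F z)))\<^sup>2 \<le> (\<integral>\<^sup>+\<xi>. ennreal (norm (\<Sum>a\<in>V. cz z a * \<phi> a \<xi>)) * ennreal (s \<xi> powr (q / 2)) \<partial>N)\<^sup>2"
        using F_le[of z] that by (intro power_mono) auto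
      also have "\<dots> \<le> (\<integral>\<^sup>+\<xi>. (ennreal (norm (\<Sum>a\<in>V. cz z a * \<phi> a \<xi>)))\<^sup>2 \<partial>N) * (\<integral>\<^sup>+\<xi>. (ennreal (s \<xi> powr (q / 2)))\<^sup>2 \<partial>N)"
        by (intro Cauchy_Schwarz_nn_integral) measurable
      also have "(\<integral>\<^sup>+\<xi>. (ennreal (s \<xi> powr (q / 2)))\<^sup>2 \<partial>N) = ennreal X"
        unfolding X[symmetric] by (simp only: ennreal_power powr_ge_zero pw)
      also have "(\<integral>\<^sup>+\<xi>. (ennreal (norm (\<Sum>a\<in>V. cz z a * \<phi> a \<xi>)))\<^sup>2 \<partial>N) * ennreal X \<le> ennreal (B * Y) * ennreal X"
      proof (rule mult_right_mono)
        have "(norm (cz z a))\<^sup>2 = norm (c a) powr p" for a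
          using that pw[of "norm (c a)" p] by (simp add: cz_norm)
        then show "(\<integral>\<^sup>+\<xi>. (ennreal (norm (\<Sum>a\<in>V. cz z a * \<phi> a \<xi>)))\<^sup>2 \<partial>N) \<le> ennreal (B * Y)"
          using bound2[of "cz z"] by (simp add: ennreal_power Y_def)
      qed simp
      also have "\<dots> = ennreal (X * (B * Y))"
        using X_nn Y_nn B by (simp add: ennreal_mult mult_ac)
      finally have "(norm (F z))\<^sup>2 \<le> X * (B * Y)"
        using X_nn Y_nn B by (simp add: ennreal_power ennreal_le_iff)
      then show ?thesis by (rule real_le_rsqrt)
    qed
    have holF: "F holomorphic_on UNIV"
      unfolding F_def cz_def by (intro holomorphic_intros) auto
    have "\<exists>M. \<forall>z. 0 \<le> Re z \<and> Re z \<le> 1 \<longrightarrow> norm (F z) \<le> M"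
    proof (intro exI allI impI)
      fix z assume z: "0 \<le> Re z \<and> Re z \<le> 1"
      have e: "norm (exp (of_real r * (1 - z / 2))) \<le> exp \<bar>r\<bar>" for r
      proof -
        have "(1 - Re z / 2) * r \<le> \<bar>r\<bar>"
          using z by (intro mult_le_abs) auto
        then show ?thesis by (simp add: mult.commute)
      qed
      show "norm (F z) \<le> (\<Sum>a\<in>V. \<Sum>b\<in>W. norm (sgn (c a)) * exp \<bar>p * ln (norm (c a))\<bar> * exp \<bar>q * ln b\<bar> * norm (\<kappa> a b))"
        unfolding F_def cz_def
        unfolding norm_mult
        by (intro order_trans[OF norm_sum] sum_mono order_trans[OF eq_refl[OF norm_mult]] mult_mono e
              order_refl norm_ge_zero mult_nonneg_nonneg exp_ge_zero)
    qed
    then obtain M where M: "\<And>z. 0 \<le> Re z \<Longrightarrow> Re z \<le> 1 \<Longrightarrow> norm (F z) \<le> M" by blast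
    \<comment> \<open>The point where 1 - \<theta>/2 = 1/p: there the exponents p (1 - \<theta>/2)
      and q (1 - \<theta>/2) equal 1 and q - 1.\<close>
    define \<theta> where "\<theta> = 2 / q"
    have \<theta>: "0 \<le> \<theta>" "\<theta> \<le> 1" using pq by (auto simp: \<theta>_def)
    have \<theta>2: "1 - \<theta> / 2 = 1 / p" "q * (1 / p) = q - 1" using pq by (auto simp: \<theta>_def field_simps)
    have F\<theta>_integrand: "(\<Sum>a\<in>V. cz (of_real \<theta>) a * \<phi> a \<xi>) * hz (of_real \<theta>) \<xi> = of_real (norm (w \<xi>) * s \<xi> powr (q - 1))" for \<xi>
    proof -
      have e: "1 - complex_of_real \<theta> / 2 = of_real (1 / p)"
        using \<theta>2(1) by (metis of_real_1 of_real_diff of_real_divide of_real_numeral)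
      have cz: "cz (of_real \<theta>) a = c a" for a
      proof (cases "c a = 0")
        case False
        have "exp (complex_of_real (p * ln (norm (c a))) * of_real (1 / p)) = of_real (exp (p * ln (norm (c a)) * (1 / p)))"
          by (simp only: of_real_mult[symmetric] exp_of_real)
        also have "\<dots> = of_real (norm (c a))" using False pq by simp
        finally show ?thesis using False by (simp only: cz_def e) (simp add: sgn_eq)
      qed (simp add: cz_def)
      have hz: "hz (of_real \<theta>) \<xi> = of_real (s \<xi> powr (q - 1)) * cnj (sgn (w \<xi>))"
      proof (cases "s \<xi> = 0")
        case False
        have "exp (complex_of_real (q * ln (s \<xi>)) * of_real (1 / p)) = of_real (exp (q * (1 / p) * ln (s \<xi>)))"
          by (simp only: of_real_mult[symmetric] exp_of_real mult_ac)
        then show ?thesis using False unfolding hz_def e \<theta>2(2) by (simp add: powr_def)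
      qed (simp add: hz_def)
      have ww: "w \<xi> * cnj (sgn (w \<xi>)) = of_real (norm (w \<xi>))"
        by (cases "w \<xi> = 0") (auto simp: sgn_eq complex_norm_square[symmetric] power2_eq_square)
      have "w \<xi> * (of_real (s \<xi> powr (q - 1)) * cnj (sgn (w \<xi>))) = (w \<xi> * cnj (sgn (w \<xi>))) * of_real (s \<xi> powr (q - 1))"
        by (simp only: mult_ac)
      then show ?thesis
        unfolding hz cz w_def[symmetric] ww by (simp only: of_real_mult)
    qed
    have F\<theta>: "F (of_real \<theta>) = of_real (LINT \<xi>|N. norm (w \<xi>) * s \<xi> powr (q - 1))"
      unfolding F_eq F\<theta>_integrand by (rule integral_complex_of_real)
    have F\<theta>_int: "integrable N (\<lambda>\<xi>. norm (w \<xi>) * s \<xi> powr (q - 1))"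
      using integrable_Re[OF F_int[of "of_real \<theta>"]] unfolding F\<theta>_integrand by simp
    \<comment> \<open>One factor of s^q is traded for the modulus of the image, which dominates
      \<open>s\<close>; the result is exactly F at \<theta>.\<close>
    have "ennreal X \<le> (\<integral>\<^sup>+\<xi>. ennreal (norm (w \<xi>) * s \<xi> powr (q - 1)) \<partial>N)"
      unfolding X[symmetric]
    proof (intro nn_integral_mono ennreal_leI)
      fix \<xi> assume \<xi>: "\<xi> \<in> space N"
      have "s \<xi> powr q = s \<xi> * s \<xi> powr (q - 1)"
        using s(2)[OF \<xi>] pq by (cases "s \<xi> = 0") (auto simp: powr_mult_base)
      also have "\<dots> \<le> norm (w \<xi>) * s \<xi> powr (q - 1)"
        using s(3)[OF \<xi>] by (intro mult_right_mono) (auto simp: w_def)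
      finally show "s \<xi> powr q \<le> norm (w \<xi>) * s \<xi> powr (q - 1)" .
    qed
    also have "\<dots> = ennreal (LINT \<xi>|N. norm (w \<xi>) * s \<xi> powr (q - 1))"
      by (intro nn_integral_eq_integral F\<theta>_int) auto
    also have "\<dots> \<le> ennreal (norm (F (of_real \<theta>)))"
      unfolding F\<theta> by (intro ennreal_leI) simp
    finally have "X \<le> norm (F (of_real \<theta>))" by (simp add: ennreal_le_iff)
    also have "\<dots> \<le> exp ((1 - \<theta>) * ln (X * Y) + \<theta> * ln (sqrt (X * (B * Y))))"
      using X_pos Y_pos B
      by (intro Hadamard_three_lines[OF holF M _ line0 _ line1 \<theta>]) auto
    finally have "ln X \<le> (1 - \<theta>) * ln (X * Y) + \<theta> * ln (sqrt (X * (B * Y)))"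
      using X_pos by (metis exp_gt_zero ln_exp ln_le_cancel_iff)
    also have "\<dots> = (1 - \<theta>) * (ln X + ln Y) + \<theta> / 2 * (ln X + ln B + ln Y)"
      using X_pos Y_pos B by (simp add: ln_mult ln_sqrt)
    \<comment> \<open>After multiplication by q the right-hand side contains (q - 1) ln X, so one ln
      X survives on the left.\<close>
    finally have "q * ln X \<le> q * ((1 - \<theta>) * (ln X + ln Y) + \<theta> / 2 * (ln X + ln B + ln Y))"
      using pq by (intro mult_left_mono) auto
    also have "\<dots> = (q - 2) * (ln X + ln Y) + (ln X + ln B + ln Y)"
      using pq by (simp add: \<theta>_def field_simps)
    finally have "ln X \<le> ln B + (q - 1) * ln Y"
      by (simp add: algebra_simps)
    also have "\<dots> = ln (B * Y powr (q - 1))"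
      using B Y_pos by (simp add: ln_mult ln_powr)
    finally show ?thesis using X_pos B Y_pos by simp
  qed
  then show ?thesis unfolding X Y_def by (rule ennreal_leI)
qed

text \<open>The previous bound does not depend on the simple minorant \<open>s\<close>; exhausting
  the modulus of the image by such minorants and applying Fatou gives the full integral, with no
  finiteness presupposed.\<close>

lemma finite_Riesz_Thorin:
  fixes V :: "'i set" and m :: "'i \<Rightarrow> real" and \<phi> :: "'i \<Rightarrow> 'b \<Rightarrow> complex" and c :: "'i \<Rightarrow> complex"
  assumes "finite V" and m: "\<And>a. a \<in> V \<Longrightarrow> 0 \<le> m a"
    and \<phi>[measurable]: "\<And>a. a \<in> V \<Longrightarrow> \<phi> a \<in> borel_measurable N"
    and bound1: "\<And>c \<xi>. \<xi> \<in> space N \<Longrightarrow> norm (\<Sum>a\<in>V. c a * \<phi> a \<xi>) \<le> (\<Sum>a\<in>V. norm (c a) * m a)"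
    and bound2: "\<And>c. (\<integral>\<^sup>+\<xi>. ennreal ((norm (\<Sum>a\<in>V. c a * \<phi> a \<xi>))\<^sup>2) \<partial>N) \<le> ennreal (B * (\<Sum>a\<in>V. (norm (c a))\<^sup>2 * m a))"
    and B: "B > 0" and pq: "p > 1" "q \<ge> 2" "1 / p + 1 / q = 1"
  shows "(\<integral>\<^sup>+\<xi>. ennreal (norm (\<Sum>a\<in>V. c a * \<phi> a \<xi>) powr q) \<partial>N)
    \<le> ennreal (B * (\<Sum>a\<in>V. norm (c a) powr p * m a) powr (q - 1))"
proof -
  define w where "w \<xi> = (\<Sum>a\<in>V. c a * \<phi> a \<xi>)" for \<xi>
  have [measurable]: "w \<in> borel_measurable N" unfolding w_def by measurable
  have "(\<lambda>\<xi>. ennreal (norm (w \<xi>))) \<in> borel_measurable N" by measurable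
  then obtain S where S: "\<And>i. simple_function N (S i)" "incseq S" "\<And>i \<xi>. S i \<xi> < top"
      "\<And>\<xi>. (SUP i. S i \<xi>) = ennreal (norm (w \<xi>))"
    by (rule borel_measurable_implies_simple_function_sequence') blast
  define s where "s i \<xi> = enn2real (S i \<xi>)" for i \<xi>
  have s_eq: "ennreal (s i \<xi>) = S i \<xi>" for i \<xi>
    using S(3) by (simp add: s_def)
  have s_le: "s i \<xi> \<le> norm (w \<xi>)" for i \<xi>
  proof -
    have "S i \<xi> \<le> ennreal (norm (w \<xi>))"
      unfolding S(4)[symmetric] by (rule SUP_upper) simp
    then show ?thesis by (simp add: s_eq[symmetric] ennreal_le_iff)
  qed
  have s_lim: "(\<lambda>i. s i \<xi>) \<longlonglongrightarrow> norm (w \<xi>)" for \<xi>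
  proof -
    have "incseq (\<lambda>i. S i \<xi>)" using S(2) by (auto simp: incseq_def le_fun_def)
    then have "(\<lambda>i. S i \<xi>) \<longlonglongrightarrow> ennreal (norm (w \<xi>))"
      unfolding S(4)[symmetric] by (rule LIMSEQ_SUP)
    then have "(\<lambda>i. ennreal (s i \<xi>)) \<longlonglongrightarrow> ennreal (norm (w \<xi>))"
      by (simp only: s_eq)
    then show ?thesis
      by (subst (asm) tendsto_ennreal_iff) (auto simp: s_def)
  qed
  have simple: "simple_function N (s i)" for i
    unfolding s_def using S(1) by (rule simple_function_compose1)
  have [measurable]: "s i \<in> borel_measurable N" for i
    using simple by (rule borel_measurable_simple_function)
  have "(\<integral>\<^sup>+\<xi>. ennreal (norm (w \<xi>) powr q) \<partial>N) \<le> ennreal (B * (\<Sum>a\<in>V. norm (c a) powr p * m a) powr (q - 1))"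
  proof (rule nn_integral_le_limit[where F="\<lambda>i \<xi>. ennreal (s i \<xi> powr q)"])
    show "(\<integral>\<^sup>+\<xi>. ennreal (s i \<xi> powr q) \<partial>N) \<le> ennreal (B * (\<Sum>a\<in>V. norm (c a) powr p * m a) powr (q - 1))" for i
      using s_le[of i] unfolding w_def
      by (intro finite_Riesz_Thorin_dual[OF assms(1-9)] simple) (auto simp: s_def)
    show "AE \<xi> in N. (\<lambda>i. ennreal (s i \<xi> powr q)) \<longlonglongrightarrow> ennreal (norm (w \<xi>) powr q)"
      using pq by (intro AE_I2 tendsto_ennrealI tendsto_powr2 s_lim tendsto_const) (auto simp: s_def)
  qed auto
  then show ?thesis unfolding w_def .
qed

section \<open>Interpolated bounds for the Laplace transform on a measure in the right
  half-plane\<close>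

lemma laplace_integrand_integrable:
  assumes "integrable lebesgue_pos g" "0 \<le> Re z"
  shows "integrable lebesgue_pos (\<lambda>t. g t * exp (- (z * of_real t)))"
proof (rule Bochner_Integration.integrable_bound[OF assms(1)])
  have "(\<lambda>t. exp (- (z * complex_of_real t))) \<in> borel_measurable lebesgue_pos"
    by (intro measurable_restrict_space1 measurable_completion) simp
  then show "(\<lambda>t. g t * exp (- (z * of_real t))) \<in> borel_measurable lebesgue_pos"
    using borel_measurable_integrable[OF assms(1)] by (rule borel_measurable_times[rotated])
  show "AE t in lebesgue_pos. norm (g t * exp (- (z * of_real t))) \<le> norm (g t)"
    using assms(2) by (intro AE_I2) (auto simp: norm_mult intro!: mult_right_le_one_le)
qed

lemma norm_laplace_le:
  assumes "integrable lebesgue_pos g" "0 \<le> Re z"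
  shows "norm (laplace g z) \<le> (LINT t|lebesgue_pos. norm (g t))"
  unfolding laplace_def
proof (rule Bochner_Integration.integral_norm_bound_integral)
  show "norm (g t * exp (- (z * of_real t))) \<le> norm (g t)" if "t \<in> space lebesgue_pos" for t
    using that assms(2) by (auto simp: norm_mult intro!: mult_right_le_one_le)
qed (use assms laplace_integrand_integrable in auto)

lemma laplace_add:
  assumes "integrable lebesgue_pos g" "integrable lebesgue_pos h" "0 \<le> Re z"
  shows "laplace (\<lambda>t. g t + h t) z = laplace g z + laplace h z"
  using Bochner_Integration.integral_add[OF laplace_integrand_integrable[OF assms(1,3)] laplace_integrand_integrable[OF assms(2,3)]]
  by (simp add: laplace_def distrib_right)

lemma laplace_cmult: "laplace (\<lambda>t. c * g t) z = c * laplace g z"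
  by (simp add: laplace_def mult.assoc)

lemma laplace_diff:
  assumes "integrable lebesgue_pos g" "integrable lebesgue_pos h" "0 \<le> Re z"
  shows "laplace (\<lambda>t. g t - h t) z = laplace g z - laplace h z"
  using laplace_add[OF assms(1) integrable_mult_right[of "-1", OF assms(2)] assms(3)] laplace_cmult[of "-1" h z]
  by simp

lemma laplace_sum:
  assumes "finite V" "\<And>a. a \<in> V \<Longrightarrow> integrable lebesgue_pos (g a)" "0 \<le> Re z"
  shows "laplace (\<lambda>t. \<Sum>a\<in>V. g a t) z = (\<Sum>a\<in>V. laplace (g a) z)"
  using assms by (simp add: laplace_def sum_distrib_right laplace_integrand_integrable)

lemma borel_measurable_laplace:
  assumes "g \<in> borel_measurable lebesgue_pos"
  shows "laplace g \<in> borel_measurable borel"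
proof -
  obtain g' where g': "g' \<in> borel_measurable borel" "\<And>t. t \<le> 0 \<Longrightarrow> g' t = 0" "AE t in lebesgue_pos. g t = g' t"
    by (rule lebesgue_pos_borel_representative[OF assms]) (rule that)
  have [measurable]: "g' \<in> borel_measurable borel" by fact
  have "laplace g = (\<lambda>z. LINT t|lborel. g' t * exp (- (z * of_real t)))"
    using laplace_representative[OF g'(3,1,2) assms] by (intro ext)
  also have "\<dots> \<in> borel_measurable borel" by measurable
  finally show ?thesis .
qed

text \<open>All that interpolation needs to know about a curve. A nonnegative real part gives the L1
  endpoint and \<open>L2_bound\<close> the other one; the latter is stated for integrable
  \<open>g\<close>, where the defining integral converges. The sigma-algebra of \<open>N\<close>
  lives on the curve, and \<open>id_measurable\<close> makes Borel functions of z measurable for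
  it.\<close>

locale laplace_L2_bound =
  fixes N :: "complex measure" and B :: real
  assumes id_measurable: "(\<lambda>z. z) \<in> borel_measurable N"
    and Re_nonneg: "z \<in> space N \<Longrightarrow> 0 \<le> Re z"
    and B_pos: "B > 0"
    and L2_bound: "integrable lebesgue_pos g \<Longrightarrow>
      (\<integral>\<^sup>+z. ennreal ((norm (laplace g z))\<^sup>2) \<partial>N) \<le> ennreal B * (\<integral>\<^sup>+t. ennreal ((norm (g t))\<^sup>2) \<partial>lebesgue_pos)"
begin

lemma laplace_measurable:
  "g \<in> borel_measurable lebesgue_pos \<Longrightarrow> laplace g \<in> borel_measurable N"
  using measurable_compose[OF id_measurable borel_measurable_laplace] by simp

text \<open>The finite interpolation theorem with the nonzero values of \<open>g\<close> as index
  set and the transforms of the level sets as \<open>\<phi>\<close>. It quantifies over all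
  coefficients, which here means all functions \<open>f c\<close> constant on the same level sets;
  both endpoint bounds are available for these.\<close>

lemma laplace_simple_bound:
  assumes g: "simple_function lebesgue_pos g" "integrable lebesgue_pos g"
    and pq: "p > 1" "q \<ge> 2" "1 / p + 1 / q = 1"
  shows "(\<integral>\<^sup>+z. ennreal (norm (laplace g z) powr q) \<partial>N)
    \<le> ennreal (B * (LINT t|lebesgue_pos. norm (g t) powr p) powr (q - 1))"
proof -
  let ?M = "lebesgue_pos"
  define V where "V = g ` space ?M - {0}"
  define A where "A a = {t \<in> space ?M. g t = a}" for a
  define m where "m a = measure ?M (A a)" for a
  define \<phi> where "\<phi> a = laplace (indicator (A a))" for a
  have "finite V" using simple_functionD(1)[OF g(1)] by (simp add: V_def)
  have A_sets: "A a \<in> sets ?M" for a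
    using simple_functionD(2)[OF g(1), of "{a}"] by (simp add: A_def vimage_def Int_def conj_commute)
  have A_fin: "emeasure ?M (A a) < \<infinity>" if "a \<in> V" for a
  proof -
    have "ennreal (norm a) * emeasure ?M (A a) = (\<integral>\<^sup>+t. ennreal (norm a) * indicator (A a) t \<partial>?M)"
      using A_sets by (simp add: nn_integral_cmult_indicator)
    also have "\<dots> \<le> (\<integral>\<^sup>+t. ennreal (norm (g t)) \<partial>?M)"
      by (intro nn_integral_mono) (auto simp: A_def indicator_def)
    also have "\<dots> < \<infinity>" using g(2) by (simp add: integrable_iff_bounded)
    finally show ?thesis using that by (auto simp: V_def ennreal_mult_less_top)
  qed
  have ind_int: "integrable ?M (\<lambda>t. c * indicator (A a) t)" if "a \<in> V" for a and c :: "'x::{real_normed_field, second_countable_topology}"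
  proof -
    have "integrable ?M (\<lambda>t. indicator (A a) t *\<^sub>R c)"
      using A_fin[OF that] A_sets by (intro integrable_scaleR_left integrable_real_indicator)
    moreover have "indicator (A a) t *\<^sub>R c = c * indicator (A a) t" for t
      by (simp add: indicator_def)
    ultimately show ?thesis by simp
  qed
  define f where "f c t = (\<Sum>a\<in>V. c a * indicator (A a) t)" for c :: "complex \<Rightarrow> complex" and t
  have f_int: "integrable ?M (f c)" for c
    unfolding f_def by (intro Bochner_Integration.integrable_sum ind_int)
  have pick: "(\<Sum>a\<in>V. k a * indicator (A a) t) = (if g t = 0 then 0 else k (g t))"
    if "t \<in> space ?M" for k :: "complex \<Rightarrow> 'x::semiring_1" and t
  proof -
    have "(\<Sum>a\<in>V. k a * indicator (A a) t) = (\<Sum>a\<in>V. if a = g t then k (g t) else 0)"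
      using that by (intro sum.cong) (auto simp: A_def indicator_def)
    then show ?thesis using \<open>finite V\<close> that by (auto simp: V_def)
  qed
  \<comment> \<open>One computation for all \<open>H\<close> vanishing at 0 serves the norm, its
    square and its p-th power.\<close>
  have f_int_eq: "(LINT t|?M. H (norm (f c t))) = (\<Sum>a\<in>V. H (norm (c a)) * m a)"
    and f_nn_eq: "(\<And>x. 0 \<le> H x) \<Longrightarrow> (\<integral>\<^sup>+t. ennreal (H (norm (f c t))) \<partial>?M) = ennreal (\<Sum>a\<in>V. H (norm (c a)) * m a)"
    if "H 0 = 0" for H :: "real \<Rightarrow> real" and c
  proof -
    have eq: "H (norm (f c t)) = (\<Sum>a\<in>V. H (norm (c a)) * indicator (A a) t)" if "t \<in> space ?M" for t
      unfolding f_def using \<open>H 0 = 0\<close> by (simp add: pick[OF that])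
    have int: "integrable ?M (\<lambda>t. \<Sum>a\<in>V. H (norm (c a)) * indicator (A a) t)"
      by (intro Bochner_Integration.integrable_sum ind_int)
    then have int': "integrable ?M (\<lambda>t. H (norm (f c t)))"
      by (simp only: Bochner_Integration.integrable_cong[OF refl eq])
    have "(LINT t|?M. H (norm (f c t))) = (LINT t|?M. (\<Sum>a\<in>V. H (norm (c a)) * indicator (A a) t))"
      by (intro Bochner_Integration.integral_cong eq) auto
    also have "\<dots> = (\<Sum>a\<in>V. H (norm (c a)) * m a)"
      using A_sets[THEN sets.sets_into_space] ind_int[of _ "1::real"]
      by (subst Bochner_Integration.integral_sum) (auto intro: ind_int simp: m_def Int_absorb2)
    finally show 1: "(LINT t|?M. H (norm (f c t))) = (\<Sum>a\<in>V. H (norm (c a)) * m a)" .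
    assume "\<And>x. 0 \<le> H x"
    then show "(\<integral>\<^sup>+t. ennreal (H (norm (f c t))) \<partial>?M) = ennreal (\<Sum>a\<in>V. H (norm (c a)) * m a)"
      unfolding 1[symmetric] by (intro nn_integral_eq_integral int') simp
  qed
  have lap: "laplace (f c) z = (\<Sum>a\<in>V. c a * \<phi> a z)" if "z \<in> space N" for c z
    unfolding f_def[abs_def] \<phi>_def
    using \<open>finite V\<close> Re_nonneg[OF that] ind_int by (subst laplace_sum) (auto simp: laplace_cmult)
  have g_eq: "f (\<lambda>a. a) t = g t" if "t \<in> space ?M" for t
    unfolding f_def by (simp add: pick[OF that])
  have "(\<integral>\<^sup>+z. ennreal (norm (\<Sum>a\<in>V. a * \<phi> a z) powr q) \<partial>N)
      \<le> ennreal (B * (\<Sum>a\<in>V. norm a powr p * m a) powr (q - 1))"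
  proof (rule finite_Riesz_Thorin[OF \<open>finite V\<close> _ _ _ _ B_pos pq])
    show "0 \<le> m a" for a by (simp add: m_def)
    show "\<phi> a \<in> borel_measurable N" for a
      unfolding \<phi>_def using A_sets by (intro laplace_measurable borel_measurable_indicator)
    fix c
    show "norm (\<Sum>a\<in>V. c a * \<phi> a z) \<le> (\<Sum>a\<in>V. norm (c a) * m a)" if "z \<in> space N" for z
      using norm_laplace_le[OF f_int[of c] Re_nonneg[OF that]] f_int_eq[of "\<lambda>x. x" c] by (simp add: lap[OF that])
    have "(\<integral>\<^sup>+z. ennreal ((norm (\<Sum>a\<in>V. c a * \<phi> a z))\<^sup>2) \<partial>N) = (\<integral>\<^sup>+z. ennreal ((norm (laplace (f c) z))\<^sup>2) \<partial>N)"
      by (intro nn_integral_cong) (simp add: lap)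
    also have "\<dots> \<le> ennreal B * ennreal (\<Sum>a\<in>V. (norm (c a))\<^sup>2 * m a)"
      using L2_bound[OF f_int[of c]] f_nn_eq[of "\<lambda>x. x\<^sup>2" c] by simp
    finally show "(\<integral>\<^sup>+z. ennreal ((norm (\<Sum>a\<in>V. c a * \<phi> a z))\<^sup>2) \<partial>N) \<le> ennreal (B * (\<Sum>a\<in>V. (norm (c a))\<^sup>2 * m a))"
      using B_pos by (simp add: ennreal_mult')
  qed
  moreover have "laplace g z = (\<Sum>a\<in>V. a * \<phi> a z)" if "z \<in> space N" for z
  proof -
    have "laplace g z = laplace (f (\<lambda>a. a)) z"
      unfolding laplace_def by (intro Bochner_Integration.integral_cong) (auto simp: g_eq)
    then show ?thesis using lap[OF that] by simp
  qed
  moreover have "(LINT t|?M. norm (g t) powr p) = (\<Sum>a\<in>V. norm a powr p * m a)"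
  proof -
    have "(LINT t|?M. norm (g t) powr p) = (LINT t|?M. norm (f (\<lambda>a. a) t) powr p)"
      by (intro Bochner_Integration.integral_cong) (auto simp: g_eq)
    then show ?thesis using f_int_eq[of "\<lambda>x. x powr p" "\<lambda>a. a"] by simp
  qed
  ultimately show ?thesis by (simp cong: nn_integral_cong_simp)
qed

text \<open>Simple approximations with modulus at most twice that of \<open>g\<close> are dominated
  in L1 and in Lp simultaneously: the first makes the transforms converge pointwise, the second
  makes the right-hand sides converge. Fatou handles the left-hand side.\<close>

lemma laplace_Lp_bound:
  assumes g: "integrable lebesgue_pos g" and gp: "integrable lebesgue_pos (\<lambda>t. norm (g t) powr p)"
    and pq: "p > 1" "q \<ge> 2" "1 / p + 1 / q = 1"
  shows "(\<integral>\<^sup>+z. ennreal (norm (laplace g z) powr q) \<partial>N)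
    \<le> ennreal (B * (LINT t|lebesgue_pos. norm (g t) powr p) powr (q - 1))"
proof -
  let ?M = "lebesgue_pos"
  have g_meas[measurable]: "g \<in> borel_measurable ?M" using g by auto
  obtain s where s: "\<And>i. simple_function ?M (s i)" "\<And>t. t \<in> space ?M \<Longrightarrow> (\<lambda>i. s i t) \<longlonglongrightarrow> g t"
      "\<And>i t. t \<in> space ?M \<Longrightarrow> dist (s i t) 0 \<le> 2 * dist (g t) 0"
    using borel_measurable_implies_sequence_metric[OF g_meas, of 0] by metis
  have s_meas[measurable]: "s i \<in> borel_measurable ?M" for i
    using s(1) by (rule borel_measurable_simple_function)
  have s_int: "integrable ?M (s i)" for i
    using s(3) by (intro Bochner_Integration.integrable_bound[OF integrable_mult_right[of 2, OF integrable_norm[OF g]]]) (auto simp: dist_norm)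
  have lap_lim: "(\<lambda>i. laplace (s i) z) \<longlonglongrightarrow> laplace g z" if z: "z \<in> space N" for z
    unfolding laplace_def
  proof (rule integral_dominated_convergence[where w="\<lambda>t. 2 * norm (g t)"])
    show "AE t in ?M. (\<lambda>i. s i t * exp (- (z * of_real t))) \<longlonglongrightarrow> g t * exp (- (z * of_real t))"
      using s(2) by (intro AE_I2 tendsto_intros) auto
    show "AE t in ?M. norm (s i t * exp (- (z * of_real t))) \<le> 2 * norm (g t)" for i
    proof (rule AE_I2)
      fix t assume t: "t \<in> space ?M"
      have "norm (s i t * exp (- (z * of_real t))) \<le> norm (s i t)"
        using t Re_nonneg[OF z] by (auto simp: norm_mult intro!: mult_right_le_one_le)
      then show "norm (s i t * exp (- (z * of_real t))) \<le> 2 * norm (g t)"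
        using s(3)[OF t, of i] by (simp add: dist_norm)
    qed
  qed (use g laplace_integrand_integrable[OF _ Re_nonneg[OF z]] s_int in \<open>auto intro!: borel_measurable_integrable\<close>)
  have "(\<lambda>i. LINT t|?M. norm (s i t) powr p) \<longlonglongrightarrow> (LINT t|?M. norm (g t) powr p)"
  proof (rule integral_dominated_convergence[where w="\<lambda>t. 2 powr p * norm (g t) powr p"])
    show "AE t in ?M. (\<lambda>i. norm (s i t) powr p) \<longlonglongrightarrow> norm (g t) powr p"
      using s(2) pq by (intro AE_I2 tendsto_powr2 tendsto_norm tendsto_const) auto
    show "AE t in ?M. norm (norm (s i t) powr p) \<le> 2 powr p * norm (g t) powr p" for i
      using s(3) pq by (intro AE_I2) (auto simp: powr_mult[symmetric] dist_norm intro!: powr_mono2)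
  qed (use gp in auto)
  then have C: "(\<lambda>i. ennreal (B * (LINT t|?M. norm (s i t) powr p) powr (q - 1))) \<longlonglongrightarrow>
      ennreal (B * (LINT t|?M. norm (g t) powr p) powr (q - 1))"
    using pq by (intro tendsto_ennrealI tendsto_mult tendsto_const tendsto_powr2) (auto intro!: integral_nonneg)
  show ?thesis
  proof (rule nn_integral_le_limit[OF _ _ _ C])
    show "(\<lambda>z. ennreal (norm (laplace (s i) z) powr q)) \<in> borel_measurable N" for i
      using laplace_measurable[OF s_meas[of i]] by measurable
    show "AE z in N. (\<lambda>i. ennreal (norm (laplace (s i) z) powr q)) \<longlonglongrightarrow> ennreal (norm (laplace g z) powr q)"
      using pq by (intro AE_I2 tendsto_ennrealI tendsto_powr2 tendsto_norm lap_lim tendsto_const) auto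
    show "(\<integral>\<^sup>+z. ennreal (norm (laplace (s i) z) powr q) \<partial>N) \<le> ennreal (B * (LINT t|?M. norm (s i t) powr p) powr (q - 1))" for i
      by (rule laplace_simple_bound[OF s(1) s_int pq])
  qed
qed

end

section \<open>Extension by continuity\<close>

text \<open>The p-th power of the norm, free of the root and of the case distinction at infinity;
  null sequences are the same for both.\<close>

definition Lp_int :: "real \<Rightarrow> 'a measure \<Rightarrow> ('a \<Rightarrow> complex) \<Rightarrow> ennreal" where
  "Lp_int p M g = (\<integral>\<^sup>+x. ennreal (norm (g x) powr p) \<partial>M)"

lemma Lp_int_mono:
  assumes "\<And>x. x \<in> space M \<Longrightarrow> norm (f x) \<le> norm (g x)" "0 \<le> p"
  shows "Lp_int p M f \<le> Lp_int p M g"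
  unfolding Lp_int_def using assms by (intro nn_integral_mono ennreal_leI powr_mono2) auto

lemma Lp_int_cong_AE: "AE x in M. f x = g x \<Longrightarrow> Lp_int p M f = Lp_int p M g"
  unfolding Lp_int_def by (intro nn_integral_cong_AE) auto

text \<open>A quasi-triangle inequality is enough in place of Minkowski, since it serves only to
  preserve finiteness and convergence to 0.\<close>

lemma Lp_int_add_le:
  assumes [measurable]: "f \<in> borel_measurable M" "g \<in> borel_measurable M" and p: "0 \<le> p"
  shows "Lp_int p M (\<lambda>x. f x + g x) \<le> ennreal (2 powr p) * (Lp_int p M f + Lp_int p M g)"
proof -
  have "norm (a + b) powr p \<le> 2 powr p * (norm a powr p + norm b powr p)" for a b :: complex
  proof -
    have "norm (a + b) powr p \<le> (2 * max (norm a) (norm b)) powr p"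
      using p norm_triangle_ineq[of a b] by (intro powr_mono2) auto
    also have "\<dots> = 2 powr p * max (norm a) (norm b) powr p"
      by (simp add: powr_mult)
    also have "\<dots> \<le> 2 powr p * (norm a powr p + norm b powr p)"
      by (intro mult_left_mono) (auto simp: max_def)
    finally show ?thesis .
  qed
  then have "Lp_int p M (\<lambda>x. f x + g x) \<le> (\<integral>\<^sup>+x. ennreal (2 powr p) * (ennreal (norm (f x) powr p) + ennreal (norm (g x) powr p)) \<partial>M)"
    unfolding Lp_int_def by (intro nn_integral_mono) (simp add: ennreal_leI flip: ennreal_plus ennreal_mult)
  also have "\<dots> = ennreal (2 powr p) * (Lp_int p M f + Lp_int p M g)"
    unfolding Lp_int_def by (simp add: nn_integral_cmult nn_integral_add)
  finally show ?thesis .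
qed

lemma Lp_int_cmult:
  assumes [measurable]: "g \<in> borel_measurable M"
  shows "Lp_int p M (\<lambda>x. c * g x) = ennreal (norm c powr p) * Lp_int p M g"
  unfolding Lp_int_def
  by (subst nn_integral_cmult[symmetric]) (auto simp: norm_mult powr_mult ennreal_mult intro!: nn_integral_cong)

lemma Lp_int_minus: "Lp_int p M (\<lambda>x. - g x) = Lp_int p M g"
  by (simp add: Lp_int_def)

lemma Lp_norm_ennreal:
  assumes "0 \<le> p"
  shows "Lp_norm (ennreal p) M g = (if Lp_int p M g = \<infinity> then \<infinity> else ennreal (enn2real (Lp_int p M g) powr (1 / p)))"
  using assms by (simp add: Lp_norm_def Lp_int_def Let_def)

lemma mem_Lp_ennreal:
  assumes "0 \<le> p"
  shows "g \<in> Lp (ennreal p) M \<longleftrightarrow> g \<in> borel_measurable M \<and> Lp_int p M g < \<infinity>"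
  using assms by (auto simp: Lp_def Lp_norm_ennreal less_top)

text \<open>Riesz-Fischer along a sequence that is already fast. The rate absorbs the weight 2^k
  placed inside the q-th power and still leaves 2^(-k), so almost everywhere the increments are
  eventually below 2^(-k) and the telescoping series converges. Fatou passes the rate on to the
  limit.\<close>

lemma Lp_fast_Cauchy_limit:
  fixes L :: "nat \<Rightarrow> 'a \<Rightarrow> complex"
  assumes [measurable]: "\<And>k. L k \<in> borel_measurable M" and q: "q > 0"
    and le: "\<And>j k. j \<le> k \<Longrightarrow> Lp_int q M (\<lambda>z. L k z - L j z) \<le> ennreal ((2 powr - (q + 1)) ^ j)"
  obtains G where "G \<in> borel_measurable M" "AE z in M. (\<lambda>k. L k z) \<longlonglongrightarrow> G z"
    "\<And>j. Lp_int q M (\<lambda>z. G z - L j z) \<le> ennreal ((2 powr - (q + 1)) ^ j)"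
proof -
  define D where "D k z = L (Suc k) z - L k z" for k z
  have [measurable]: "D k \<in> borel_measurable M" for k unfolding D_def by measurable
  define S where "S z = (\<Sum>k. ennreal ((2 ^ k * norm (D k z)) powr q))" for z
  have "(\<integral>\<^sup>+z. S z \<partial>M) = (\<Sum>k. \<integral>\<^sup>+z. ennreal ((2 ^ k * norm (D k z)) powr q) \<partial>M)"
    unfolding S_def by (rule nn_integral_suminf) measurable
  also have "\<dots> \<le> (\<Sum>k. ennreal ((1 / 2) ^ k))"
  proof (rule suminf_le)
    fix k
    have "(\<integral>\<^sup>+z. ennreal ((2 ^ k * norm (D k z)) powr q) \<partial>M) = ennreal ((2 ^ k) powr q) * Lp_int q M (D k)"
      unfolding Lp_int_def by (subst nn_integral_cmult[symmetric]) (auto simp: powr_mult ennreal_mult intro!: nn_integral_cong)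
    also have "\<dots> \<le> ennreal ((2 ^ k) powr q) * ennreal ((2 powr - (q + 1)) ^ k)"
      using le[of k "Suc k"] by (intro mult_left_mono) (auto simp: D_def[abs_def])
    also have "\<dots> = ennreal ((2 powr q * 2 powr - (q + 1)) ^ k)"
    proof -
      have "(2 ^ k) powr q = (2 powr q) ^ k"
        by (simp add: powr_realpow[symmetric] powr_powr mult.commute)
      then show ?thesis by (simp add: power_mult_distrib flip: ennreal_mult)
    qed
    also have "2 powr q * 2 powr - (q + 1) = (1 / 2 :: real)"
      by (simp add: powr_add[symmetric] powr_minus)
    finally show "(\<integral>\<^sup>+z. ennreal ((2 ^ k * norm (D k z)) powr q) \<partial>M) \<le> ennreal ((1 / 2) ^ k)" .
  qed auto
  also have "\<dots> = ennreal (\<Sum>k. (1 / 2) ^ k)"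
    by (intro suminf_ennreal2) (auto simp: summable_geometric)
  finally have "(\<integral>\<^sup>+z. S z \<partial>M) \<noteq> \<infinity>" by (auto simp: top_unique)
  then have "AE z in M. S z \<noteq> \<infinity>"
    by (intro nn_integral_PInf_AE) (auto simp: S_def)
  then have conv: "AE z in M. convergent (\<lambda>k. L k z)"
  proof eventually_elim
    fix z assume "S z \<noteq> \<infinity>"
    then have "summable (\<lambda>k. (2 ^ k * norm (D k z)) powr q)"
      unfolding S_def by (intro summable_suminf_not_top) auto
    then have "(\<lambda>k. (2 ^ k * norm (D k z)) powr q) \<longlonglongrightarrow> 0"
      by (rule summable_LIMSEQ_zero)
    then have "\<forall>\<^sub>F k in sequentially. (2 ^ k * norm (D k z)) powr q < 1"
      by (rule order_tendstoD) simp
    then have "\<forall>\<^sub>F k in sequentially. norm (D k z) \<le> (1 / 2) ^ k"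
    proof eventually_elim
      fix k assume *: "(2 ^ k * norm (D k z)) powr q < 1"
      have "2 ^ k * norm (D k z) \<le> 1"
      proof (rule ccontr)
        assume "\<not> ?thesis"
        then have "1 \<le> (2 ^ k * norm (D k z)) powr q" using q by (intro ge_one_powr_ge_zero) auto
        then show False using * by simp
      qed
      then show "norm (D k z) \<le> (1 / 2) ^ k" by (simp add: power_one_over field_simps)
    qed
    then have "summable (\<lambda>k. D k z)"
      by (rule summable_comparison_test_ev) (simp add: summable_geometric)
    then have "convergent (\<lambda>n. L 0 z + (\<Sum>k<n. D k z))"
      by (intro convergent_add convergent_const) (simp add: summable_iff_convergent)
    also have "(\<lambda>n. L 0 z + (\<Sum>k<n. D k z)) = (\<lambda>n. L n z)"
      using sum_lessThan_telescope[of "\<lambda>k. L k z"] by (simp add: D_def)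
    finally show "convergent (\<lambda>k. L k z)" .
  qed
  define G where "G z = lim (\<lambda>k. L k z)" for z
  have [measurable]: "G \<in> borel_measurable M" unfolding G_def by measurable
  have lim: "AE z in M. (\<lambda>k. L k z) \<longlonglongrightarrow> G z"
    using conv unfolding G_def by (simp add: convergent_LIMSEQ_iff)
  have "Lp_int q M (\<lambda>z. G z - L j z) \<le> ennreal ((2 powr - (q + 1)) ^ j)" for j
    unfolding Lp_int_def
  proof (rule nn_integral_le_limit[where F="\<lambda>n z. ennreal (norm (L (n + j) z - L j z) powr q)", OF _ _ _ tendsto_const])
    show "AE z in M. (\<lambda>n. ennreal (norm (L (n + j) z - L j z) powr q)) \<longlonglongrightarrow> ennreal (norm (G z - L j z) powr q)"
      using lim
    proof eventually_elim
      fix z assume "(\<lambda>k. L k z) \<longlonglongrightarrow> G z"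
      then show "(\<lambda>n. ennreal (norm (L (n + j) z - L j z) powr q)) \<longlonglongrightarrow> ennreal (norm (G z - L j z) powr q)"
        using q by (intro tendsto_ennrealI tendsto_powr2 tendsto_norm tendsto_diff tendsto_const LIMSEQ_ignore_initial_segment) auto
    qed
    show "(\<integral>\<^sup>+z. ennreal (norm (L (n + j) z - L j z) powr q) \<partial>M) \<le> ennreal ((2 powr - (q + 1)) ^ j)" for n
      using le[of j "n + j"] by (simp add: Lp_int_def)
  qed measurable
  then show thesis using lim by (intro that[of G]) auto
qed

lemma tendsto_Lp_int_add:
  assumes "\<And>k. u k \<in> borel_measurable M'" "\<And>k. v k \<in> borel_measurable M'" "0 \<le> r"
    and "(\<lambda>k. Lp_int r M' (u k)) \<longlonglongrightarrow> 0" "(\<lambda>k. Lp_int r M' (v k)) \<longlonglongrightarrow> 0"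
  shows "(\<lambda>k. Lp_int r M' (\<lambda>x. u k x + v k x)) \<longlonglongrightarrow> 0"
proof (rule tendsto_sandwich[OF _ _ tendsto_const])
  show "\<forall>\<^sub>F k in sequentially. Lp_int r M' (\<lambda>x. u k x + v k x) \<le> ennreal (2 powr r) * (Lp_int r M' (u k) + Lp_int r M' (v k))"
    by (intro always_eventually allI Lp_int_add_le assms)
  have "(\<lambda>k. ennreal (2 powr r) * (Lp_int r M' (u k) + Lp_int r M' (v k))) \<longlonglongrightarrow> ennreal (2 powr r) * (0 + 0)"
    by (intro tendsto_mult_ennreal tendsto_add assms tendsto_const) auto
  then show "(\<lambda>k. ennreal (2 powr r) * (Lp_int r M' (u k) + Lp_int r M' (v k))) \<longlonglongrightarrow> 0"
    by simp
qed auto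

locale laplace_Lp_bound = laplace_L2_bound +
  fixes p q :: real
  assumes p_gt_1: "p > 1" and q_ge_2: "q \<ge> 2" and conjugate: "1 / p + 1 / q = 1"
begin

abbreviation "M \<equiv> lebesgue_pos"

text \<open>For \<open>J\<close> the p-th power of the norm of \<open>g\<close>, this is the q-th
  power of B^(1/q) times that norm, because q - 1 = q / p. As \<open>enn2real\<close> sends infinity
  to 0, so does \<open>bound\<close>; hence the finiteness condition in its monotonicity.\<close>

definition bound :: "ennreal \<Rightarrow> ennreal" where
  "bound J = ennreal (B * enn2real J powr (q - 1))"

lemma bound_mono: "J \<le> J' \<Longrightarrow> J' < \<infinity> \<Longrightarrow> bound J \<le> bound J'"
  unfolding bound_def using B_pos q_ge_2
  by (intro ennreal_leI mult_left_mono powr_mono2 enn2real_mono) auto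

lemma tendsto_bound_0:
  assumes "(J \<longlongrightarrow> 0) F"
  shows "((\<lambda>k. bound (J k)) \<longlongrightarrow> 0) F"
proof -
  have "((\<lambda>k. enn2real (J k)) \<longlongrightarrow> enn2real 0) F"
    using tendsto_enn2real[of J 0 F] assms by simp
  then have "((\<lambda>k. ennreal (B * enn2real (J k) powr (q - 1))) \<longlongrightarrow> ennreal (B * enn2real 0 powr (q - 1))) F"
    using q_ge_2 by (intro tendsto_ennrealI tendsto_mult tendsto_const tendsto_powr2) auto
  then show ?thesis unfolding bound_def by simp
qed

lemma Lp_int_laplace_le:
  assumes "integrable M h" "Lp_int p M h < \<infinity>"
  shows "Lp_int q N (laplace h) \<le> bound (Lp_int p M h)"
proof -
  have [measurable]: "h \<in> borel_measurable M" using assms(1) by auto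
  have int: "integrable M (\<lambda>t. norm (h t) powr p)"
    using assms(2) by (auto simp: integrable_iff_bounded Lp_int_def)
  have "Lp_int p M h = ennreal (LINT t|M. norm (h t) powr p)"
    unfolding Lp_int_def by (intro nn_integral_eq_integral int) auto
  then have "enn2real (Lp_int p M h) = (LINT t|M. norm (h t) powr p)"
    by (simp add: integral_nonneg)
  then show ?thesis
    using laplace_Lp_bound[OF assms(1) int p_gt_1 q_ge_2 conjugate] by (simp add: bound_def Lp_int_def)
qed

text \<open>The closure of the graph of \<open>laplace\<close> on the integrable functions in Lp. It
  is a relation because a limit is determined only up to null sets; in this form linearity needs no
  choice of representatives.\<close>

definition is_limit :: "(real \<Rightarrow> complex) \<Rightarrow> (complex \<Rightarrow> complex) \<Rightarrow> bool" where
  "is_limit g G \<longleftrightarrow> g \<in> borel_measurable M \<and> G \<in> borel_measurable N \<and>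
     (\<exists>h. (\<forall>k. integrable M (h k) \<and> Lp_int p M (h k) < \<infinity>) \<and>
        (\<lambda>k. Lp_int p M (\<lambda>t. g t - h k t)) \<longlonglongrightarrow> 0 \<and>
        (\<lambda>k. Lp_int q N (\<lambda>z. G z - laplace (h k) z)) \<longlonglongrightarrow> 0)"

lemma is_limit_laplace:
  assumes "integrable M g" "Lp_int p M g < \<infinity>"
  shows "is_limit g (laplace g)"
  unfolding is_limit_def using assms p_gt_1 q_ge_2
  by (auto intro!: exI[of _ "\<lambda>_. g"] laplace_measurable simp: Lp_int_def)

lemma is_limit_add:
  assumes "is_limit g G" "is_limit g' G'"
  shows "is_limit (\<lambda>t. g t + g' t) (\<lambda>z. G z + G' z)"
proof -
  have [measurable]: "g \<in> borel_measurable M" "g' \<in> borel_measurable M" "G \<in> borel_measurable N" "G' \<in> borel_measurable N"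
    using assms by (auto simp: is_limit_def)
  obtain h where h: "\<And>k. integrable M (h k)" "\<And>k. Lp_int p M (h k) < \<infinity>"
      "(\<lambda>k. Lp_int p M (\<lambda>t. g t - h k t)) \<longlonglongrightarrow> 0" "(\<lambda>k. Lp_int q N (\<lambda>z. G z - laplace (h k) z)) \<longlonglongrightarrow> 0"
    using assms(1) unfolding is_limit_def by blast
  obtain h' where h': "\<And>k. integrable M (h' k)" "\<And>k. Lp_int p M (h' k) < \<infinity>"
      "(\<lambda>k. Lp_int p M (\<lambda>t. g' t - h' k t)) \<longlonglongrightarrow> 0" "(\<lambda>k. Lp_int q N (\<lambda>z. G' z - laplace (h' k) z)) \<longlonglongrightarrow> 0"
    using assms(2) unfolding is_limit_def by blast
  have [measurable]: "h k \<in> borel_measurable M" "h' k \<in> borel_measurable M" for k using h h' by auto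
  have [measurable]: "laplace (h k) \<in> borel_measurable N" "laplace (h' k) \<in> borel_measurable N" for k
    by (auto intro!: laplace_measurable)
  have "Lp_int p M (\<lambda>t. h k t + h' k t) < \<infinity>" for k
  proof (rule le_less_trans[OF Lp_int_add_le])
    show "ennreal (2 powr p) * (Lp_int p M (h k) + Lp_int p M (h' k)) < \<infinity>"
      using h(2)[of k] h'(2)[of k] by (simp add: ennreal_mult_less_top)
  qed (use p_gt_1 in auto)
  moreover have "(\<lambda>k. Lp_int p M (\<lambda>t. g t + g' t - (h k t + h' k t))) \<longlonglongrightarrow> 0"
    using tendsto_Lp_int_add[OF _ _ _ h(3) h'(3)] p_gt_1 by (simp add: algebra_simps)
  moreover have "(\<lambda>k. Lp_int q N (\<lambda>z. G z + G' z - laplace (\<lambda>t. h k t + h' k t) z)) \<longlonglongrightarrow> 0"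
  proof -
    have "Lp_int q N (\<lambda>z. G z + G' z - laplace (\<lambda>t. h k t + h' k t) z) =
        Lp_int q N (\<lambda>z. (G z - laplace (h k) z) + (G' z - laplace (h' k) z))" for k
      using h(1) h'(1) Re_nonneg by (intro Lp_int_cong_AE AE_I2) (simp add: laplace_add)
    then show ?thesis
      using tendsto_Lp_int_add[OF _ _ _ h(4) h'(4)] q_ge_2 by simp
  qed
  ultimately show ?thesis
    unfolding is_limit_def using h(1) h'(1) by (intro conjI exI[of _ "\<lambda>k t. h k t + h' k t"]) auto
qed

lemma is_limit_cmult:
  assumes "is_limit g G"
  shows "is_limit (\<lambda>t. c * g t) (\<lambda>z. c * G z)"
proof -
  have [measurable]: "g \<in> borel_measurable M" "G \<in> borel_measurable N"
    using assms by (auto simp: is_limit_def)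
  obtain h where h: "\<And>k. integrable M (h k)" "\<And>k. Lp_int p M (h k) < \<infinity>"
      "(\<lambda>k. Lp_int p M (\<lambda>t. g t - h k t)) \<longlonglongrightarrow> 0" "(\<lambda>k. Lp_int q N (\<lambda>z. G z - laplace (h k) z)) \<longlonglongrightarrow> 0"
    using assms(1) unfolding is_limit_def by blast
  have [measurable]: "h k \<in> borel_measurable M" for k using h by auto
  have [measurable]: "laplace (h k) \<in> borel_measurable N" for k
    by (auto intro!: laplace_measurable)
  have "Lp_int p M (\<lambda>t. c * h k t) < \<infinity>" for k
    using h(2)[of k] by (simp add: Lp_int_cmult ennreal_mult_less_top)
  moreover have "(\<lambda>k. Lp_int p M (\<lambda>t. c * g t - c * h k t)) \<longlonglongrightarrow> 0"
    using tendsto_mult_ennreal[OF tendsto_const h(3), of "ennreal (norm c powr p)"]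
    by (simp add: Lp_int_cmult[symmetric] right_diff_distrib)
  moreover have "(\<lambda>k. Lp_int q N (\<lambda>z. c * G z - laplace (\<lambda>t. c * h k t) z)) \<longlonglongrightarrow> 0"
    using tendsto_mult_ennreal[OF tendsto_const h(4), of "ennreal (norm c powr q)"]
    by (simp add: Lp_int_cmult[symmetric] right_diff_distrib laplace_cmult)
  ultimately show ?thesis
    unfolding is_limit_def using h(1) by (intro conjI exI[of _ "\<lambda>k t. c * h k t"]) auto
qed

text \<open>By linearity the difference of two limits is a limit belonging to 0. Its approximants
  tend to 0 in Lp, hence by the interpolated bound their transforms tend to 0 in Lq.\<close>

lemma is_limit_unique:
  assumes "is_limit g G" "is_limit g G'"
  shows "AE z in N. G z = G' z"
proof -
  have [measurable]: "G \<in> borel_measurable N" "G' \<in> borel_measurable N"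
    using assms by (auto simp: is_limit_def)
  \<comment> \<open>Written as a sum with a multiple by \<open>- 1\<close>, so that the closure
    properties apply verbatim.\<close>
  define E where "E z = G z + - 1 * G' z" for z
  have [measurable]: "E \<in> borel_measurable N" unfolding E_def by measurable
  have "is_limit (\<lambda>t. g t + - 1 * g t) E"
    unfolding E_def by (intro is_limit_add is_limit_cmult assms)
  then have "is_limit (\<lambda>t. 0) E" by simp
  then obtain h where h: "\<And>k. integrable M (h k)" "\<And>k. Lp_int p M (h k) < \<infinity>"
      "(\<lambda>k. Lp_int p M (\<lambda>t. 0 - h k t)) \<longlonglongrightarrow> 0" "(\<lambda>k. Lp_int q N (\<lambda>z. E z - laplace (h k) z)) \<longlonglongrightarrow> 0"
    unfolding is_limit_def by blast
  have [measurable]: "laplace (h k) \<in> borel_measurable N" for k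
    using h(1) by (auto intro!: laplace_measurable)
  have bound_lim: "(\<lambda>k. bound (Lp_int p M (h k))) \<longlonglongrightarrow> 0"
    using h(3) by (intro tendsto_bound_0) (simp add: Lp_int_minus)
  have "(\<lambda>k. Lp_int q N (laplace (h k))) \<longlonglongrightarrow> 0"
  proof (rule tendsto_sandwich[OF _ _ tendsto_const bound_lim])
    show "\<forall>\<^sub>F k in sequentially. Lp_int q N (laplace (h k)) \<le> bound (Lp_int p M (h k))"
      by (intro always_eventually allI Lp_int_laplace_le h)
  qed simp
  then have "(\<lambda>k. Lp_int q N (\<lambda>z. (E z - laplace (h k) z) + laplace (h k) z)) \<longlonglongrightarrow> 0"
    using h(4) q_ge_2 by (intro tendsto_Lp_int_add) auto
  then have "Lp_int q N E = 0"
    by (simp add: LIMSEQ_const_iff)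
  then have "AE z in N. ennreal (norm (E z) powr q) = 0"
    unfolding Lp_int_def by (subst (asm) nn_integral_0_iff_AE) auto
  then show ?thesis
    by eventually_elim (simp add: E_def)
qed

text \<open>The underlying measure lives on the positive axis, so cutting off on the right leaves a
  set of finite measure, on which Lp is contained in L1. This provides the density of L1 \<inter>
  Lp.\<close>

definition trunc :: "(real \<Rightarrow> complex) \<Rightarrow> nat \<Rightarrow> real \<Rightarrow> complex" where
  "trunc g n t = (if t \<le> real n then g t else 0)"

lemma
  assumes g[measurable]: "g \<in> borel_measurable M" and fin: "Lp_int p M g < \<infinity>"
  shows trunc_integrable: "integrable M (trunc g n)"
    and trunc_Lp: "Lp_int p M (trunc g n) \<le> Lp_int p M g"
    and trunc_tendsto: "(\<lambda>n. Lp_int p M (\<lambda>t. g t - trunc g n t)) \<longlonglongrightarrow> 0"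
proof -
  have [measurable]: "(\<lambda>t. t) \<in> borel_measurable M"
    by (intro measurable_restrict_space1 measurable_completion) simp
  have [measurable]: "trunc g n \<in> borel_measurable M" for n
    unfolding trunc_def by measurable
  have int_p: "integrable M (\<lambda>t. norm (g t) powr p)"
    using fin by (auto simp: integrable_iff_bounded Lp_int_def)
  have "emeasure M {0<..real n} < \<infinity>"
    by (subst emeasure_restrict_space) auto
  then have int_1: "integrable M (indicator {0<..real n} :: real \<Rightarrow> real)"
    by (intro integrable_real_indicator) (auto simp: sets_restrict_space_iff)
  show "integrable M (trunc g n)"
  proof (rule Bochner_Integration.integrable_bound[OF Bochner_Integration.integrable_add[OF int_1 int_p]])
    \<comment> \<open>Holds because p > 1; the summand 1 is integrable over the bounded
      interval.\<close>
    have "x \<le> 1 + x powr p" if "0 \<le> x" for x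
    proof (cases "x \<le> 1")
      case False
      then have "x powr 1 \<le> x powr p" using p_gt_1 by (intro powr_mono) auto
      then show ?thesis using False by simp
    qed (simp add: add_increasing2)
    then show "AE t in M. norm (trunc g n t) \<le> norm (indicat_real {0<..real n} t + norm (g t) powr p)"
      by (intro AE_I2) (auto simp: trunc_def indicator_def)
  qed measurable
  show "Lp_int p M (trunc g n) \<le> Lp_int p M g"
    using p_gt_1 by (intro Lp_int_mono) (auto simp: trunc_def)
  have "(\<lambda>n. \<integral>\<^sup>+t. ennreal (norm (g t - trunc g n t) powr p) \<partial>M) \<longlonglongrightarrow> (\<integral>\<^sup>+t. 0 \<partial>M)"
  proof (rule nn_integral_dominated_convergence[where w="\<lambda>t. ennreal (norm (g t) powr p)"])
    show "(\<integral>\<^sup>+t. ennreal (norm (g t) powr p) \<partial>M) < \<infinity>" using fin by (simp add: Lp_int_def)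
    show "AE t in M. (\<lambda>n. ennreal (norm (g t - trunc g n t) powr p)) \<longlonglongrightarrow> 0"
    proof (intro AE_I2 tendsto_eventually)
      fix t :: real
      obtain K where "t \<le> real K" using real_arch_simple by blast
      then show "\<forall>\<^sub>F n in sequentially. ennreal (norm (g t - trunc g n t) powr p) = 0"
        unfolding eventually_sequentially by (intro exI[of _ K]) (auto simp: trunc_def)
    qed
    show "AE t in M. ennreal (norm (g t - trunc g n t) powr p) \<le> ennreal (norm (g t) powr p)" for n
      by (auto simp: trunc_def)
  qed auto
  then show "(\<lambda>n. Lp_int p M (\<lambda>t. g t - trunc g n t)) \<longlonglongrightarrow> 0"
    by (simp add: Lp_int_def)
qed

text \<open>Truncations are selected so sparsely that their transforms meet the rate of the fast
  Cauchy lemma. The bound for the limit comes by Fatou from the truncations themselves, whose norms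
  do not exceed that of \<open>g\<close>.\<close>

lemma ex_is_limit:
  assumes g[measurable]: "g \<in> borel_measurable M" and fin: "Lp_int p M g < \<infinity>"
  obtains G where "is_limit g G" "Lp_int q N G \<le> bound (Lp_int p M g)"
proof -
  define r where "r = 2 powr - (q + 1)"
  have r: "0 < r" "r < 1" using q_ge_2 by (auto simp: r_def powr_less_one)
  note trunc = trunc_integrable[OF g fin] trunc_Lp[OF g fin] trunc_tendsto[OF g fin]
  \<comment> \<open>The first condition yields convergence to \<open>g\<close>, the second the
    prescribed geometric rate for the transforms.\<close>
  have "\<exists>n. Lp_int p M (\<lambda>t. g t - trunc g n t) < ennreal (inverse (real (Suc k))) \<and>
      bound (Lp_int p M (\<lambda>t. g t - trunc g n t)) < ennreal (r ^ k)" for k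
  proof -
    have "\<forall>\<^sub>F n in sequentially. Lp_int p M (\<lambda>t. g t - trunc g n t) < ennreal (inverse (real (Suc k)))"
      using trunc(3) by (rule order_tendstoD) simp
    moreover have "\<forall>\<^sub>F n in sequentially. bound (Lp_int p M (\<lambda>t. g t - trunc g n t)) < ennreal (r ^ k)"
      using tendsto_bound_0[OF trunc(3)] by (rule order_tendstoD) (use r in simp)
    ultimately have "\<forall>\<^sub>F n in sequentially. Lp_int p M (\<lambda>t. g t - trunc g n t) < ennreal (inverse (real (Suc k))) \<and>
      bound (Lp_int p M (\<lambda>t. g t - trunc g n t)) < ennreal (r ^ k)"
      by (rule eventually_conj)
    then show ?thesis by (rule eventually_happens'[OF sequentially_bot])
  qed
  then obtain n where n: "\<And>k. Lp_int p M (\<lambda>t. g t - trunc g (n k) t) < ennreal (inverse (real (Suc k)))"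
      "\<And>k. bound (Lp_int p M (\<lambda>t. g t - trunc g (n k) t)) < ennreal (r ^ k)"
    by metis
  define u where "u k = trunc g (n k)" for k
  have u: "integrable M (u k)" "Lp_int p M (u k) \<le> Lp_int p M g" "Lp_int p M (u k) < \<infinity>" for k
    using trunc(1)[of "n k"] trunc(2)[of "n k"] fin by (auto simp: u_def)
  have u_meas[measurable]: "u k \<in> borel_measurable M" for k using u(1) by auto
  have L_meas[measurable]: "laplace (u k) \<in> borel_measurable N" for k
    by (intro laplace_measurable) simp
  have diff_fin: "Lp_int p M (\<lambda>t. g t - u k t) < \<infinity>" for k
    using n(1)[of k] unfolding u_def by (rule less_trans) simp
  have Cauchy: "Lp_int q N (\<lambda>z. laplace (u k) z - laplace (u j) z) \<le> ennreal (r ^ j)" if "j \<le> k" for j k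
  proof -
    \<comment> \<open>The cutoffs \<open>n k\<close> need not increase with k. Two truncations
      differ only beyond the smaller cutoff, so their difference is controlled by the remainder at
      that index; it is j or k, hence at least j, and the rate r^j is kept.\<close>
    define i where "i = (if n j \<le> n k then j else k)"
    have le: "norm (u k t - u j t) \<le> norm (g t - u i t)" for t
      by (auto simp: u_def trunc_def i_def)
    have "Lp_int q N (\<lambda>z. laplace (u k) z - laplace (u j) z) = Lp_int q N (laplace (\<lambda>t. u k t - u j t))"
      using u(1) Re_nonneg by (intro Lp_int_cong_AE AE_I2) (simp add: laplace_diff)
    also have "\<dots> \<le> bound (Lp_int p M (\<lambda>t. u k t - u j t))"
      using u(1) Lp_int_mono[of M "\<lambda>t. u k t - u j t" "\<lambda>t. g t - u i t" p] le p_gt_1 diff_fin[of i]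
      by (intro Lp_int_laplace_le) (auto intro: le_less_trans)
    also have "\<dots> \<le> bound (Lp_int p M (\<lambda>t. g t - u i t))"
      using le p_gt_1 by (intro bound_mono Lp_int_mono diff_fin) auto
    also have "\<dots> \<le> ennreal (r ^ i)"
      using n(2)[of i] by (simp add: u_def)
    also have "\<dots> \<le> ennreal (r ^ j)"
      using r that by (intro ennreal_leI power_decreasing) (auto simp: i_def)
    finally show ?thesis .
  qed
  have q_pos: "q > 0" using q_ge_2 by simp
  obtain G where G[measurable]: "G \<in> borel_measurable N" and G_lim: "AE z in N. (\<lambda>k. laplace (u k) z) \<longlonglongrightarrow> G z"
    and G_le': "\<And>j. Lp_int q N (\<lambda>z. G z - laplace (u j) z) \<le> ennreal ((2 powr - (q + 1)) ^ j)"
    by (rule Lp_fast_Cauchy_limit[of "\<lambda>k. laplace (u k)", OF L_meas q_pos Cauchy[unfolded r_def]])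
       (assumption, rule that)
  note G_le = G_le'[folded r_def]
  show thesis
  proof (rule that)
    have "(\<lambda>k. Lp_int p M (\<lambda>t. g t - u k t)) \<longlonglongrightarrow> 0"
    proof (rule tendsto_sandwich[OF _ _ tendsto_const])
      show "\<forall>\<^sub>F k in sequentially. Lp_int p M (\<lambda>t. g t - u k t) \<le> ennreal (inverse (real (Suc k)))"
        using n(1) by (intro always_eventually) (auto simp: u_def less_imp_le)
      show "(\<lambda>k. ennreal (inverse (real (Suc k)))) \<longlonglongrightarrow> 0"
        using tendsto_ennrealI[OF LIMSEQ_inverse_real_of_nat] by simp
    qed simp
    moreover have "(\<lambda>k. Lp_int q N (\<lambda>z. G z - laplace (u k) z)) \<longlonglongrightarrow> 0"
    proof (rule tendsto_sandwich[OF _ _ tendsto_const])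
      show "\<forall>\<^sub>F k in sequentially. Lp_int q N (\<lambda>z. G z - laplace (u k) z) \<le> ennreal (r ^ k)"
        using G_le by (intro always_eventually) auto
      show "(\<lambda>k. ennreal (r ^ k)) \<longlonglongrightarrow> 0"
        using tendsto_ennrealI[OF LIMSEQ_power_zero[of r]] r by simp
    qed simp
    ultimately show "is_limit g G"
      unfolding is_limit_def using u by (intro conjI exI[of _ u]) auto
    show "Lp_int q N G \<le> bound (Lp_int p M g)"
      unfolding Lp_int_def[of q]
    proof (rule nn_integral_le_limit[where F="\<lambda>k z. ennreal (norm (laplace (u k) z) powr q)", OF _ _ _ tendsto_const])
      show "AE z in N. (\<lambda>k. ennreal (norm (laplace (u k) z) powr q)) \<longlonglongrightarrow> ennreal (norm (G z) powr q)"
        using G_lim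
      proof eventually_elim
        fix z assume "(\<lambda>k. laplace (u k) z) \<longlonglongrightarrow> G z"
        then show "(\<lambda>k. ennreal (norm (laplace (u k) z) powr q)) \<longlonglongrightarrow> ennreal (norm (G z) powr q)"
          using q_ge_2 by (intro tendsto_ennrealI tendsto_powr2 tendsto_norm tendsto_const) auto
      qed
      show "(\<integral>\<^sup>+z. ennreal (norm (laplace (u k) z) powr q) \<partial>N) \<le> bound (Lp_int p M g)" for k
        using order_trans[OF Lp_int_laplace_le[OF u(1,3)] bound_mono[OF u(2) fin]] by (simp add: Lp_int_def)
    qed measurable
  qed
qed

text \<open>The bound is known for one limit by construction; uniqueness carries it over to
  all.\<close>

lemma is_limit_bound:
  assumes "is_limit g G" "Lp_int p M g < \<infinity>"
  shows "Lp_int q N G \<le> bound (Lp_int p M g)"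
proof -
  have "g \<in> borel_measurable M" using assms(1) by (simp add: is_limit_def)
  then obtain G' where G': "is_limit g G'" "Lp_int q N G' \<le> bound (Lp_int p M g)"
    using ex_is_limit[OF _ assms(2)] by blast
  then show ?thesis
    using Lp_int_cong_AE[OF is_limit_unique[OF assms(1) G'(1)]] by metis
qed

end

lemma Lp_norm_ennreal_finite:
  "0 \<le> p \<Longrightarrow> Lp_int p M g < \<infinity> \<Longrightarrow> Lp_norm (ennreal p) M g = ennreal (enn2real (Lp_int p M g) powr (1 / p))"
  by (auto simp: Lp_norm_ennreal)

context laplace_Lp_bound
begin

lemma Lp_norm_le_of_bound:
  assumes "Lp_int q N G \<le> bound (Lp_int p M g)" "Lp_int p M g < \<infinity>"
  shows "Lp_norm (ennreal q) N G \<le> ennreal (B powr (1 / q)) * Lp_norm (ennreal p) M g"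
proof -
  define a where "a = enn2real (Lp_int p M g)"
  have fin: "Lp_int q N G < \<infinity>"
    using assms(1) by (auto simp: bound_def le_less_trans)
  have "enn2real (Lp_int q N G) \<le> B * a powr (q - 1)"
    using enn2real_mono[OF assms(1)] B_pos by (simp add: bound_def a_def)
  then have "enn2real (Lp_int q N G) powr (1 / q) \<le> (B * a powr (q - 1)) powr (1 / q)"
    using q_ge_2 by (intro powr_mono2) auto
  also have "\<dots> = B powr (1 / q) * a powr ((q - 1) * (1 / q))"
    using B_pos by (simp add: powr_mult powr_powr)
  also have "(q - 1) * (1 / q) = 1 / p"
    using conjugate q_ge_2 by (simp add: field_simps)
  finally show ?thesis
    using fin assms(2) p_gt_1 q_ge_2 by (auto simp: Lp_norm_ennreal a_def ennreal_leI simp flip: ennreal_mult)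
qed

lemma mem_Lp_1_Int_Lp: "g \<in> Lp 1 M \<inter> Lp (ennreal p) M \<longleftrightarrow> integrable M g \<and> Lp_int p M g < \<infinity>"
  using mem_Lp_ennreal[of 1 g M] mem_Lp_ennreal[of p g M] p_gt_1
  by (auto simp: integrable_iff_bounded Lp_int_def)

text \<open>Makes the sharp bound available for whatever extension the choice operator picks. The
  unspecified constant of \<open>T\<close> is used only to see that T (g - trunc g n) tends to 0; on
  truncations \<open>T\<close> is the transform itself.\<close>

lemma is_limit_of_extension:
  assumes T: "is_laplace_extension (ennreal p) (ennreal q) N T" and g: "g \<in> Lp (ennreal p) M"
  shows "is_limit g (T g)"
proof -
  have [measurable]: "g \<in> borel_measurable M" and fin: "Lp_int p M g < \<infinity>"
    using g p_gt_1 by (auto simp: mem_Lp_ennreal)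
  note trunc = trunc_integrable[OF _ fin] trunc_Lp[OF _ fin] trunc_tendsto[OF _ fin]
  have T_meas: "T f \<in> borel_measurable N" if "f \<in> Lp (ennreal p) M" for f
    using T that q_ge_2 by (auto simp: is_laplace_extension_def bounded_linear_Lp_def mem_Lp_ennreal)
  have T_add: "AE z in N. T (\<lambda>t. f t + h t) z = T f z + T h z"
    if "f \<in> Lp (ennreal p) M" "h \<in> Lp (ennreal p) M" for f h
    using T that unfolding is_laplace_extension_def bounded_linear_Lp_def by blast
  have "\<exists>C::real. \<forall>f\<in>Lp (ennreal p) M. Lp_norm (ennreal q) N (T f) \<le> ennreal C * Lp_norm (ennreal p) M f"
    using T by (simp add: is_laplace_extension_def bounded_linear_Lp_def)
  then obtain C where C: "\<And>f. f \<in> Lp (ennreal p) M \<Longrightarrow> Lp_norm (ennreal q) N (T f) \<le> ennreal C * Lp_norm (ennreal p) M f"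
    by blast
  \<comment> \<open>\<open>ennreal\<close> maps negative reals to 0, so replacing C by its positive
    part changes nothing and makes real powers monotone.\<close>
  define C' where "C' = max C 0"
  have T_int: "Lp_int q N (T f) \<le> ennreal ((C' * enn2real (Lp_int p M f) powr (1 / p)) powr q)"
    if f: "f \<in> Lp (ennreal p) M" for f
  proof -
    have fin_f: "Lp_int p M f < \<infinity>" using f p_gt_1 by (simp add: mem_Lp_ennreal)
    have fin': "Lp_int q N (T f) < \<infinity>"
      using T f q_ge_2 by (auto simp: is_laplace_extension_def bounded_linear_Lp_def mem_Lp_ennreal)
    have "ennreal C = ennreal C'" by (simp add: C'_def max_def ennreal_neg)
    then have "ennreal (enn2real (Lp_int q N (T f)) powr (1 / q)) \<le> ennreal C' * ennreal (enn2real (Lp_int p M f) powr (1 / p))"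
      using C[OF f] Lp_norm_ennreal_finite[OF _ fin_f] Lp_norm_ennreal_finite[OF _ fin'] p_gt_1 q_ge_2 by simp
    also have "\<dots> = ennreal (C' * enn2real (Lp_int p M f) powr (1 / p))"
      by (simp add: C'_def flip: ennreal_mult)
    finally have "enn2real (Lp_int q N (T f)) powr (1 / q) \<le> C' * enn2real (Lp_int p M f) powr (1 / p)"
      by (simp add: C'_def ennreal_le_iff)
    then have "(enn2real (Lp_int q N (T f)) powr (1 / q)) powr q \<le> (C' * enn2real (Lp_int p M f) powr (1 / p)) powr q"
      using q_ge_2 by (intro powr_mono2) auto
    then have "ennreal (enn2real (Lp_int q N (T f))) \<le> ennreal ((C' * enn2real (Lp_int p M f) powr (1 / p)) powr q)"
      using q_ge_2 by (intro ennreal_leI) (simp add: powr_powr)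
    then show ?thesis using fin' by (subst (asm) ennreal_enn2real) auto
  qed
  have diff: "(\<lambda>t. g t - trunc g n t) \<in> Lp (ennreal p) M" for n
  proof -
    have "Lp_int p M (\<lambda>t. g t - trunc g n t) \<le> Lp_int p M g"
      using p_gt_1 by (intro Lp_int_mono) (auto simp: trunc_def)
    then show ?thesis
      using fin p_gt_1 borel_measurable_integrable[OF trunc(1)] by (auto simp: mem_Lp_ennreal le_less_trans)
  qed
  have trunc_mem: "trunc g n \<in> Lp 1 M \<inter> Lp (ennreal p) M" for n
    unfolding mem_Lp_1_Int_Lp using trunc(1) le_less_trans[OF trunc(2) fin] by simp
  have "Lp_int q N (\<lambda>z. T g z - laplace (trunc g n) z) = Lp_int q N (T (\<lambda>t. g t - trunc g n t))" for n
  proof (rule Lp_int_cong_AE)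
    have "AE z in N. T (\<lambda>t. (g t - trunc g n t) + trunc g n t) z = T (\<lambda>t. g t - trunc g n t) z + T (trunc g n) z"
      using trunc_mem[of n] by (intro T_add diff) simp
    moreover have "AE z in N. T (trunc g n) z = laplace (trunc g n) z"
      using T trunc_mem[of n] by (simp add: is_laplace_extension_def)
    ultimately show "AE z in N. T g z - laplace (trunc g n) z = T (\<lambda>t. g t - trunc g n t) z"
      by eventually_elim simp
  qed
  then have le: "Lp_int q N (\<lambda>z. T g z - laplace (trunc g n) z) \<le>
      ennreal ((C' * enn2real (Lp_int p M (\<lambda>t. g t - trunc g n t)) powr (1 / p)) powr q)" for n
    using T_int[OF diff] by simp
  have "(\<lambda>n. enn2real (Lp_int p M (\<lambda>t. g t - trunc g n t))) \<longlonglongrightarrow> 0"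
    using tendsto_enn2real[of _ 0] trunc(3) by simp
  then have "(\<lambda>n. ennreal ((C' * enn2real (Lp_int p M (\<lambda>t. g t - trunc g n t)) powr (1 / p)) powr q)) \<longlonglongrightarrow>
      ennreal ((C' * 0 powr (1 / p)) powr q)"
    using p_gt_1 q_ge_2
    by (intro tendsto_ennrealI tendsto_powr2 tendsto_mult tendsto_const) (auto simp: C'_def)
  then have lim: "(\<lambda>n. ennreal ((C' * enn2real (Lp_int p M (\<lambda>t. g t - trunc g n t)) powr (1 / p)) powr q)) \<longlonglongrightarrow> 0"
    by simp
  have "(\<lambda>n. Lp_int q N (\<lambda>z. T g z - laplace (trunc g n) z)) \<longlonglongrightarrow> 0"
    by (rule tendsto_sandwich[OF _ _ tendsto_const lim]) (auto intro!: always_eventually le)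
  then show ?thesis
    unfolding is_limit_def using trunc T_meas[OF g] trunc_mem mem_Lp_1_Int_Lp
    by (intro conjI exI[of _ "trunc g"]) auto
qed

text \<open>Values chosen separately for each \<open>g\<close> still form a linear operator: a sum
  or multiple of limits is a limit of the sum or multiple, and limits agree almost
  everywhere.\<close>

lemma is_laplace_extension_limit:
  "is_laplace_extension (ennreal p) (ennreal q) N (\<lambda>g. SOME G. is_limit g G)"
proof -
  define T where "T g = (SOME G. is_limit g G)" for g
  have T: "is_limit g (T g)" if "g \<in> Lp (ennreal p) M" for g
  proof -
    have "g \<in> borel_measurable M" "Lp_int p M g < \<infinity>"
      using that p_gt_1 by (auto simp: mem_Lp_ennreal)
    then obtain G where "is_limit g G" using ex_is_limit by blast
    then show ?thesis unfolding T_def by (rule someI[where P="is_limit g"])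
  qed
  have T_bound: "Lp_int q N (T g) \<le> bound (Lp_int p M g)" if "g \<in> Lp (ennreal p) M" for g
    using is_limit_bound[OF T[OF that]] that p_gt_1 by (auto simp: mem_Lp_ennreal)
  have add: "(\<lambda>t. g t + h t) \<in> Lp (ennreal p) M" if "g \<in> Lp (ennreal p) M" "h \<in> Lp (ennreal p) M" for g h
    using that Lp_int_add_le[of g M h p] p_gt_1
    by (auto simp: mem_Lp_ennreal ennreal_mult_less_top intro: le_less_trans)
  have cmult: "(\<lambda>t. c * g t) \<in> Lp (ennreal p) M" if "g \<in> Lp (ennreal p) M" for c g
    using that p_gt_1 by (auto simp: mem_Lp_ennreal ennreal_mult_less_top Lp_int_cmult)
  have "bounded_linear_Lp (ennreal p) M (ennreal q) N T"
    unfolding bounded_linear_Lp_def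
  proof (intro conjI ballI allI)
    show "T g \<in> Lp (ennreal q) N" if g: "g \<in> Lp (ennreal p) M" for g
      using T[OF g] le_less_trans[OF T_bound[OF g]] q_ge_2 by (auto simp: mem_Lp_ennreal is_limit_def bound_def)
    show "AE y in N. T (\<lambda>x. g x + h x) y = T g y + T h y"
      if "g \<in> Lp (ennreal p) M" "h \<in> Lp (ennreal p) M" for g h
      using that by (intro is_limit_unique[OF T is_limit_add] T add)
    show "AE y in N. T (\<lambda>x. c * g x) y = c * T g y" if "g \<in> Lp (ennreal p) M" for c g
      using that by (intro is_limit_unique[OF T is_limit_cmult] T cmult)
    show "\<exists>C::real. \<forall>g\<in>Lp (ennreal p) M. Lp_norm (ennreal q) N (T g) \<le> ennreal C * Lp_norm (ennreal p) M g"
      using T_bound p_gt_1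
      by (intro exI[of _ "B powr (1 / q)"] ballI Lp_norm_le_of_bound) (auto simp: mem_Lp_ennreal)
  qed
  moreover have "AE z in N. T g z = laplace g z" if "g \<in> Lp 1 M \<inter> Lp (ennreal p) M" for g
    using that is_limit_unique[OF T is_limit_laplace] by (metis IntD2 mem_Lp_1_Int_Lp)
  ultimately show ?thesis
    unfolding is_laplace_extension_def T_def by blast
qed

lemma laplace_op_extension: "is_laplace_extension (ennreal p) (ennreal q) N (laplace_op (ennreal p) (ennreal q) N)"
  unfolding laplace_op_def using is_laplace_extension_limit
  by (rule someI[where P="is_laplace_extension (ennreal p) (ennreal q) N"])

lemma laplace_opnorm_le: "laplace_opnorm (ennreal p) (ennreal q) N \<le> ennreal (B powr (1 / q))"
  unfolding laplace_opnorm_def Lp_opnorm_def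
proof (rule SUP_least, clarify)
  fix g assume g: "g \<in> Lp (ennreal p) M" "Lp_norm (ennreal p) M g \<le> 1"
  have fin: "Lp_int p M g < \<infinity>" using g p_gt_1 by (simp add: mem_Lp_ennreal)
  have "Lp_norm (ennreal q) N (laplace_op (ennreal p) (ennreal q) N g) \<le> ennreal (B powr (1 / q)) * Lp_norm (ennreal p) M g"
    by (intro Lp_norm_le_of_bound is_limit_bound is_limit_of_extension laplace_op_extension g fin)
  also have "\<dots> \<le> ennreal (B powr (1 / q)) * 1"
    using g(2) by (intro mult_left_mono) auto
  finally show "Lp_norm (ennreal q) N (laplace_op (ennreal p) (ennreal q) N g) \<le> ennreal (B powr (1 / q))" by simp
qed

end

section \<open>The endpoint p = 1 and all exponents together\<close>

context laplace_L2_bound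
begin

text \<open>At p = 1 the dense subspace is the whole space, so every extension agrees almost
  everywhere with \<open>laplace\<close>, and the pointwise bound by the L1-norm controls the
  essential supremum.\<close>

lemma laplace_L1_Linfinity:
  "is_laplace_extension 1 \<infinity> N (laplace_op 1 \<infinity> N) \<and> laplace_opnorm 1 \<infinity> N \<le> 1"
proof -
  let ?M = "lebesgue_pos"
  have norm1: "Lp_norm 1 ?M g = ennreal (LINT t|?M. norm (g t))" and int: "integrable ?M g"
    if "g \<in> Lp 1 ?M" for g
  proof -
    have "g \<in> borel_measurable ?M" "Lp_int 1 ?M g < \<infinity>"
      using that mem_Lp_ennreal[of 1 g ?M] by auto
    then show int: "integrable ?M g"
      by (simp add: integrable_iff_bounded Lp_int_def)
    have "Lp_int 1 ?M g = ennreal (LINT t|?M. norm (g t))"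
      unfolding Lp_int_def using int by (simp add: nn_integral_eq_integral)
    then show "Lp_norm 1 ?M g = ennreal (LINT t|?M. norm (g t))"
      using Lp_norm_ennreal[of 1 ?M g] by (simp add: integral_nonneg)
  qed
  have infty: "Lp_norm \<infinity> N G \<le> Lp_norm 1 ?M g"
    if "g \<in> Lp 1 ?M" "G \<in> borel_measurable N" "AE z in N. G z = laplace g z" for g G
  proof -
    have "AE z in N. ennreal (norm (laplace g z)) \<le> Lp_norm 1 ?M g"
      using norm_laplace_le[OF int[OF that(1)] Re_nonneg] by (intro AE_I2) (simp add: norm1[OF that(1)] ennreal_leI)
    then have "AE z in N. ennreal (norm (G z)) \<le> Lp_norm 1 ?M g"
      using that(3) by eventually_elim simp
    then show ?thesis
      using that(2) unfolding Lp_norm_def by (simp only: if_True simp_thms) (intro esssup_I, measurable)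
  qed
  have lap: "laplace g \<in> Lp \<infinity> N" "Lp_norm \<infinity> N (laplace g) \<le> Lp_norm 1 ?M g" if "g \<in> Lp 1 ?M" for g
  proof -
    have meas: "laplace g \<in> borel_measurable N"
      using int[OF that] by (intro laplace_measurable) auto
    then show "Lp_norm \<infinity> N (laplace g) \<le> Lp_norm 1 ?M g"
      by (intro infty that) auto
    then show "laplace g \<in> Lp \<infinity> N"
      using meas norm1[OF that] by (auto simp: Lp_def le_less_trans)
  qed
  have "is_laplace_extension 1 \<infinity> N laplace"
    unfolding is_laplace_extension_def bounded_linear_Lp_def
  proof (intro conjI ballI allI)
    show "\<exists>C::real. \<forall>g\<in>Lp 1 ?M. Lp_norm \<infinity> N (laplace g) \<le> ennreal C * Lp_norm 1 ?M g"
      using lap(2) by (intro exI[of _ 1]) simp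
  qed (use lap(1) int Re_nonneg in \<open>auto simp: laplace_add laplace_cmult\<close>)
  then have ext: "is_laplace_extension 1 \<infinity> N (laplace_op 1 \<infinity> N)"
    unfolding laplace_op_def by (rule someI[where P="is_laplace_extension 1 \<infinity> N"])
  have "laplace_opnorm 1 \<infinity> N \<le> 1"
    unfolding laplace_opnorm_def Lp_opnorm_def
  proof (rule SUP_least, clarify)
    fix g assume g: "g \<in> Lp 1 ?M" "Lp_norm 1 ?M g \<le> 1"
    have "Lp_norm \<infinity> N (laplace_op 1 \<infinity> N g) \<le> Lp_norm 1 ?M g"
    proof (rule infty[OF g(1)])
      show "laplace_op 1 \<infinity> N g \<in> borel_measurable N"
        using ext g(1) by (auto simp: is_laplace_extension_def bounded_linear_Lp_def Lp_def)
      show "AE z in N. laplace_op 1 \<infinity> N g z = laplace g z"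
        using ext g(1) by (auto simp: is_laplace_extension_def)
    qed
    then show "Lp_norm \<infinity> N (laplace_op 1 \<infinity> N g) \<le> 1" using g(2) by (rule order_trans)
  qed
  with ext show ?thesis ..
qed

text \<open>The exponent \<open>enn2real (1 / q)\<close> unifies the cases: it is 0 for
  \<open>q = \<infinity>\<close>, where the bound becomes \<open>B powr 0 = 1\<close>, and 1/q in
  the real sense otherwise.\<close>

lemma laplace_op_bound:
  fixes p q :: ennreal
  assumes "1 \<le> p" "p \<le> 2" "1 / p + 1 / q = 1"
  shows "is_laplace_extension p q N (laplace_op p q N)"
    and "laplace_opnorm p q N \<le> ennreal (B powr enn2real (1 / q))"
proof -
  have "is_laplace_extension p q N (laplace_op p q N) \<and> laplace_opnorm p q N \<le> ennreal (B powr enn2real (1 / q))"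
  proof (cases "p = 1")
    case True
    have "1 + 1 / q = 1 + 0" using assms(3) True by simp
    then have "1 / q = 0" by (subst (asm) ennreal_add_left_cancel) auto
    then have "q = \<infinity>" by (simp add: ennreal_divide_eq_0_iff)
    then show ?thesis using laplace_L1_Linfinity True B_pos by simp
  next
    case False
    define p' q' where "p' = enn2real p" and "q' = enn2real q"
    have "p < \<infinity>" using assms(2) by (auto simp: le_less_trans)
    then have p: "p = ennreal p'" by (simp add: p'_def)
    have "1 \<le> p'" using assms(1) unfolding p by simp
    moreover have "p' \<noteq> 1" using False unfolding p by auto
    moreover have "p' \<le> 2"
      using assms(2) unfolding p by (simp add: ennreal_le_iff flip: ennreal_numeral)
    ultimately have p': "p' > 1" "p' \<le> 2" by simp_all
    \<comment> \<open>An infinite q would leave 1/p = 1 and contradict p > 1.\<close>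
    have q_inf: "q \<noteq> \<infinity>"
      using assms(3) p' unfolding p by (auto simp: divide_ennreal simp flip: ennreal_1)
    then have q: "q = ennreal q'" by (simp add: q'_def less_top)
    have "q \<noteq> 0" using assms(3) by auto
    then have "q' \<noteq> 0" unfolding q by auto
    moreover have "0 \<le> q'" by (simp add: q'_def)
    ultimately have q': "q' > 0" by simp
    have "ennreal (1 / p' + 1 / q') = ennreal 1"
      using assms(3) p' q' unfolding p q by (simp add: divide_ennreal flip: ennreal_1)
    then have conj: "1 / p' + 1 / q' = 1"
      using p' q' by (subst (asm) ennreal_inj) auto
    have "1 / 2 \<le> 1 / p'" using p' by (intro divide_left_mono) auto
    then have "1 / q' \<le> 1 / 2" using conj by simp
    then have "q' \<ge> 2" using q' by (simp add: field_simps)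
    then interpret laplace_Lp_bound N B p' q'
      using p' conj by unfold_locales
    have "enn2real (1 / q) = 1 / q'" using q' unfolding q by (simp add: divide_ennreal flip: ennreal_1)
    then show ?thesis
      using laplace_op_extension laplace_opnorm_le p q by simp
  qed
  then show "is_laplace_extension p q N (laplace_op p q N)"
    and "laplace_opnorm p q N \<le> ennreal (B powr enn2real (1 / q))" by auto
qed

end

section \<open>Lipschitz graphs\<close>

lemma space_arclength_measure [simp]: "space (arclength_measure I c) = c ` I"
  by (simp add: arclength_measure_def space_restrict_space)

lemma lipschitz_curve_dist_le:
  assumes "lam-lipschitz_on I f" "x \<in> I" "y \<in> I"
  shows "sqrt ((x - y)\<^sup>2 + (f x - f y)\<^sup>2) \<le> sqrt (1 + lam\<^sup>2) * \<bar>x - y\<bar>"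
proof -
  have "\<bar>f x - f y\<bar> \<le> lam * \<bar>x - y\<bar>"
    using lipschitz_onD[OF assms] by (simp add: dist_real_def)
  then have "(f x - f y)\<^sup>2 \<le> (lam * \<bar>x - y\<bar>)\<^sup>2"
    using power_mono[of "\<bar>f x - f y\<bar>" _ 2] by simp
  then have "(x - y)\<^sup>2 + (f x - f y)\<^sup>2 \<le> (1 + lam\<^sup>2) * (x - y)\<^sup>2"
    by (simp add: power_mult_distrib algebra_simps)
  then have "sqrt ((x - y)\<^sup>2 + (f x - f y)\<^sup>2) \<le> sqrt ((1 + lam\<^sup>2) * (x - y)\<^sup>2)" by simp
  then show ?thesis by (simp add: real_sqrt_mult)
qed

text \<open>Reduces a curve to an estimate in the parameter. Arclength costs the Lipschitz constant
  sqrt (1 + lam^2) of the curve, which is enlarged to 1 + lam^2 as in the stated bounds.\<close>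

lemma laplace_L2_bound_arclength:
  assumes I: "is_interval I" and Re: "\<And>x. x \<in> I \<Longrightarrow> 0 \<le> Re (c x)"
    and dist: "\<And>x y. x \<in> I \<Longrightarrow> y \<in> I \<Longrightarrow> dist (c x) (c y) \<le> sqrt (1 + lam\<^sup>2) * \<bar>x - y\<bar>"
    and A: "0 < A" and L2: "\<And>g. integrable lebesgue_pos g \<Longrightarrow>
      (\<integral>\<^sup>+x. ennreal ((norm (laplace g (c x)))\<^sup>2) * indicator I x \<partial>lborel) \<le>
        ennreal A * (\<integral>\<^sup>+t. ennreal ((norm (g t))\<^sup>2) \<partial>lebesgue_pos)"
  shows "laplace_L2_bound (arclength_measure I c) (A * (1 + lam\<^sup>2))"
proof
  show "(\<lambda>z. z) \<in> borel_measurable (arclength_measure I c)"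
    by (subst measurable_cong_sets[OF sets_arclength_measure refl]) (simp add: measurable_restrict_space1)
  show "0 \<le> Re z" if "z \<in> space (arclength_measure I c)" for z
    using that Re by auto
  show "0 < A * (1 + lam\<^sup>2)" using A by (simp add: add_pos_nonneg)
  fix g :: "real \<Rightarrow> complex" assume g: "integrable lebesgue_pos g"
  have lam: "sqrt (1 + lam\<^sup>2) \<le> 1 + lam\<^sup>2"
    by (rule real_le_lsqrt) (auto intro!: self_le_power)
  have [measurable]: "laplace g \<in> borel_measurable borel"
    using g by (intro borel_measurable_laplace) auto
  have "(\<integral>\<^sup>+z. ennreal ((norm (laplace g z))\<^sup>2) \<partial>arclength_measure I c) \<le>
      ennreal (sqrt (1 + lam\<^sup>2)) * (\<integral>\<^sup>+x. ennreal ((norm (laplace g (c x)))\<^sup>2) * indicator I x \<partial>lborel)"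
    by (intro nn_integral_arclength_le I dist) auto
  also have "\<dots> \<le> ennreal (1 + lam\<^sup>2) * (ennreal A * (\<integral>\<^sup>+t. ennreal ((norm (g t))\<^sup>2) \<partial>lebesgue_pos))"
    by (intro mult_mono L2 g ennreal_leI lam) auto
  also have "\<dots> = ennreal (A * (1 + lam\<^sup>2)) * (\<integral>\<^sup>+t. ennreal ((norm (g t))\<^sup>2) \<partial>lebesgue_pos)"
    using A by (simp add: ennreal_mult' mult_ac)
  finally show "(\<integral>\<^sup>+z. ennreal ((norm (laplace g z))\<^sup>2) \<partial>arclength_measure I c) \<le>
      ennreal (A * (1 + lam\<^sup>2)) * (\<integral>\<^sup>+t. ennreal ((norm (g t))\<^sup>2) \<partial>lebesgue_pos)" .
qed

text \<open>The height f(x) enters the kernel only through a phase, so it disappears with the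
  absolute value and the half-line estimate in x applies.\<close>

lemma laplace_L2_bound_graph:
  assumes I: "is_interval I" "I \<subseteq> {0<..}" and f: "lam-lipschitz_on I f"
  shows "laplace_L2_bound (arclength_measure I (graph_curve f)) (32 * pi * (1 + lam\<^sup>2))"
proof (rule laplace_L2_bound_arclength[OF I(1)])
  show "0 \<le> Re (graph_curve f x)" if "x \<in> I" for x
    using that I(2) by (auto simp: graph_curve_def)
  show "dist (graph_curve f x) (graph_curve f y) \<le> sqrt (1 + lam\<^sup>2) * \<bar>x - y\<bar>" if "x \<in> I" "y \<in> I" for x y
    using lipschitz_curve_dist_le[OF f that] by (simp add: graph_curve_def dist_complex_def cmod_def)
  fix g :: "real \<Rightarrow> complex" assume g: "integrable lebesgue_pos g"
  have g_meas: "g \<in> borel_measurable lebesgue_pos" using g by auto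
  obtain g' where g': "g' \<in> borel_measurable borel" "\<And>t. t \<le> 0 \<Longrightarrow> g' t = 0" "AE t in lebesgue_pos. g t = g' t"
    by (rule lebesgue_pos_borel_representative[OF g_meas]) (rule that)
  have [measurable]: "g' \<in> borel_measurable borel" by fact
  have le: "ennreal (norm (laplace g (graph_curve f x))) \<le> (\<integral>\<^sup>+t. ennreal (norm (g' t) * exp (- (x * t))) \<partial>lborel)" if "x \<in> I" for x
  proof -
    have "0 \<le> Re (graph_curve f x)" using that I(2) by (auto simp: graph_curve_def)
    then have "ennreal (norm (laplace g (graph_curve f x))) \<le>
        (\<integral>\<^sup>+t. ennreal (norm (g t * exp (- (graph_curve f x * of_real t)))) \<partial>lebesgue_pos)"
      unfolding laplace_def by (intro integral_norm_bound_ennreal laplace_integrand_integrable g)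
    also have "\<dots> = (\<integral>\<^sup>+t. ennreal (norm (g' t * exp (- (graph_curve f x * of_real t)))) \<partial>lborel)"
      by (rule nn_integral_lebesgue_pos_representative[OF g'(3,1,2)]) auto
    also have "\<dots> = (\<integral>\<^sup>+t. ennreal (norm (g' t) * exp (- (x * t))) \<partial>lborel)"
      by (simp add: norm_mult graph_curve_def)
    finally show ?thesis .
  qed
  have "(\<integral>\<^sup>+x. ennreal ((norm (laplace g (graph_curve f x)))\<^sup>2) * indicator I x \<partial>lborel) \<le>
      (\<integral>\<^sup>+x. (\<integral>\<^sup>+t. ennreal (norm (g' t) * exp (- (x * t))) \<partial>lborel)\<^sup>2 * indicator {0<..} x \<partial>lborel)"
  proof (intro nn_integral_mono)
    fix x
    show "ennreal ((norm (laplace g (graph_curve f x)))\<^sup>2) * indicator I x \<le>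
      (\<integral>\<^sup>+t. ennreal (norm (g' t) * exp (- (x * t))) \<partial>lborel)\<^sup>2 * indicator {0<..} x"
      using power_mono[OF le, of x 2] I(2) by (cases "x \<in> I") (auto simp: ennreal_power)
  qed
  also have "\<dots> \<le> ennreal pi * (\<integral>\<^sup>+t. ennreal ((norm (g' t))\<^sup>2) \<partial>lborel)"
    by (rule nn_integral_laplace_sq_le) (auto simp: g')
  also have "(\<integral>\<^sup>+t. ennreal ((norm (g' t))\<^sup>2) \<partial>lborel) = (\<integral>\<^sup>+t. ennreal ((norm (g t))\<^sup>2) \<partial>lebesgue_pos)"
    by (rule nn_integral_lebesgue_pos_representative[OF g'(3,1,2), symmetric]) auto
  \<comment> \<open>Here the sharper constant pi is weakened to the stated one.\<close>
  also have "ennreal pi * \<dots> \<le> ennreal (32 * pi) * \<dots>"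
    by (intro mult_right_mono ennreal_leI) auto
  finally show "(\<integral>\<^sup>+x. ennreal ((norm (laplace g (graph_curve f x)))\<^sup>2) * indicator I x \<partial>lborel) \<le>
      ennreal (32 * pi) * (\<integral>\<^sup>+t. ennreal ((norm (g t))\<^sup>2) \<partial>lebesgue_pos)" .
qed simp

text \<open>Now the oscillation is essential: the parameter is the imaginary part, and f may vanish,
  so absolute values would destroy all decay. The global estimate over the imaginary axis is applied
  to an extension of f.\<close>

lemma laplace_L2_bound_swapped_graph:
  assumes I: "is_interval I" and f: "lam-lipschitz_on I f" "\<And>x. x \<in> I \<Longrightarrow> 0 \<le> f x"
  shows "laplace_L2_bound (arclength_measure I (swapped_graph_curve f)) (36 * 32 * pi * (1 + lam\<^sup>2))"
proof (rule laplace_L2_bound_arclength[OF I])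
  show "0 \<le> Re (swapped_graph_curve f x)" if "x \<in> I" for x
    using that f(2) by (auto simp: swapped_graph_curve_def)
  show "dist (swapped_graph_curve f x) (swapped_graph_curve f y) \<le> sqrt (1 + lam\<^sup>2) * \<bar>x - y\<bar>" if "x \<in> I" "y \<in> I" for x y
    using lipschitz_curve_dist_le[OF f(1) that] by (simp add: swapped_graph_curve_def dist_complex_def cmod_def add.commute)
  fix g :: "real \<Rightarrow> complex" assume g: "integrable lebesgue_pos g"
  have g_meas: "g \<in> borel_measurable lebesgue_pos" using g by auto
  obtain g' where g': "g' \<in> borel_measurable borel" "\<And>t. t \<le> 0 \<Longrightarrow> g' t = 0" "AE t in lebesgue_pos. g t = g' t"
    by (rule lebesgue_pos_borel_representative[OF g_meas]) (rule that)
  have [measurable]: "g' \<in> borel_measurable borel" by fact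
  have g'_int: "integrable lborel g'"
    using g nn_integral_lebesgue_pos_representative[OF g'(3,1,2), of "\<lambda>_ w. ennreal (norm w)"]
    by (simp add: integrable_iff_bounded)
  \<comment> \<open>Extension by 0 preserves nonnegativity and Borel measurability. It need not be
    Lipschitz, which the global estimate does not ask for.\<close>
  define f' where "f' x = (if x \<in> I then f x else 0)" for x
  have I_borel: "I \<in> sets borel" using I by (rule real_interval_borel_measurable)
  have "f \<in> borel_measurable (restrict_space borel I)"
    by (intro borel_measurable_continuous_on_restrict lipschitz_on_continuous_on[OF f(1)])
  then have f'[measurable]: "f' \<in> borel_measurable borel"
    unfolding f'_def using I_borel by (intro measurable_If_restrict_space_iff[THEN iffD2]) auto
  have "(\<integral>\<^sup>+x. ennreal ((norm (laplace g (swapped_graph_curve f x)))\<^sup>2) * indicator I x \<partial>lborel) \<le>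
    (\<integral>\<^sup>+x. ennreal ((norm (LINT t|lborel. g' t * exp (- ((of_real (f' x) + \<i> * of_real x) * of_real t))))\<^sup>2) \<partial>lborel)"
    by (intro nn_integral_mono)
       (auto simp: laplace_representative[OF g'(3,1,2) g_meas] swapped_graph_curve_def f'_def Complex_eq split: split_indicator)
  also have "\<dots> \<le> ennreal (16 * pi) * (\<integral>\<^sup>+t. ennreal ((norm (g' t))\<^sup>2) \<partial>lborel)"
    using f(2) by (intro laplace_graph_L2_le f' g'_int g'(2)) (auto simp: f'_def)
  also have "(\<integral>\<^sup>+t. ennreal ((norm (g' t))\<^sup>2) \<partial>lborel) = (\<integral>\<^sup>+t. ennreal ((norm (g t))\<^sup>2) \<partial>lebesgue_pos)"
    by (rule nn_integral_lebesgue_pos_representative[OF g'(3,1,2), symmetric]) auto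
  also have "ennreal (16 * pi) * \<dots> \<le> ennreal (36 * 32 * pi) * \<dots>"
    by (intro mult_right_mono ennreal_leI) auto
  finally show "(\<integral>\<^sup>+x. ennreal ((norm (laplace g (swapped_graph_curve f x)))\<^sup>2) * indicator I x \<partial>lborel) \<le>
      ennreal (36 * 32 * pi) * (\<integral>\<^sup>+t. ennreal ((norm (g t))\<^sup>2) \<partial>lebesgue_pos)" .
qed simp

theorem theorem8:
  fixes p q :: ennreal and lam :: real
  assumes "1 \<le> p" and "p \<le> 2" and "1 / p + 1 / q = 1" and "0 \<le> lam"
  shows
    "(\<forall>I. is_interval I \<and> I \<subseteq> {0<..} \<longrightarrow>
        (\<forall>f. lam-lipschitz_on I f \<longrightarrow>
           is_laplace_extension p q (arclength_measure I (graph_curve f))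
             (laplace_op p q (arclength_measure I (graph_curve f)))) \<and>
        (SUP f \<in> {f. lam-lipschitz_on I f}.
           laplace_opnorm p q (arclength_measure I (graph_curve f)))
          \<le> ennreal ((32 * pi * (1 + lam\<^sup>2)) powr enn2real (1 / q))) \<and>
     (\<forall>I. is_interval I \<longrightarrow>
        (\<forall>f. lam-lipschitz_on I f \<and> (\<forall>x\<in>I. 0 \<le> f x) \<longrightarrow>
           is_laplace_extension p q (arclength_measure I (swapped_graph_curve f))
             (laplace_op p q (arclength_measure I (swapped_graph_curve f)))) \<and>
        (SUP f \<in> {f. lam-lipschitz_on I f \<and> (\<forall>x\<in>I. 0 \<le> f x)}.
           laplace_opnorm p q (arclength_measure I (swapped_graph_curve f)))
          \<le> ennreal ((36 * 32 * pi * (1 + lam\<^sup>2)) powr enn2real (1 / q)))"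
proof -
  note bound = laplace_L2_bound.laplace_op_bound[OF _ assms(1-3)]
  note bound_a = bound[OF laplace_L2_bound_graph]
  note bound_b = bound[OF laplace_L2_bound_swapped_graph]
  show ?thesis
  proof (intro conjI allI impI)
    fix I :: "real set" and f :: "real \<Rightarrow> real"
    assume "is_interval I \<and> I \<subseteq> {0<..}" "lam-lipschitz_on I f"
    then show "is_laplace_extension p q (arclength_measure I (graph_curve f))
        (laplace_op p q (arclength_measure I (graph_curve f)))"
      by (intro bound_a(1)) auto
  next
    fix I :: "real set"
    assume "is_interval I \<and> I \<subseteq> {0<..}"
    then show "(SUP f \<in> {f. lam-lipschitz_on I f}. laplace_opnorm p q (arclength_measure I (graph_curve f)))
        \<le> ennreal ((32 * pi * (1 + lam\<^sup>2)) powr enn2real (1 / q))"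
      by (intro SUP_least bound_a(2)) auto
  next
    fix I :: "real set" and f :: "real \<Rightarrow> real"
    assume "is_interval I" "lam-lipschitz_on I f \<and> (\<forall>x\<in>I. 0 \<le> f x)"
    then show "is_laplace_extension p q (arclength_measure I (swapped_graph_curve f))
        (laplace_op p q (arclength_measure I (swapped_graph_curve f)))"
      by (intro bound_b(1)) auto
  next
    fix I :: "real set"
    assume "is_interval I"
    then show "(SUP f \<in> {f. lam-lipschitz_on I f \<and> (\<forall>x\<in>I. 0 \<le> f x)}.
          laplace_opnorm p q (arclength_measure I (swapped_graph_curve f)))
        \<le> ennreal ((36 * 32 * pi * (1 + lam\<^sup>2)) powr enn2real (1 / q))"
      by (intro SUP_least bound_b(2)) auto
  qed
qed

end
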